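(* Let $F$ be a field of characteristic zero and consider the subalgebras $M_1=Fe_{22}\oplus Fe_{12}$ and $M_2=Fe_{11}\oplus Fe_{12}$ of the algebra of $2\times 2$ matrices over $F$ ($e_{ij}$ are the matrix units). On $M_1$ let $\varepsilon,\delta$ be the derivations $\varepsilon(\alpha e_{22}+\beta e_{12})=\beta e_{12}$, $\delta(\alpha e_{22}+\beta e_{12})=\alpha e_{12}$, and on $M_2$ let $\varepsilon,\delta$ be the derivations $\varepsilon(\alpha e_{11}+\beta e_{12})=\beta e_{12}$, $\delta(\alpha e_{11}+\beta e_{12})=\alpha e_{12}$, for all $\alpha,\beta\in F$. Let $L$ be the $2$-dimensional metabelian Lie algebra with basis $\{\varepsilon,\delta\}$ and $[\varepsilon,\delta]=\delta$, and let $M_1^D$, $M_2^D$ denote $M_1$, $M_2$ regarded as $L$-algebras via these derivations, so that $L$ acts on $M_i$ as the Lie algebra $\mathrm{Der}(M_i)$ of all derivations of $M_i$, $i=1,2$. Then: (1) $\mathrm{Id}^L(M_1^D)=\langle xy^\varepsilon,\ x^\varepsilon y-y^\varepsilon x-[x,y],\ x^{\varepsilon^2}-x^\varepsilon,\ x^{\delta\varepsilon},\ x^{\varepsilon\delta}-x^\delta\rangle_{T_L}$ and $\mathrm{Id}^L(M_2^D)=\langle x^\varepsilon y,\ xy^\varepsilon-yx^\varepsilon-[x,y],\ x^{\varepsilon^2}-x^\varepsilon,\ x^{\delta\varepsilon},\ x^{\varepsilon\delta}-x^\delta\rangle_{T_L}$; (2) $c_n^L(M_1^D)=c_n^L(M_2^D)=n+2$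 for all $n\ge 1$; (3) $\chi_n^L(M_1^D)=\chi_n^L(M_2^D)=3\chi_{(n)}+\chi_{(n-1,1)}$ for all $n\ge 1$, where the term $\chi_{(n-1,1)}$ is omitted if $n=1$.
   Context: An $L$-algebra is an associative algebra $A$ over $F$ (not necessarily unital) on which a Lie algebra $L$ acts by derivations; the action extends to the universal enveloping algebra $U(L)$, products acting by composition, i.e. $(gh)(a)=g(h(a))$. Fix a basis $\mathcal B\ni 1$ of $U(L)$. $F\langle X|L\rangle$ is the free associative algebra (without constant terms) on the free generators $x_j^{h}$, $h\in\mathcal B$, $j\in\mathbb N$; one writes $x_j=x_j^1$ and extends $x_j^h$ linearly to all $h\in U(L)$. $U(L)$ acts on it with each $\gamma\in L$ acting as the derivation with $\gamma(x_j^h)=x_j^{\gamma h}$; for a polynomial $f$ and $h\in U(L)$, $f^h=h(f)$. In particular $x^{gh}=g(h(x))$. Elements are differential polynomials; $f(x_1,\dots,x_n)$ is a differential identity of $A$ if it vanishes under all substitutions $x_i\mapsto a_i\in A$ (with $x_i^h\mapsto h(a_i)$). $\mathrm{Id}^L(A)$ is the set of differential identities of $A$. A $T_L$-ideal is a two-sided ideal of $F\langle X|L\rangle$ stable under the $U(L)$-action and under all substitutions $x_j\mapsto g_j\in F\langle X|L\rangle$ (with $x_j^h\mapsto h(g_j)$); $\langle S\rangle_{T_L}$ is the $T_L$-ideal generated by $S$. Letters $x,y$ denote distinct variables of $X=\{x_1,x_2,\dots\}$, and $[x,y]=xy-yx$. $P_n^L=\mathrm{span}_F\{x_{\sigma(1)}^{h_1}\cdots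 x_{\sigma(n)}^{h_n}\mid \sigma\in S_n,\ h_i\in\mathcal B\}$ is the space of multilinear differential polynomials in $x_1,\dots,x_n$, with $S_n$ acting by $\sigma(x_i^h)=x_{\sigma(i)}^h$. The $n$th differential codimension is $c_n^L(A)=\dim_F P_n^L/(P_n^L\cap \mathrm{Id}^L(A))$ and the $n$th differential cocharacter $\chi_n^L(A)$ is the $S_n$-character of this quotient. For $\lambda\vdash n$, $\chi_\lambda$ is the irreducible $S_n$-character associated to $\lambda$. *)

theory Defs
  imports "HOL-Analysis.Analysis" "HOL-Library.Poly_Mapping"
begin

section \<open>Free associative algebras\<close>

text \<open>
  Words form a free monoid, so \<open>'a list \<Rightarrow>\<^sub>0 'f\<close> with the convolution product of
  \<^theory>\<open>HOL-Library.Poly_Mapping\<close> is the free unital associative algebra over \<open>'f\<close> on the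
  set \<open>UNIV :: 'a set\<close>.
\<close>

instantiation list :: (type) monoid_add
begin

definition zero_list :: "'a list" where "zero_list = []"

definition plus_list :: "'a list \<Rightarrow> 'a list \<Rightarrow> 'a list" where "plus_list = append"

instance
  by standard (simp_all add: zero_list_def plus_list_def)

end

lift_definition smul :: "'f::field \<Rightarrow> ('k \<Rightarrow>\<^sub>0 'f) \<Rightarrow> ('k \<Rightarrow>\<^sub>0 'f)"
  is "\<lambda>c f k. c * f k"
  by (rule finite_subset[rotated]) auto

lemma lookup_smul [simp]: "Poly_Mapping.lookup (smul c f) k = c * Poly_Mapping.lookup f k"
  by transfer simp

interpretation pm: vector_space smul
  by standard (auto intro!: poly_mapping_eqI simp: lookup_add algebra_simps)

lemma smul_single [simp]: "smul c (Poly_Mapping.single k d) = Poly_Mapping.single k (c * d)"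
  by (rule poly_mapping_eqI) (simp add: lookup_single when_def)

lemma keys_smul: "c \<noteq> 0 \<Longrightarrow> Poly_Mapping.keys (smul c f) = Poly_Mapping.keys f"
  by (auto simp: in_keys_iff)

lemma lookup_mult_keys:
  "Poly_Mapping.lookup (f * g) k = (\<Sum>l\<in>Poly_Mapping.keys f. Poly_Mapping.lookup f l *
     (\<Sum>q\<in>Poly_Mapping.keys g. Poly_Mapping.lookup g q when k = l + q))"
proof -
  have inner: "(\<Sum>q. Poly_Mapping.lookup g q when k = l + q)
      = (\<Sum>q\<in>Poly_Mapping.keys g. Poly_Mapping.lookup g q when k = l + q)" for l
    by (rule Sum_any.expand_superset) (auto simp: in_keys_iff when_def)
  show ?thesis
    unfolding lookup_mult inner
    by (rule Sum_any.expand_superset) (auto simp: in_keys_iff)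
qed

lemma smul_mult_left: "smul c f * g = smul c (f * g)" for f :: "'k::monoid_add \<Rightarrow>\<^sub>0 'f::field"
proof (cases "c = 0")
  case False
  then show ?thesis
    by (intro poly_mapping_eqI)
      (simp add: lookup_mult_keys keys_smul sum_distrib_left mult.assoc)
qed simp

lemma smul_mult_right: "f * smul c g = smul c (f * g)" for f :: "'k::monoid_add \<Rightarrow>\<^sub>0 'f::field"
proof (cases "c = 0")
  case False
  then show ?thesis
    by (intro poly_mapping_eqI)
      (simp add: lookup_mult_keys keys_smul sum_distrib_left mult_when mult.left_commute)
qed simp

definition lin_ext :: "('f \<Rightarrow> 'a \<Rightarrow> 'a) \<Rightarrow> ('k \<Rightarrow> 'a) \<Rightarrow> ('k \<Rightarrow>\<^sub>0 'f::field) \<Rightarrow> 'a::ab_group_add"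
  where "lin_ext sc g f = (\<Sum>k\<in>Poly_Mapping.keys f. sc (Poly_Mapping.lookup f k) (g k))"

context vector_space
begin

lemma lin_ext_superset:
  "finite K \<Longrightarrow> Poly_Mapping.keys f \<subseteq> K \<Longrightarrow> lin_ext scale g f = (\<Sum>k\<in>K. Poly_Mapping.lookup f k *s g k)"
  unfolding lin_ext_def by (rule sum.mono_neutral_left) (auto simp: in_keys_iff)

lemma lin_ext_0 [simp]: "lin_ext scale g 0 = 0"
  by (simp add: lin_ext_def)

lemma lin_ext_add: "lin_ext scale g (f + f') = lin_ext scale g f + lin_ext scale g f'"
  using keys_add[of f f']
  by (simp add: lin_ext_superset[of "Poly_Mapping.keys f \<union> Poly_Mapping.keys f'"] lookup_add scale_left_distrib
      sum.distrib)

lemma lin_ext_smul: "lin_ext scale g (smul c f) = c *s lin_ext scale g f"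
  by (cases "c = 0") (simp_all add: lin_ext_def keys_smul scale_sum_right)

lemma lin_ext_minus: "lin_ext scale g (- f) = - lin_ext scale g f"
  using lin_ext_add[of g f "- f"] by (simp add: eq_neg_iff_add_eq_0 add.commute)

lemma lin_ext_diff: "lin_ext scale g (f - f') = lin_ext scale g f - lin_ext scale g f'"
  using lin_ext_add[of g f "- f'"] by (simp add: lin_ext_minus)

lemma lin_ext_single [simp]: "lin_ext scale g (Poly_Mapping.single k c) = c *s g k"
  by (simp add: lin_ext_def)

lemma lin_ext_sum: "lin_ext scale g (sum F I) = (\<Sum>i\<in>I. lin_ext scale g (F i))"
  by (induction I rule: infinite_finite_induct) (simp_all add: lin_ext_add)

end


section \<open>The Lie algebra and its universal enveloping algebra\<close>

text \<open>
  The Lie algebra \<open>L\<close> is \<open>'f^2\<close>, where \<open>\<epsilon>\<close> and \<open>\<delta>\<close> are the two coordinate vectors.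
\<close>

definition lie_eps :: "'f::field ^ 2" where "lie_eps = axis 1 1"

definition lie_del :: "'f::field ^ 2" where "lie_del = axis 2 1"

definition bracket :: "'f::field ^ 2 \<Rightarrow> 'f ^ 2 \<Rightarrow> 'f ^ 2"
  where "bracket u v = (u $ 1 * v $ 2 - u $ 2 * v $ 1) *s lie_del"

lemma bracket_eps_del: "bracket lie_eps lie_del = lie_del"
  by (simp add: bracket_def lie_eps_def lie_del_def axis_def)

lemma lie_basis: "u = u $ 1 *s lie_eps + u $ 2 *s lie_del"
  by (simp add: vec_eq_iff forall_2 lie_eps_def lie_del_def axis_def)

lemma bracket_nth: "bracket u v $ 1 = 0" "bracket u v $ 2 = u $ 1 * v $ 2 - u $ 2 * v $ 1"
  by (simp_all add: bracket_def lie_del_def axis_def)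

lemma bracket_lie:
  "bracket (u + u') v = bracket u v + bracket u' v"
  "bracket u (v + v') = bracket u v + bracket u v'"
  "bracket (c *s u) v = c *s bracket u v"
  "bracket u (c *s v) = c *s bracket u v"
  "bracket u u = 0"
  "bracket u (bracket v w) + bracket v (bracket w u) + bracket w (bracket u v) = 0"
  by (simp_all add: vec_eq_iff forall_2 bracket_nth algebra_simps)

text \<open>
  \<open>U(L)\<close> is the free unital algebra on the underlying set of \<open>L\<close>, modulo the relations that make
  the canonical map from \<open>L\<close> linear and the bracket the commutator.
\<close>

inductive_set uea_ideal :: "(('f::field ^ 2) list \<Rightarrow>\<^sub>0 'f) set" where
  add_rel: "Poly_Mapping.single [u + v] 1 - Poly_Mapping.single [u] 1 - Poly_Mapping.single [v] 1
    \<in> uea_ideal"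
| scale_rel: "Poly_Mapping.single [c *s u] 1 - smul c (Poly_Mapping.single [u] 1) \<in> uea_ideal"
| bracket_rel: "Poly_Mapping.single [u] 1 * Poly_Mapping.single [v] 1
    - Poly_Mapping.single [v] 1 * Poly_Mapping.single [u] 1
    - Poly_Mapping.single [bracket u v] 1 \<in> uea_ideal"
| ideal_add: "f \<in> uea_ideal \<Longrightarrow> g \<in> uea_ideal \<Longrightarrow> f + g \<in> uea_ideal"
| ideal_mult: "f \<in> uea_ideal \<Longrightarrow> p * f * q \<in> uea_ideal"

lemma uea_ideal_0: "0 \<in> uea_ideal"
  using ideal_mult[OF add_rel, of 0] by simp

lemma uea_ideal_left: "f \<in> uea_ideal \<Longrightarrow> p * f \<in> uea_ideal"
  using ideal_mult[of f p 1] by simp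

lemma uea_ideal_right: "f \<in> uea_ideal \<Longrightarrow> f * q \<in> uea_ideal"
  using ideal_mult[of f 1 q] by simp

lemma uea_ideal_uminus: "f \<in> uea_ideal \<Longrightarrow> - f \<in> uea_ideal"
  using uea_ideal_left[of f "-1"] by simp

lemma uea_ideal_smul: "f \<in> uea_ideal \<Longrightarrow> smul c f \<in> uea_ideal"
  using uea_ideal_left[of f "smul c 1"] by (simp add: smul_mult_left)

lemma lookup_mult_Nil: "Poly_Mapping.lookup (f * g) [] = Poly_Mapping.lookup f [] * Poly_Mapping.lookup g []"
  for f g :: "'a list \<Rightarrow>\<^sub>0 'f::field"
proof -
  have "(\<Sum>l\<in>Poly_Mapping.keys f. Poly_Mapping.lookup f l * (\<Sum>q\<in>Poly_Mapping.keys g. Poly_Mapping.lookup g q when [] = l @ q))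
      = (\<Sum>l\<in>Poly_Mapping.keys f. if l = [] then Poly_Mapping.lookup f [] * Poly_Mapping.lookup g [] else 0)"
  proof (rule sum.cong)
    fix l :: "'a list"
    show "Poly_Mapping.lookup f l * (\<Sum>q\<in>Poly_Mapping.keys g. Poly_Mapping.lookup g q when [] = l @ q)
        = (if l = [] then Poly_Mapping.lookup f [] * Poly_Mapping.lookup g [] else 0)"
      by (cases l) (auto simp: when_def in_keys_iff sum.delta)
  qed simp
  also have "\<dots> = Poly_Mapping.lookup f [] * Poly_Mapping.lookup g []"
    by (auto simp: sum.delta in_keys_iff)
  finally show ?thesis
    by (simp add: lookup_mult_keys plus_list_def)
qed

lemma uea_ideal_augmentation: "f \<in> uea_ideal \<Longrightarrow> Poly_Mapping.lookup f [] = 0"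
  by (induction rule: uea_ideal.induct)
    (simp_all add: lookup_add lookup_minus lookup_mult_Nil lookup_single)

definition uea_rel :: "(('f::field ^ 2) list \<Rightarrow>\<^sub>0 'f) \<Rightarrow> (('f ^ 2) list \<Rightarrow>\<^sub>0 'f) \<Rightarrow> bool"
  where "uea_rel p q \<longleftrightarrow> p - q \<in> uea_ideal"

lemma equivp_uea_rel: "equivp uea_rel"
proof (rule equivpI)
  show "reflp uea_rel"
    by (auto intro: reflpI simp: uea_rel_def uea_ideal_0)
  show "symp uea_rel"
    using uea_ideal_uminus by (force intro: sympI simp: uea_rel_def)
  show "transp uea_rel"
    using ideal_add by (force intro: transpI simp: uea_rel_def)
qed

quotient_type (overloaded) 'f uea = "('f::field ^ 2) list \<Rightarrow>\<^sub>0 'f" / uea_rel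
  morphisms rep_uea abs_uea
  by (rule equivp_uea_rel)

instantiation uea :: (field) ring_1
begin

lift_definition zero_uea :: "'a uea" is 0 .

lift_definition one_uea :: "'a uea" is 1 .

lift_definition plus_uea :: "'a uea \<Rightarrow> 'a uea \<Rightarrow> 'a uea" is "(+)"
proof -
  fix p p' q q' :: "('a ^ 2) list \<Rightarrow>\<^sub>0 'a"
  assume "uea_rel p p'" "uea_rel q q'"
  then have "(p - p') + (q - q') \<in> uea_ideal"
    unfolding uea_rel_def by (rule ideal_add)
  then show "uea_rel (p + q) (p' + q')"
    by (simp add: uea_rel_def algebra_simps)
qed

lift_definition uminus_uea :: "'a uea \<Rightarrow> 'a uea" is uminus
proof -
  fix p p' :: "('a ^ 2) list \<Rightarrow>\<^sub>0 'a"
  assume "uea_rel p p'"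
  then have "- (p - p') \<in> uea_ideal"
    unfolding uea_rel_def by (rule uea_ideal_uminus)
  then show "uea_rel (- p) (- p')"
    by (simp add: uea_rel_def algebra_simps)
qed

definition minus_uea :: "'a uea \<Rightarrow> 'a uea \<Rightarrow> 'a uea" where "minus_uea a b = a + - b"

lift_definition times_uea :: "'a uea \<Rightarrow> 'a uea \<Rightarrow> 'a uea" is "(*)"
proof -
  fix p p' q q' :: "('a ^ 2) list \<Rightarrow>\<^sub>0 'a"
  assume "uea_rel p p'" "uea_rel q q'"
  moreover have "p * q - p' * q' = p * (q - q') + (p - p') * q'"
    by (simp add: algebra_simps)
  ultimately show "uea_rel (p * q) (p' * q')"
    unfolding uea_rel_def by (simp add: ideal_add uea_ideal_left uea_ideal_right)
qed

instance
proof
  fix a b c :: "'a uea"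
  have eq: "uea_rel p q" if "p = q" for p q :: "('a ^ 2) list \<Rightarrow>\<^sub>0 'a"
    using that by (simp add: uea_rel_def uea_ideal_0)
  show "a + b + c = a + (b + c)" by transfer (rule eq, simp add: add.assoc)
  show "a + b = b + a" by transfer (rule eq, simp add: add.commute)
  show "0 + a = a" by transfer (rule eq, simp)
  show "- a + a = 0" by transfer (rule eq, simp)
  show "a - b = a + - b" by (rule minus_uea_def)
  show "a * b * c = a * (b * c)" by transfer (rule eq, simp add: mult.assoc)
  show "(a + b) * c = a * c + b * c" by transfer (rule eq, simp add: distrib_right)
  show "a * (b + c) = a * b + a * c" by transfer (rule eq, simp add: distrib_left)
  show "1 * a = a" by transfer (rule eq, simp)
  show "a * 1 = a" by transfer (rule eq, simp)
  have "\<not> uea_rel 0 (1 :: ('a ^ 2) list \<Rightarrow>\<^sub>0 'a)"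
    using uea_ideal_augmentation[of "0 - 1"] by (auto simp: uea_rel_def lookup_one zero_list_def)
  then show "(0 :: 'a uea) \<noteq> 1" by transfer
qed

end

lift_definition uscale :: "'f::field \<Rightarrow> 'f uea \<Rightarrow> 'f uea" is smul
  using uea_ideal_smul by (auto simp: uea_rel_def simp flip: pm.scale_right_diff_distrib)

interpretation U: vector_space uscale
proof
  fix c d :: "'a::field" and a b :: "'a uea"
  have eq: "uea_rel p q" if "p = q" for p q :: "('a ^ 2) list \<Rightarrow>\<^sub>0 'a"
    using that by (simp add: uea_rel_def uea_ideal_0)
  show "uscale c (a + b) = uscale c a + uscale c b"
    by transfer (rule eq, rule pm.scale_right_distrib)
  show "uscale (c + d) a = uscale c a + uscale d a"
    by transfer (rule eq, rule pm.scale_left_distrib)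
  show "uscale c (uscale d a) = uscale (c * d) a" by transfer (rule eq, simp)
  show "uscale 1 a = a" by transfer (rule eq, simp)
qed

lift_definition lie_emb :: "'f::field ^ 2 \<Rightarrow> 'f uea" is "\<lambda>u. Poly_Mapping.single [u] 1" .

lemma lie_emb_linear:
  "lie_emb (u + v) = lie_emb u + lie_emb v" "lie_emb (c *s u) = uscale c (lie_emb u)"
proof -
  show "lie_emb (u + v) = lie_emb u + lie_emb v"
    by transfer (use add_rel in \<open>simp add: uea_rel_def diff_diff_eq\<close>)
  show "lie_emb (c *s u) = uscale c (lie_emb u)"
    by transfer (use scale_rel in \<open>simp add: uea_rel_def\<close>)
qed

lemma lie_emb_bracket: "lie_emb (bracket u v) = lie_emb u * lie_emb v - lie_emb v * lie_emb u"
proof -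
  have "lie_emb u * lie_emb v + - (lie_emb v * lie_emb u) + - lie_emb (bracket u v) = 0"
    by transfer (use bracket_rel in \<open>simp add: uea_rel_def\<close>)
  then show ?thesis by (simp add: algebra_simps)
qed

lemma ex_uea_basis: "\<exists>B. U.independent B \<and> U.span B = UNIV \<and> (1 :: 'f::field uea) \<in> B"
proof -
  have "U.independent {1 :: 'f uea}" by simp
  then show ?thesis
    using U.independent_extend_basis[of "{1}"] U.span_extend_basis[of "{1}"]
      U.extend_basis_superset[of "{1}"] by (intro exI[of _ "U.extend_basis {1}"]) simp
qed

lemma uscale_mult: "uscale c g * h = uscale c (g * h)" "g * uscale c h = uscale c (g * h)"
  by (transfer, simp add: uea_rel_def uea_ideal_0 smul_mult_left smul_mult_right)+


section \<open>Algebras with an action of \<open>L\<close> by derivations\<close>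

text \<open>
  The addition of an algebra is that of the ambient type; its carrier is a subspace.
\<close>

record ('f, 'a) L_struct =
  carr :: "'a set"
  scl :: "'f \<Rightarrow> 'a \<Rightarrow> 'a"
  mul :: "'a \<Rightarrow> 'a \<Rightarrow> 'a"
  act :: "'f ^ 2 \<Rightarrow> 'a \<Rightarrow> 'a"

definition derivations :: "('f::field, 'a::ab_group_add) L_struct \<Rightarrow> ('a \<Rightarrow> 'a) set"
  where "derivations A = {d.
    (\<forall>a\<in>carr A. d a \<in> carr A) \<and>
    (\<forall>a\<in>carr A. \<forall>b\<in>carr A. d (a + b) = d a + d b) \<and>
    (\<forall>c. \<forall>a\<in>carr A. d (scl A c a) = scl A c (d a)) \<and>
    (\<forall>a\<in>carr A. \<forall>b\<in>carr A. d (mul A a b) = mul A (d a) b + mul A a (d b))}"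

locale L_algebra = vector_space "scl A" for A :: "('f::field, 'a::ab_group_add) L_struct" +
  assumes subspace_carr: "subspace (carr A)"
    and mul_closed: "a \<in> carr A \<Longrightarrow> b \<in> carr A \<Longrightarrow> mul A a b \<in> carr A"
    and mul_assoc: "a \<in> carr A \<Longrightarrow> b \<in> carr A \<Longrightarrow> c \<in> carr A \<Longrightarrow>
      mul A (mul A a b) c = mul A a (mul A b c)"
    and mul_add_left: "a \<in> carr A \<Longrightarrow> b \<in> carr A \<Longrightarrow> c \<in> carr A \<Longrightarrow>
      mul A (a + b) c = mul A a c + mul A b c"
    and mul_add_right: "a \<in> carr A \<Longrightarrow> b \<in> carr A \<Longrightarrow> c \<in> carr A \<Longrightarrow>
      mul A a (b + c) = mul A a b + mul A a c"
    and mul_scl_left: "a \<in> carr A \<Longrightarrow> b \<in> carr A \<Longrightarrow> mul A (scl A r a) b = scl A r (mul A a b)"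
    and mul_scl_right: "a \<in> carr A \<Longrightarrow> b \<in> carr A \<Longrightarrow> mul A a (scl A r b) = scl A r (mul A a b)"
    and act_derivation: "act A u \<in> derivations A"
    and act_add: "a \<in> carr A \<Longrightarrow> act A (u + v) a = act A u a + act A v a"
    and act_scale: "a \<in> carr A \<Longrightarrow> act A (r *s u) a = scl A r (act A u a)"
    and act_bracket: "a \<in> carr A \<Longrightarrow>
      act A (bracket u v) a = act A u (act A v a) - act A v (act A u a)"

text \<open>
  The extension of the action to \<open>U(L)\<close>. It is independent of the chosen representative of a class
  in \<open>U(L)\<close>, and \<open>U(L)\<close> acts as an algebra; see \<open>uact_abs\<close> and \<open>uact_mult\<close> below.
\<close>

definition uact :: "('f::field, 'a::ab_group_add) L_struct \<Rightarrow> 'f uea \<Rightarrow> 'a \<Rightarrow> 'a"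
  where "uact A h a = lin_ext (scl A) (\<lambda>w. foldr (act A) w a) (rep_uea h)"

lemma poly_mapping_induct_add [case_names zero add single]:
  assumes "P 0" "\<And>f g. P f \<Longrightarrow> P g \<Longrightarrow> P (f + g)" "\<And>k c. P (Poly_Mapping.single k c)"
  shows "P (f :: 'k \<Rightarrow>\<^sub>0 'f::comm_monoid_add)"
proof -
  have "P (\<Sum>k\<in>K. Poly_Mapping.single k (Poly_Mapping.lookup f k))" for K
    by (induction K rule: infinite_finite_induct) (use assms in auto)
  moreover have "(\<Sum>k\<in>Poly_Mapping.keys f. Poly_Mapping.single k (Poly_Mapping.lookup f k)) = f"
    by (rule poly_mapping_eqI)
      (auto simp: lookup_sum lookup_single when_def sum.delta in_keys_iff)
  ultimately show ?thesis by metis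
qed

context L_algebra
begin

lemma act_props:
  "a \<in> carr A \<Longrightarrow> act A u a \<in> carr A"
  "a \<in> carr A \<Longrightarrow> b \<in> carr A \<Longrightarrow> act A u (a + b) = act A u a + act A u b"
  "a \<in> carr A \<Longrightarrow> act A u (scl A r a) = scl A r (act A u a)"
  "a \<in> carr A \<Longrightarrow> b \<in> carr A \<Longrightarrow> act A u (mul A a b) = mul A (act A u a) b + mul A a (act A u b)"
  using act_derivation[of u] by (auto simp: derivations_def)

abbreviation (input) word_act :: "(('f ^ 2) list \<Rightarrow>\<^sub>0 'f) \<Rightarrow> 'a \<Rightarrow> 'a"
  where "word_act p a \<equiv> lin_ext (scl A) (\<lambda>w. foldr (act A) w a) p"

lemma foldr_act_closed: "a \<in> carr A \<Longrightarrow> foldr (act A) w a \<in> carr A"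
  by (induction w) (auto simp: act_props)

lemma foldr_act_linear:
  "a \<in> carr A \<Longrightarrow> b \<in> carr A \<Longrightarrow> foldr (act A) w (a + b) = foldr (act A) w a + foldr (act A) w b"
  "a \<in> carr A \<Longrightarrow> foldr (act A) w (scl A r a) = scl A r (foldr (act A) w a)"
  by (induction w) (auto simp: act_props foldr_act_closed)

lemmas foldr_act_props = foldr_act_closed foldr_act_linear

lemma word_act_props:
  "a \<in> carr A \<Longrightarrow> word_act p a \<in> carr A"
  "a \<in> carr A \<Longrightarrow> b \<in> carr A \<Longrightarrow> word_act p (a + b) = word_act p a + word_act p b"
  "a \<in> carr A \<Longrightarrow> word_act p (scl A r a) = scl A r (word_act p a)"
proof -
  show "a \<in> carr A \<Longrightarrow> word_act p a \<in> carr A"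
    unfolding lin_ext_def
    by (intro subspace_sum subspace_scale subspace_carr foldr_act_props)
  show "a \<in> carr A \<Longrightarrow> b \<in> carr A \<Longrightarrow> word_act p (a + b) = word_act p a + word_act p b"
    by (simp add: lin_ext_def foldr_act_props scale_right_distrib sum.distrib)
  show "a \<in> carr A \<Longrightarrow> word_act p (scl A r a) = scl A r (word_act p a)"
    by (simp add: lin_ext_def foldr_act_props scale_sum_right mult.commute)
qed

lemma word_act_0: "word_act p 0 = 0"
  using word_act_props(3)[OF subspace_0[OF subspace_carr], where p = p and r = 0] by simp

lemma word_act_mult:
  assumes a: "a \<in> carr A"
  shows "word_act (p * q) a = word_act p (word_act q a)"
proof (induction p rule: poly_mapping_induct_add)
  case (single w c)
  show ?case
  proof (induction q rule: poly_mapping_induct_add)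
    case zero
    show ?case by (simp add: foldr_act_props(3)[OF subspace_0[OF subspace_carr], where w = w and r = 0, simplified])
  next
    case (add f g)
    then show ?case
      by (simp add: distrib_left lin_ext_add word_act_props a foldr_act_props scale_right_distrib)
  next
    case (single v d)
    show ?case by (simp add: mult_single plus_list_def foldr_act_props a)
  qed
qed (simp_all add: distrib_right lin_ext_add)

lemma word_act_ideal: "p \<in> uea_ideal \<Longrightarrow> a \<in> carr A \<Longrightarrow> word_act p a = 0"
proof (induction arbitrary: a rule: uea_ideal.induct)
  case (ideal_mult f p q)
  then show ?case by (simp add: word_act_mult word_act_props word_act_0)
qed (simp_all add: lin_ext_add lin_ext_diff lin_ext_smul act_add act_scale act_bracket
    mult_single plus_list_def)

lemma uact_abs: "a \<in> carr A \<Longrightarrow> uact A (abs_uea p) a = word_act p a"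
proof -
  assume a: "a \<in> carr A"
  have "uea_rel (rep_uea (abs_uea p)) p"
    using Quotient3_uea Quotient3_rep_abs uea_rel_def uea_ideal_0
    by (metis diff_self equivp_reflp equivp_uea_rel)
  then show ?thesis
    unfolding uea_rel_def uact_def using word_act_ideal[OF _ a] by (fastforce simp: lin_ext_diff)
qed

lemma abs_uea_cases: obtains p where "h = abs_uea p"
  by (metis Quotient3_abs_rep Quotient3_uea)

lemma uact_closed: "a \<in> carr A \<Longrightarrow> uact A h a \<in> carr A"
  by (cases h rule: abs_uea_cases) (simp add: uact_abs word_act_props)

lemma uact_mult: "a \<in> carr A \<Longrightarrow> uact A (g * h) a = uact A g (uact A h a)"
  by (cases g rule: abs_uea_cases; cases h rule: abs_uea_cases)
    (simp add: uact_abs times_uea.abs_eq word_act_mult word_act_props)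

lemma uact_1: "a \<in> carr A \<Longrightarrow> uact A 1 a = a"
  by (simp add: one_uea.abs_eq uact_abs lin_ext_def zero_list_def lookup_one)

lemma uact_lie_emb: "a \<in> carr A \<Longrightarrow> uact A (lie_emb u) a = act A u a"
  by (simp add: lie_emb.abs_eq uact_abs)

lemma uact_add: "a \<in> carr A \<Longrightarrow> uact A (g + h) a = uact A g a + uact A h a"
  by (cases g rule: abs_uea_cases; cases h rule: abs_uea_cases)
    (simp add: uact_abs plus_uea.abs_eq lin_ext_add)

lemma uact_uscale: "a \<in> carr A \<Longrightarrow> uact A (uscale c h) a = scl A c (uact A h a)"
  by (cases h rule: abs_uea_cases) (simp add: uact_abs uscale.abs_eq lin_ext_smul)

end


section \<open>Differential polynomials\<close>

text \<open>
  The letter \<open>(j, b)\<close> stands for the generator \<open>x\<^sub>j\<^sup>b\<close>, where \<open>j \<ge> 1\<close> and \<open>b\<close> is in the fixed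
  basis \<open>B\<close> of \<open>U(L)\<close>. The free algebra \<open>F\<langle>X|L\<rangle>\<close> is the set \<open>diff_polys B\<close>.
\<close>

type_synonym 'f dpoly = "(nat \<times> 'f uea) list \<Rightarrow>\<^sub>0 'f"

definition diff_polys :: "'f::field uea set \<Rightarrow> 'f dpoly set"
  where "diff_polys B =
    {f. \<forall>w\<in>Poly_Mapping.keys f. w \<noteq> [] \<and> (\<forall>(j, b)\<in>set w. 1 \<le> j \<and> b \<in> B)}"

text \<open>\<open>xgen B j h\<close> is \<open>x\<^sub>j\<^sup>h\<close> for arbitrary \<open>h \<in> U(L)\<close>.\<close>

definition xgen :: "'f::field uea set \<Rightarrow> nat \<Rightarrow> 'f uea \<Rightarrow> 'f dpoly"
  where "xgen B j h = (\<Sum>b | U.representation B h b \<noteq> 0.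
    Poly_Mapping.single [(j, b)] (U.representation B h b))"

definition dpoly_act :: "'f::field uea set \<Rightarrow> 'f ^ 2 \<Rightarrow> 'f dpoly \<Rightarrow> 'f dpoly"
  where "dpoly_act B u = lin_ext smul (\<lambda>w. \<Sum>i<length w.
    Poly_Mapping.single (take i w) 1 * xgen B (fst (w ! i)) (lie_emb u * snd (w ! i)) *
    Poly_Mapping.single (drop (Suc i) w) 1)"

definition free_L_algebra :: "'f::field uea set \<Rightarrow> ('f, 'f dpoly) L_struct"
  where "free_L_algebra B =
    \<lparr>carr = diff_polys B, scl = smul, mul = (*), act = dpoly_act B\<rparr>"

lemma xgen_superset:
  assumes "U.independent B" "finite S" "{b. U.representation B h b \<noteq> 0} \<subseteq> S"
  shows "xgen B j h = (\<Sum>b\<in>S. Poly_Mapping.single [(j, b)] (U.representation B h b))"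
  unfolding xgen_def using assms by (intro sum.mono_neutral_left) auto

lemma xgen_add:
  assumes B: "U.independent B" "U.span B = UNIV"
  shows "xgen B j (g + h) = xgen B j g + xgen B j h"
proof -
  let ?S = "{b. U.representation B g b \<noteq> 0} \<union> {b. U.representation B h b \<noteq> 0}"
  have "finite ?S"
    by (simp add: U.finite_representation)
  moreover have rep: "U.representation B (g + h) b = U.representation B g b + U.representation B h b"
    for b using U.representation_add[OF B(1), of h g] B(2) by (simp add: add.commute)
  ultimately show ?thesis
    using B by (subst (1 2 3) xgen_superset[of B ?S]) (auto simp: rep single_add sum.distrib)
qed

lemma xgen_uscale:
  assumes B: "U.independent B" "U.span B = UNIV"
  shows "xgen B j (uscale c h) = smul c (xgen B j h)"
proof -
  let ?S = "{b. U.representation B h b \<noteq> 0}"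
  have "finite ?S"
    by (simp add: U.finite_representation)
  moreover have rep: "U.representation B (uscale c h) b = c * U.representation B h b" for b
    using U.representation_scale[OF B(1), of h c] B(2) by simp
  ultimately show ?thesis
    using B by (subst (1 2) xgen_superset[of B ?S]) (auto simp: rep pm.scale_sum_right)
qed

lemma xgen_0: "U.independent B \<Longrightarrow> U.span B = UNIV \<Longrightarrow> xgen B j 0 = 0"
  using xgen_uscale[of B j 0 0] by simp

lemma xgen_diff:
  assumes "U.independent B" "U.span B = UNIV"
  shows "xgen B j (g - h) = xgen B j g - xgen B j h"
  using xgen_add[OF assms, of j "g - h" h] by (simp add: algebra_simps)

lemma xgen_sum:
  assumes "U.independent B" "U.span B = UNIV"
  shows "xgen B j (sum f S) = (\<Sum>i\<in>S. xgen B j (f i))"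
  by (induction S rule: infinite_finite_induct) (simp_all add: xgen_add xgen_0 assms)

lemma xgen_basis:
  assumes "U.independent B" "b \<in> B"
  shows "xgen B j b = Poly_Mapping.single [(j, b)] 1"
  using assms
  by (subst xgen_superset[of B "{b}"]) (auto simp: U.representation_basis split: if_splits)

lemma keys_xgen: "w \<in> Poly_Mapping.keys (xgen B j h) \<Longrightarrow> \<exists>b\<in>B. w = [(j, b)]"
  unfolding xgen_def
  by (drule subsetD[OF keys_sum]) (auto dest: U.representation_ne_zero split: if_splits)

lemma subspace_diff_polys: "pm.subspace (diff_polys B)"
proof (rule pm.subspaceI)
  show "f + g \<in> diff_polys B" if "f \<in> diff_polys B" "g \<in> diff_polys B" for f g
    unfolding diff_polys_def
  proof (intro CollectI ballI)
    fix w assume "w \<in> Poly_Mapping.keys (f + g)"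
    then have "w \<in> Poly_Mapping.keys f \<or> w \<in> Poly_Mapping.keys g"
      using Poly_Mapping.keys_add[of f g] by auto
    then show "w \<noteq> [] \<and> (\<forall>(j, b)\<in>set w. 1 \<le> j \<and> b \<in> B)"
      using that by (elim disjE) (simp_all add: diff_polys_def)
  qed
  show "smul c f \<in> diff_polys B" if "f \<in> diff_polys B" for c f
    using that by (cases "c = 0") (simp_all add: diff_polys_def keys_smul)
qed (simp add: diff_polys_def)

lemma diff_polys_mult:
  assumes "f \<in> diff_polys B" "g \<in> diff_polys B"
  shows "f * g \<in> diff_polys B"
  unfolding diff_polys_def
proof (intro CollectI ballI)
  fix w assume "w \<in> Poly_Mapping.keys (f * g)"
  then obtain v v' where "w = v @ v'" "v \<in> Poly_Mapping.keys f" "v' \<in> Poly_Mapping.keys g"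
    using keys_mult[of f g] by (auto simp: plus_list_def)
  then show "w \<noteq> [] \<and> (\<forall>(j, b)\<in>set w. 1 \<le> j \<and> b \<in> B)"
    using assms by (auto simp: diff_polys_def)
qed

lemma single_Nil: "Poly_Mapping.single [] 1 = (1 :: 'a list \<Rightarrow>\<^sub>0 'f::field)"
  by (metis single_one zero_list_def)

lemma dpoly_act_Nil: "dpoly_act B u (Poly_Mapping.single [] c) = 0" "dpoly_act B u 1 = 0"
  by (simp_all add: dpoly_act_def flip: single_Nil)

lemma dpoly_act_Cons:
  "dpoly_act B u (Poly_Mapping.single (a # w) 1) =
     xgen B (fst a) (lie_emb u * snd a) * Poly_Mapping.single w 1 +
     Poly_Mapping.single [a] 1 * dpoly_act B u (Poly_Mapping.single w 1)"
proof -
  have Cons: "Poly_Mapping.single (a # take i w) 1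
      = (Poly_Mapping.single [a] 1 * Poly_Mapping.single (take i w) 1 :: 'a dpoly)" for i
    by (simp add: mult_single plus_list_def)
  show ?thesis
    by (simp add: dpoly_act_def sum.lessThan_Suc_shift single_Nil Cons sum_distrib_left mult.assoc
        del: sum.lessThan_Suc)
qed

lemma dpoly_act_append:
  "dpoly_act B u (Poly_Mapping.single (v @ w) 1) =
     dpoly_act B u (Poly_Mapping.single v 1) * Poly_Mapping.single w 1 +
     Poly_Mapping.single v 1 * dpoly_act B u (Poly_Mapping.single w 1)"
proof (induction v)
  case Nil
  show ?case
    by (simp add: dpoly_act_Nil single_Nil)
next
  case (Cons a v)
  have split: "Poly_Mapping.single (a # v) 1
      = (Poly_Mapping.single [a] 1 * Poly_Mapping.single v 1 :: 'a dpoly)"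
    "Poly_Mapping.single (v @ w) 1
      = (Poly_Mapping.single v 1 * Poly_Mapping.single w 1 :: 'a dpoly)"
    by (simp_all add: mult_single plus_list_def)
  have "dpoly_act B u (Poly_Mapping.single (a # v @ w) 1) =
      xgen B (fst a) (lie_emb u * snd a) * Poly_Mapping.single (v @ w) 1 +
      Poly_Mapping.single [a] 1 * dpoly_act B u (Poly_Mapping.single (v @ w) 1)"
    by (rule dpoly_act_Cons)
  also have "\<dots> = dpoly_act B u (Poly_Mapping.single (a # v) 1) * Poly_Mapping.single w 1 +
      Poly_Mapping.single (a # v) 1 * dpoly_act B u (Poly_Mapping.single w 1)"
    unfolding Cons.IH dpoly_act_Cons[of B u a v] by (simp add: split algebra_simps)
  finally show ?case by simp
qed

lemma dpoly_act_linear: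
  "dpoly_act B u (f + g) = dpoly_act B u f + dpoly_act B u g"
  "dpoly_act B u (f - g) = dpoly_act B u f - dpoly_act B u g"
  "dpoly_act B u (smul c f) = smul c (dpoly_act B u f)"
  "dpoly_act B u (sum F S) = (\<Sum>i\<in>S. dpoly_act B u (F i))"
  "dpoly_act B u 0 = 0"
  by (simp_all add: dpoly_act_def pm.lin_ext_add pm.lin_ext_diff pm.lin_ext_smul pm.lin_ext_sum)

lemma single_smul: "Poly_Mapping.single k c = smul c (Poly_Mapping.single k 1)"
  by simp

lemma dpoly_act_mult: "dpoly_act B u (f * g) = dpoly_act B u f * g + f * dpoly_act B u g"
proof (induction f rule: poly_mapping_induct_add)
  case (single v c)
  show ?case
  proof (induction g rule: poly_mapping_induct_add)
    case (single w d)
    define V W :: "'a dpoly"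
      where "V = Poly_Mapping.single v 1" and "W = Poly_Mapping.single w 1"
    have VW: "Poly_Mapping.single v c = smul c V" "Poly_Mapping.single w d = smul d W"
      by (simp_all add: V_def W_def)
    have "dpoly_act B u (V * W) = dpoly_act B u V * W + V * dpoly_act B u W"
      using dpoly_act_append[of B u v w] by (simp add: V_def W_def mult_single plus_list_def)
    then show ?case
      by (simp add: VW dpoly_act_linear smul_mult_left smul_mult_right pm.scale_right_distrib
          mult.commute)
  qed (simp_all add: dpoly_act_linear distrib_left)
qed (simp_all add: dpoly_act_linear distrib_right)

lemma dpoly_act_xgen:
  assumes B: "U.independent B" "U.span B = UNIV"
  shows "dpoly_act B u (xgen B j h) = xgen B j (lie_emb u * h)"
proof -
  let ?S = "{b. U.representation B h b \<noteq> 0}"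
  have "lie_emb u * h = lie_emb u * (\<Sum>b\<in>?S. uscale (U.representation B h b) b)"
    using B by (subst U.sum_nonzero_representation_eq) auto
  also have "xgen B j \<dots> = (\<Sum>b\<in>?S. smul (U.representation B h b) (xgen B j (lie_emb u * b)))"
    by (simp add: sum_distrib_left xgen_sum B uscale_mult xgen_uscale)
  also have "\<dots> = (\<Sum>b\<in>?S. dpoly_act B u (Poly_Mapping.single [(j, b)] (U.representation B h b)))"
  proof (rule sum.cong)
    fix b
    have "dpoly_act B u (Poly_Mapping.single [(j, b)] 1) = xgen B j (lie_emb u * b)"
      by (simp add: dpoly_act_Cons dpoly_act_Nil single_Nil)
    then show "smul (U.representation B h b) (xgen B j (lie_emb u * b))
        = dpoly_act B u (Poly_Mapping.single [(j, b)] (U.representation B h b))"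
      using dpoly_act_linear(3)[of B u "U.representation B h b" "Poly_Mapping.single [(j, b)] 1"]
      by simp
  qed simp
  also have "\<dots> = dpoly_act B u (xgen B j h)"
    by (simp add: xgen_def[of B j h] dpoly_act_linear)
  finally show ?thesis ..
qed

lemma keys_between:
  fixes X :: "'a list \<Rightarrow>\<^sub>0 'f::field"
  assumes "v \<in> Poly_Mapping.keys (Poly_Mapping.single a 1 * X * Poly_Mapping.single b 1)"
  obtains k where "k \<in> Poly_Mapping.keys X" "v = a @ k @ b"
proof -
  from assms obtain y where y: "y \<in> Poly_Mapping.keys (Poly_Mapping.single a 1 * X)" "v = y @ b"
    using keys_mult[of "Poly_Mapping.single a 1 * X" "Poly_Mapping.single b 1"]
    by (auto simp: plus_list_def)
  moreover from y(1) obtain k where "k \<in> Poly_Mapping.keys X" "y = a @ k"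
    using keys_mult[of "Poly_Mapping.single a 1" X] by (auto simp: plus_list_def)
  ultimately show ?thesis using that by simp
qed

lemma dpoly_act_closed:
  assumes "f \<in> diff_polys B"
  shows "dpoly_act B u f \<in> diff_polys B"
  unfolding dpoly_act_def lin_ext_def
proof (intro pm.subspace_sum pm.subspace_scale subspace_diff_polys)
  fix w i assume w: "w \<in> Poly_Mapping.keys f" and i: "i \<in> {..<length w}"
  let ?X = "xgen B (fst (w ! i)) (lie_emb u * snd (w ! i))"
  have ok: "1 \<le> j \<and> b \<in> B" if "(j, b) \<in> set w" for j b
    using assms w that by (auto simp: diff_polys_def)
  show "Poly_Mapping.single (take i w) 1 * ?X * Poly_Mapping.single (drop (Suc i) w) 1
      \<in> diff_polys B"
    unfolding diff_polys_def
  proof (intro CollectI ballI)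
    fix v assume "v \<in> Poly_Mapping.keys
      (Poly_Mapping.single (take i w) 1 * ?X * Poly_Mapping.single (drop (Suc i) w) 1)"
    then obtain k where "v = take i w @ k @ drop (Suc i) w" "k \<in> Poly_Mapping.keys ?X"
      by (elim keys_between)
    moreover from this obtain b where "b \<in> B" "k = [(fst (w ! i), b)]"
      using keys_xgen by blast
    moreover have "1 \<le> fst (w ! i)"
      using ok[of "fst (w ! i)" "snd (w ! i)"] i by simp
    ultimately show "v \<noteq> [] \<and> (\<forall>(j, b)\<in>set v. 1 \<le> j \<and> b \<in> B)"
      using ok by (auto dest: in_set_takeD in_set_dropD)
  qed
qed

lemma dpoly_act_bracket:
  assumes B: "U.independent B" "U.span B = UNIV" and f: "f \<in> diff_polys B"
  shows "dpoly_act B (bracket u v) f =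
    dpoly_act B u (dpoly_act B v f) - dpoly_act B v (dpoly_act B u f)"
proof -
  define E where "E g = dpoly_act B (bracket u v) g -
    (dpoly_act B u (dpoly_act B v g) - dpoly_act B v (dpoly_act B u g))" for g
  have E_mult: "E (g * h) = E g * h + g * E h" for g h
    by (simp add: E_def dpoly_act_mult dpoly_act_linear algebra_simps)
  have E_smul: "E (smul c g) = smul c (E g)" for c g
    by (simp add: E_def dpoly_act_linear pm.scale_right_diff_distrib)
  have E_sum: "E (sum F S) = (\<Sum>i\<in>S. E (F i))" for F :: "_ \<Rightarrow> _" and S
    by (simp add: E_def dpoly_act_linear sum_subtractf)
  have "E (Poly_Mapping.single w 1) = 0" if "snd ` set w \<subseteq> B" for w
    using that
  proof (induction w)
    case Nil
    show ?case by (simp add: E_def dpoly_act_Nil dpoly_act_linear)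
  next
    case (Cons a w)
    have "E (Poly_Mapping.single [a] 1) = E (xgen B (fst a) (snd a))"
      using Cons.prems B by (simp add: xgen_basis)
    also have "\<dots> = 0"
      by (simp add: E_def dpoly_act_xgen B lie_emb_bracket left_diff_distrib xgen_diff mult.assoc)
    finally have "E (Poly_Mapping.single [a] 1 * Poly_Mapping.single w 1) = 0"
      using Cons by (simp add: E_mult)
    then show ?case by (simp add: mult_single plus_list_def)
  qed
  then have zero: "E (smul (Poly_Mapping.lookup f w) (Poly_Mapping.single w 1)) = 0"
    if w: "w \<in> Poly_Mapping.keys f" for w
  proof -
    have "\<forall>(j, b)\<in>set w. 1 \<le> j \<and> b \<in> B"
      using f w by (simp add: diff_polys_def)
    then have "snd ` set w \<subseteq> B"
      by (simp add: image_subset_iff split_beta)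
    then show ?thesis
      using \<open>\<And>w. snd ` set w \<subseteq> B \<Longrightarrow> E (Poly_Mapping.single w 1) = 0\<close>
      by (simp only: E_smul pm.scale_zero_right)
  qed
  have "f = (\<Sum>w\<in>Poly_Mapping.keys f.
      smul (Poly_Mapping.lookup f w) (Poly_Mapping.single w 1))"
    by (rule poly_mapping_eqI)
      (auto simp: lookup_sum lookup_single when_def sum.delta in_keys_iff)
  then have "E f = E (\<Sum>w\<in>Poly_Mapping.keys f.
      smul (Poly_Mapping.lookup f w) (Poly_Mapping.single w 1))"
    by (rule arg_cong)
  also have "\<dots> = 0"
    unfolding E_sum by (rule sum.neutral) (use zero in blast)
  finally show ?thesis by (simp add: E_def)
qed

lemma dpoly_act_add:
  assumes B: "U.independent B" "U.span B = UNIV"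
  shows "dpoly_act B (u + v) f = dpoly_act B u f + dpoly_act B v f"
  by (simp add: dpoly_act_def lin_ext_def lie_emb_linear xgen_add B distrib_right distrib_left
      sum.distrib pm.scale_right_distrib)

lemma dpoly_act_scale:
  assumes B: "U.independent B" "U.span B = UNIV"
  shows "dpoly_act B (c *s u) f = smul c (dpoly_act B u f)"
  by (simp add: dpoly_act_def lin_ext_def lie_emb_linear xgen_uscale B uscale_mult smul_mult_left
      smul_mult_right pm.scale_sum_right mult.commute)

lemma L_algebra_free:
  assumes B: "U.independent B" "U.span B = UNIV"
  shows "L_algebra (free_L_algebra B)"
proof -
  have sel: "carr (free_L_algebra B) = diff_polys B" "scl (free_L_algebra B) = smul"
    "mul (free_L_algebra B) = (*)" "act (free_L_algebra B) = dpoly_act B"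
    by (simp_all add: free_L_algebra_def)
  show ?thesis
    by (rule L_algebra.intro, unfold sel, rule pm.vector_space_axioms, rule L_algebra_axioms.intro,
        unfold sel derivations_def)
      (simp_all add: subspace_diff_polys diff_polys_mult mult.assoc distrib_left distrib_right
        smul_mult_left smul_mult_right dpoly_act_closed dpoly_act_linear dpoly_act_mult
        dpoly_act_add[OF B] dpoly_act_scale[OF B] dpoly_act_bracket[OF B])
qed

fun list_mul :: "('a \<Rightarrow> 'a \<Rightarrow> 'a) \<Rightarrow> 'a::zero list \<Rightarrow> 'a" where
  "list_mul m [] = 0"
| "list_mul m [a] = a"
| "list_mul m (a # b # as) = m a (list_mul m (b # as))"

text \<open>The value of a differential polynomial in \<open>A\<close> under \<open>x\<^sub>j\<^sup>b \<mapsto> b(\<phi>(j))\<close>.\<close>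

definition dpoly_subst :: "('f::field, 'a::ab_group_add) L_struct \<Rightarrow> (nat \<Rightarrow> 'a) \<Rightarrow> 'f dpoly \<Rightarrow> 'a"
  where "dpoly_subst A \<phi> =
    lin_ext (scl A) (\<lambda>w. list_mul (mul A) (map (\<lambda>(j, b). uact A b (\<phi> j)) w))"

definition diff_ids :: "'f::field uea set \<Rightarrow> ('f, 'a::ab_group_add) L_struct \<Rightarrow> 'f dpoly set"
  where "diff_ids B A = {f \<in> diff_polys B. \<forall>\<phi>. range \<phi> \<subseteq> carr A \<longrightarrow> dpoly_subst A \<phi> f = 0}"

definition T_L_ideal :: "'f::field uea set \<Rightarrow> 'f dpoly set \<Rightarrow> bool"
  where "T_L_ideal B I \<longleftrightarrow> I \<subseteq> diff_polys B \<and> pm.subspace I \<and>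
    (\<forall>f\<in>I. \<forall>g\<in>diff_polys B. f * g \<in> I \<and> g * f \<in> I) \<and>
    (\<forall>f\<in>I. \<forall>h. uact (free_L_algebra B) h f \<in> I) \<and>
    (\<forall>f\<in>I. \<forall>\<phi>. range \<phi> \<subseteq> diff_polys B \<longrightarrow> dpoly_subst (free_L_algebra B) \<phi> f \<in> I)"

definition T_L_generated :: "'f::field uea set \<Rightarrow> 'f dpoly set \<Rightarrow> 'f dpoly set"
  where "T_L_generated B S = \<Inter> {I. T_L_ideal B I \<and> S \<subseteq> I}"


section \<open>Codimensions and cocharacters\<close>

text \<open>
  For subspaces \<open>W \<subseteq> V\<close>, \<open>quot_basis V W C\<close> says that the cosets of the elements of \<open>C\<close> form a
  finite basis of \<open>V / W\<close> (and are pairwise distinct). As for \<^const>\<open>vector_space.dim\<close>, an infinite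
  dimension is reported as 0. The trace is that of the operator induced on \<open>V / W\<close> by a linear
  \<open>T\<close> preserving \<open>V\<close> and \<open>W\<close>.
\<close>

definition quot_basis :: "('f::field \<Rightarrow> 'a \<Rightarrow> 'a) \<Rightarrow> 'a::ab_group_add set \<Rightarrow> 'a set \<Rightarrow> 'a set \<Rightarrow> bool"
  where "quot_basis sc V W C \<longleftrightarrow> finite C \<and> C \<subseteq> V \<and>
    (\<forall>a. (\<Sum>c\<in>C. sc (a c) c) \<in> W \<longrightarrow> (\<forall>c\<in>C. a c = 0)) \<and>
    (\<forall>v\<in>V. \<exists>a. v - (\<Sum>c\<in>C. sc (a c) c) \<in> W)"

definition quot_dim :: "('f::field \<Rightarrow> 'a \<Rightarrow> 'a) \<Rightarrow> 'a::ab_group_add set \<Rightarrow> 'a set \<Rightarrow> nat"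
  where "quot_dim sc V W =
    (if \<exists>C. quot_basis sc V W C then card (SOME C. quot_basis sc V W C) else 0)"

definition quot_coord ::
    "('f::field \<Rightarrow> 'a \<Rightarrow> 'a) \<Rightarrow> 'a::ab_group_add set \<Rightarrow> 'a set \<Rightarrow> 'a \<Rightarrow> 'a \<Rightarrow> 'f"
  where "quot_coord sc W C v = (SOME a. v - (\<Sum>c\<in>C. sc (a c) c) \<in> W)"

definition quot_trace ::
    "('f::field \<Rightarrow> 'a \<Rightarrow> 'a) \<Rightarrow> 'a::ab_group_add set \<Rightarrow> 'a set \<Rightarrow> ('a \<Rightarrow> 'a) \<Rightarrow> 'f"
  where "quot_trace sc V W T =
    (let C = SOME C. quot_basis sc V W C in \<Sum>c\<in>C. quot_coord sc W C (T c) c)"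

definition multilin :: "'f::field uea set \<Rightarrow> nat \<Rightarrow> 'f dpoly set"
  where "multilin B n = pm.span
    {Poly_Mapping.single (map (\<lambda>k. (\<sigma> k, h k)) [1..<Suc n]) 1 | \<sigma> h.
      \<sigma> permutes {1..n} \<and> range h \<subseteq> B}"

definition perm_act :: "(nat \<Rightarrow> nat) \<Rightarrow> 'f::field dpoly \<Rightarrow> 'f dpoly"
  where "perm_act \<sigma> = lin_ext smul (\<lambda>w. Poly_Mapping.single (map (map_prod \<sigma> id) w) 1)"

definition diff_codim :: "'f::field uea set \<Rightarrow> ('f, 'a::ab_group_add) L_struct \<Rightarrow> nat \<Rightarrow> nat"
  where "diff_codim B A n = quot_dim smul (multilin B n) (multilin B n \<inter> diff_ids B A)"

definition diff_cochar ::
    "'f::field uea set \<Rightarrow> ('f, 'a::ab_group_add) L_struct \<Rightarrow> nat \<Rightarrow> (nat \<Rightarrow> nat) \<Rightarrow> 'f"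
  where "diff_cochar B A n \<sigma> =
    quot_trace smul (multilin B n) (multilin B n \<inter> diff_ids B A) (perm_act \<sigma>)"


section \<open>Irreducible characters of the symmetric groups\<close>

text \<open>
  A partition is a weakly decreasing list of positive numbers, and \<open>(nat \<Rightarrow> nat) \<Rightarrow>\<^sub>0 'f\<close> contains
  the group algebra of every symmetric group. In characteristic zero the irreducible character
  \<open>\<chi>\<^sub>\<mu>\<close> is afforded by the left ideal generated by the Young symmetrizer of a tableau of shape \<open>\<mu>\<close>;
  here the tableau is the one whose rows, read from top to bottom, are \<open>1, 2, \<dots>, n\<close>.
\<close>

definition tableau :: "nat list \<Rightarrow> nat \<Rightarrow> nat \<Rightarrow> nat"
  where "tableau \<mu> i j = sum_list (take i \<mu>) + j + 1"

definition row_group :: "nat list \<Rightarrow> (nat \<Rightarrow> nat) set"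
  where "row_group \<mu> = {p. p permutes {1..sum_list \<mu>} \<and>
    (\<forall>i<length \<mu>. p ` {tableau \<mu> i j | j. j < \<mu> ! i} = {tableau \<mu> i j | j. j < \<mu> ! i})}"

definition col_group :: "nat list \<Rightarrow> (nat \<Rightarrow> nat) set"
  where "col_group \<mu> = {q. q permutes {1..sum_list \<mu>} \<and>
    (\<forall>j. q ` {tableau \<mu> i j | i. i < length \<mu> \<and> j < \<mu> ! i}
      = {tableau \<mu> i j | i. i < length \<mu> \<and> j < \<mu> ! i})}"

definition young_symmetrizer :: "nat list \<Rightarrow> (nat \<Rightarrow> nat) \<Rightarrow>\<^sub>0 'f::field"
  where "young_symmetrizer \<mu> =
    (\<Sum>p\<in>row_group \<mu>. \<Sum>q\<in>col_group \<mu>. Poly_Mapping.single (p \<circ> q) (of_int (sign q)))"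

definition left_mult :: "(nat \<Rightarrow> nat) \<Rightarrow> ((nat \<Rightarrow> nat) \<Rightarrow>\<^sub>0 'f) \<Rightarrow> ((nat \<Rightarrow> nat) \<Rightarrow>\<^sub>0 'f::field)"
  where "left_mult \<sigma> = lin_ext smul (\<lambda>p. Poly_Mapping.single (\<sigma> \<circ> p) 1)"

definition specht :: "nat list \<Rightarrow> ((nat \<Rightarrow> nat) \<Rightarrow>\<^sub>0 'f::field) set"
  where "specht \<mu> =
    pm.span {left_mult \<sigma> (young_symmetrizer \<mu>) | \<sigma>. \<sigma> permutes {1..sum_list \<mu>}}"

definition irr_char :: "nat list \<Rightarrow> (nat \<Rightarrow> nat) \<Rightarrow> 'f::field"
  where "irr_char \<mu> \<sigma> = quot_trace smul (specht \<mu>) {0} (left_mult \<sigma> :: _ \<Rightarrow> (_ \<Rightarrow>\<^sub>0 'f))"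


section \<open>The algebras \<open>M\<^sub>1\<close> and \<open>M\<^sub>2\<close>\<close>

text \<open>Multiplication of \<open>2 \<times> 2\<close> matrices is \<open>(**)\<close>; on this type \<open>(*)\<close> is componentwise.\<close>

definition mat_scale :: "'f::field \<Rightarrow> 'f ^ 2 ^ 2 \<Rightarrow> 'f ^ 2 ^ 2"
  where "mat_scale c m = (\<chi> i j. c * m $ i $ j)"

definition mat_unit :: "2 \<Rightarrow> 2 \<Rightarrow> 'f::field ^ 2 ^ 2"
  where "mat_unit i j = (\<chi> r s. if r = i \<and> s = j then 1 else 0)"

definition M1_eps :: "'f::field ^ 2 ^ 2 \<Rightarrow> 'f ^ 2 ^ 2"
  where "M1_eps m = mat_scale (m $ 1 $ 2) (mat_unit 1 2)"

definition M1_del :: "'f::field ^ 2 ^ 2 \<Rightarrow> 'f ^ 2 ^ 2"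
  where "M1_del m = mat_scale (m $ 2 $ 2) (mat_unit 1 2)"

definition M2_eps :: "'f::field ^ 2 ^ 2 \<Rightarrow> 'f ^ 2 ^ 2"
  where "M2_eps m = mat_scale (m $ 1 $ 2) (mat_unit 1 2)"

definition M2_del :: "'f::field ^ 2 ^ 2 \<Rightarrow> 'f ^ 2 ^ 2"
  where "M2_del m = mat_scale (m $ 1 $ 1) (mat_unit 1 2)"

definition M1D :: "('f::field, 'f ^ 2 ^ 2) L_struct"
  where "M1D = \<lparr>
    carr = {mat_scale \<alpha> (mat_unit 2 2) + mat_scale \<beta> (mat_unit 1 2) | \<alpha> \<beta>. True},
    scl = mat_scale, mul = (**),
    act = (\<lambda>u m. mat_scale (u $ 1) (M1_eps m) + mat_scale (u $ 2) (M1_del m))\<rparr>"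

definition M2D :: "('f::field, 'f ^ 2 ^ 2) L_struct"
  where "M2D = \<lparr>
    carr = {mat_scale \<alpha> (mat_unit 1 1) + mat_scale \<beta> (mat_unit 1 2) | \<alpha> \<beta>. True},
    scl = mat_scale, mul = (**),
    act = (\<lambda>u m. mat_scale (u $ 1) (M2_eps m) + mat_scale (u $ 2) (M2_del m))\<rparr>"

lemma vector_space_mat_scale: "vector_space mat_scale"
  by standard (simp_all add: mat_scale_def vec_eq_iff algebra_simps)

lemma mat2_eq_iff:
  "m = m' \<longleftrightarrow> m $ 1 $ 1 = m' $ 1 $ 1 \<and> m $ 1 $ 2 = m' $ 1 $ 2 \<and>
    m $ 2 $ 1 = m' $ 2 $ 1 \<and> m $ 2 $ 2 = m' $ 2 $ 2" for m m' :: "'f ^ 2 ^ 2"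
  by (auto simp: vec_eq_iff forall_2)

lemma mat2_nth:
  "mat_scale c m $ i $ j = c * m $ i $ j"
  "(m ** m') $ i $ j = m $ i $ 1 * m' $ 1 $ j + m $ i $ 2 * m' $ 2 $ j"
  for m m' :: "'f::field ^ 2 ^ 2"
  by (simp_all add: mat_scale_def matrix_matrix_mult_def sum_2)

lemma M1D_sel:
  "m \<in> carr M1D \<longleftrightarrow> m $ 1 $ 1 = 0 \<and> m $ 2 $ 1 = 0"
  "scl M1D = mat_scale" "mul M1D = (**)"
  "act M1D u m $ 1 $ 2 = u $ 1 * m $ 1 $ 2 + u $ 2 * m $ 2 $ 2"
  "act M1D u m $ 1 $ 1 = 0" "act M1D u m $ 2 $ i = 0"
  by (auto simp: M1D_def M1_eps_def M1_del_def mat2_eq_iff mat2_nth mat_unit_def)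

lemma L_algebra_M1D: "L_algebra M1D"
proof -
  interpret vector_space mat_scale by (rule vector_space_mat_scale)
  have "module.subspace (scl M1D) (carr M1D :: ('a ^ 2 ^ 2) set)"
    unfolding M1D_sel by (rule subspaceI) (auto simp: M1D_sel mat2_nth)
  moreover have "vector_space (scl M1D :: 'a \<Rightarrow> _)"
    unfolding M1D_sel by (rule vector_space_mat_scale)
  ultimately show ?thesis
    by (intro L_algebra.intro L_algebra_axioms.intro)
      (simp_all add: derivations_def M1D_sel mat2_eq_iff mat2_nth bracket_nth algebra_simps)
qed

lemma M2D_sel:
  "m \<in> carr M2D \<longleftrightarrow> m $ 2 $ 2 = 0 \<and> m $ 2 $ 1 = 0"
  "scl M2D = mat_scale" "mul M2D = (**)"
  "act M2D u m $ 1 $ 2 = u $ 1 * m $ 1 $ 2 + u $ 2 * m $ 1 $ 1"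
  "act M2D u m $ 1 $ 1 = 0" "act M2D u m $ 2 $ i = 0"
  by (auto simp: M2D_def M2_eps_def M2_del_def mat2_eq_iff mat2_nth mat_unit_def)

lemma L_algebra_M2D: "L_algebra M2D"
proof -
  interpret vector_space mat_scale by (rule vector_space_mat_scale)
  have "module.subspace (scl M2D) (carr M2D :: ('a ^ 2 ^ 2) set)"
    unfolding M2D_sel by (rule subspaceI) (auto simp: M2D_sel mat2_nth)
  moreover have "vector_space (scl M2D :: 'a \<Rightarrow> _)"
    unfolding M2D_sel by (rule vector_space_mat_scale)
  ultimately show ?thesis
    by (intro L_algebra.intro L_algebra_axioms.intro)
      (simp_all add: derivations_def M2D_sel mat2_eq_iff mat2_nth bracket_nth algebra_simps)
qed

end

theory Submission
  imports Defs
begin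

text \<open>
  An element of \<open>M\<^sub>1\<close> is \<open>a = \<alpha> e\<^sub>2\<^sub>2 + \<beta> e\<^sub>1\<^sub>2\<close>, and \<open>a a' = \<alpha>' a\<close>: a product is its first factor times
  the \<open>e\<^sub>2\<^sub>2\<close>-coordinates of the others. On \<open>a\<close> an element \<open>h\<close> of \<open>U(L)\<close> acts through three numbers,
  \<open>h(a) = aug(h) \<alpha> e\<^sub>2\<^sub>2 + (eps_weight(h) \<beta> + del_coeff(h) \<alpha>) e\<^sub>1\<^sub>2\<close>; they are the coordinates of \<open>h\<close>
  with respect to \<open>1 - \<epsilon>\<close>, \<open>\<epsilon>\<close> and \<open>\<delta>\<close>, modulo the annihilator of \<open>M\<^sub>1\<close>.

  \<^bold>\<open>Identities.\<close> The five generators reproduce these two facts in the free algebra. Modulo a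
  \<open>T\<^sub>L\<close>-ideal that contains them, \<open>x\<^sup>h\<close> is a combination of \<open>x\<close> with exponents \<open>1 - \<epsilon>\<close>, \<open>\<epsilon>\<close>, \<open>\<delta>\<close>
  (\<open>xgen_reduce\<close>); a letter that is not the first of its word loses its exponent \<open>h\<close> against the
  factor \<open>aug(h)\<close> (\<open>tail_letter_reduce\<close>); letters after the first commute (\<open>tail_commute\<close>); and a
  first letter with exponent \<open>1 - \<epsilon>\<close> or \<open>\<delta>\<close> may change places with the second (\<open>head_exchange\<close>).
  So every word is a combination of three normal words (\<open>word_reduce\<close>). The values of the normal
  words are pairwise different products of a monomial in the coordinates of the arguments with one
  of \<open>e\<^sub>2\<^sub>2\<close> and \<open>e\<^sub>1\<^sub>2\<close>, and distinct monomials are linearly independent functions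
  (\<open>monomials_independent\<close>). Hence a differential identity has normal
  form zero and lies in the ideal (\<open>diff_ids_M1D_subset\<close>).

  \<^bold>\<open>Codimensions and cocharacters.\<close> In degree \<open>n\<close> the normal multilinear words are the two words
  \<open>x\<^sub>1\<^sup>h x\<^sub>2 \<dots> x\<^sub>n\<close> with \<open>h\<close> one of \<open>1 - \<epsilon>\<close> and \<open>\<delta>\<close>, and the \<open>n\<close> words that start with some \<open>x\<^sub>i\<^sup>\<epsilon>\<close>.
  Evaluation at points whose \<open>e\<^sub>2\<^sub>2\<close>-coordinates are \<open>1\<close> provides functionals dual to them
  (\<open>dual_frame_M1D\<close>), and dual functionals compute both the dimension of the quotient and the traces
  on it. A permutation fixes the first two words modulo identities and permutes the others, so its
  trace is \<open>2\<close> plus its number of fixed points. The Specht module of shape \<open>(n - 1, 1)\<close> is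
  spanned by \<open>n\<close> vectors that are permuted and have sum \<open>0\<close>, so there the trace is the number of
  fixed points minus \<open>1\<close> (\<open>irr_char_hook\<close>).

  \<^bold>\<open>The algebra \<open>M\<^sub>2\<close>.\<close> Reflection of matrices in the antidiagonal is an anti-isomorphism
  \<open>M\<^sub>1 \<rightarrow> M\<^sub>2\<close> that commutes with \<open>L\<close>. Everything about \<open>M\<^sub>2\<close> therefore follows by reading words
  backwards (\<open>diff_ids_M2D_iff\<close>, \<open>T_L_generated_rev\<close>).
\<close>

section \<open>Traces and dimensions of quotients from dual functionals\<close>

text \<open>
  The cosets of the \<open>e i\<close> form a basis of \<open>V / W\<close>, and the \<open>\<phi> i\<close> induce the dual basis.
\<close>

definition dual_frame ::
    "('f::field \<Rightarrow> 'a \<Rightarrow> 'a) \<Rightarrow> 'a::ab_group_add set \<Rightarrow> 'a set \<Rightarrow> 'i set \<Rightarrow> ('i \<Rightarrow> 'a) \<Rightarrow> ('i \<Rightarrow> 'a \<Rightarrow> 'f) \<Rightarrow> bool"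
  where "dual_frame sc V W I e \<phi> \<longleftrightarrow> finite I \<and> e ` I \<subseteq> V \<and>
    (\<forall>i\<in>I. Vector_Spaces.linear sc (*) (\<phi> i)) \<and> (\<forall>i\<in>I. \<forall>w\<in>W. \<phi> i w = 0) \<and>
    (\<forall>i\<in>I. \<forall>j\<in>I. \<phi> i (e j) = of_bool (i = j)) \<and>
    (\<forall>v\<in>V. \<exists>a. v - (\<Sum>i\<in>I. sc (a i) (e i)) \<in> W)"

lemma linear_functional:
  assumes "Vector_Spaces.linear sc ((*) :: 'f::field \<Rightarrow> _) \<phi>"
  shows "\<phi> (a + b) = \<phi> a + \<phi> b" "\<phi> (a - b) = \<phi> a - \<phi> b" "\<phi> (sc c a) = c * \<phi> a"
    "\<phi> (sum F S) = (\<Sum>s\<in>S. \<phi> (F s))"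
proof -
  interpret Vector_Spaces.linear sc "(*)" \<phi> by fact
  show "\<phi> (a + b) = \<phi> a + \<phi> b" "\<phi> (a - b) = \<phi> a - \<phi> b" "\<phi> (sc c a) = c * \<phi> a"
    "\<phi> (sum F S) = (\<Sum>s\<in>S. \<phi> (F s))"
    by (rule add diff scale sum)+
qed

context vector_space
begin

lemma dual_frame_decompose:
  assumes fr: "dual_frame scale V W I e \<phi>" and v: "v \<in> V"
  shows "v - (\<Sum>i\<in>I. scale (\<phi> i v) (e i)) \<in> W"
proof -
  obtain a where a: "v - (\<Sum>i\<in>I. scale (a i) (e i)) \<in> W"
    using fr v unfolding dual_frame_def by blast
  have "\<phi> k v = a k" if k: "k \<in> I" for k
  proof -
    have lin: "Vector_Spaces.linear scale (*) (\<phi> k)" using fr k by (simp add: dual_frame_def)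
    have "0 = \<phi> k (v - (\<Sum>i\<in>I. scale (a i) (e i)))"
      using fr k a by (simp add: dual_frame_def)
    also have "\<dots> = \<phi> k v - (\<Sum>i\<in>I. a i * of_bool (k = i))"
      using fr k by (simp add: linear_functional[OF lin] dual_frame_def)
    also have "(\<Sum>i\<in>I. a i * of_bool (k = i)) = a k"
      using fr k by (simp add: dual_frame_def of_bool_def if_distrib[of "(*) _"] sum.delta cong: if_cong)
    finally show ?thesis by simp
  qed
  then have "(\<Sum>i\<in>I. scale (\<phi> i v) (e i)) = (\<Sum>i\<in>I. scale (a i) (e i))" by (intro sum.cong) auto
  then show ?thesis using a by simp
qed

lemma quot_basis_dual_frame:
  assumes fr: "dual_frame scale V W I e \<phi>"
  shows "quot_basis scale V W (e ` I)"
proof -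
  have dual: "\<phi> i (e j) = of_bool (i = j)" if "i \<in> I" "j \<in> I" for i j
    using fr that by (simp add: dual_frame_def)
  have fin: "finite I" using fr by (simp add: dual_frame_def)
  have inj: "inj_on e I"
  proof (rule inj_onI)
    fix i j assume ij: "i \<in> I" "j \<in> I" "e i = e j"
    then show "i = j" using dual[of i i] dual[of i j] by (auto split: if_splits)
  qed
  show ?thesis unfolding quot_basis_def
  proof (intro conjI allI impI ballI)
    show "finite (e ` I)" "e ` I \<subseteq> V" using fr by (auto simp: dual_frame_def)
  next
    fix a c assume a: "(\<Sum>c\<in>e ` I. scale (a c) c) \<in> W" and "c \<in> e ` I"
    then obtain k where k: "k \<in> I" "c = e k" by auto
    have lin: "Vector_Spaces.linear scale (*) (\<phi> k)" using fr k by (simp add: dual_frame_def)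
    have "0 = \<phi> k (\<Sum>c\<in>e ` I. scale (a c) c)" using fr k a by (simp add: dual_frame_def)
    also have "\<dots> = (\<Sum>i\<in>I. a (e i) * of_bool (k = i))"
      using k by (simp add: sum.reindex[OF inj] linear_functional[OF lin] dual)
    also have "\<dots> = a (e k)"
      using fin k by (simp add: of_bool_def if_distrib[of "(*) _"] sum.delta cong: if_cong)
    finally show "a c = 0" using k by simp
  next
    fix v assume v: "v \<in> V"
    have "(\<Sum>c\<in>e ` I. scale (\<phi> (inv_into I e c) v) c) = (\<Sum>i\<in>I. scale (\<phi> i v) (e i))"
      by (simp add: sum.reindex[OF inj] inv_into_f_f[OF inj])
    then show "\<exists>a. v - (\<Sum>c\<in>e ` I. scale (a c) c) \<in> W"
      using dual_frame_decompose[OF fr v] by (intro exI[of _ "\<lambda>c. \<phi> (inv_into I e c) v"]) simp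
  qed
qed

lemma quot_coord_unique:
  assumes W: "subspace W" and C: "quot_basis scale V W C" and v: "v \<in> V"
    and a: "v - (\<Sum>c\<in>C. scale (a c) c) \<in> W" and c: "c \<in> C"
  shows "quot_coord scale W C v c = a c"
proof -
  have "v - (\<Sum>c\<in>C. scale (quot_coord scale W C v c) c) \<in> W"
    unfolding quot_coord_def by (rule someI[of "\<lambda>a. v - (\<Sum>c\<in>C. scale (a c) c) \<in> W", OF a])
  from subspace_diff[OF W this a] have "(\<Sum>c\<in>C. scale (a c - quot_coord scale W C v c) c) \<in> W"
    by (simp add: scale_left_diff_distrib sum_subtractf)
  moreover have ind: "(\<Sum>c\<in>C. scale (b c) c) \<in> W \<Longrightarrow> \<forall>c\<in>C. b c = 0" for b
    using C by (simp add: quot_basis_def)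
  ultimately show ?thesis using c ind[of "\<lambda>c. a c - quot_coord scale W C v c"] by simp
qed

text \<open>
  The trace does not see the chosen basis \<open>C\<close>: expanding each \<open>c \<in> C\<close> in the frame and each
  \<open>T (e i)\<close> in \<open>C\<close> writes both sides as the same double sum.
\<close>

lemma sum_quot_coord_dual_frame:
  assumes V: "subspace V" and W: "subspace W" "W \<subseteq> V"
    and fr: "dual_frame scale V W I e \<phi>" and C: "quot_basis scale V W C"
    and T: "Vector_Spaces.linear scale scale T" "T ` V \<subseteq> V" "T ` W \<subseteq> W"
  shows "(\<Sum>c\<in>C. quot_coord scale W C (T c) c) = (\<Sum>i\<in>I. \<phi> i (T (e i)))"
proof -
  interpret T: Vector_Spaces.linear scale scale T by fact
  let ?k = "quot_coord scale W C"
  have eV: "e i \<in> V" if "i \<in> I" for i using fr that by (auto simp: dual_frame_def)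
  have k: "v - (\<Sum>c\<in>C. scale (?k v c) c) \<in> W" if "v \<in> V" for v
  proof -
    obtain a where "v - (\<Sum>c\<in>C. scale (a c) c) \<in> W"
      using C \<open>v \<in> V\<close> by (auto simp: quot_basis_def)
    then show ?thesis
      unfolding quot_coord_def by (rule someI[of "\<lambda>a. v - (\<Sum>c\<in>C. scale (a c) c) \<in> W"])
  qed
  have exp: "?k (T c) c' = (\<Sum>i\<in>I. \<phi> i c * ?k (T (e i)) c')" if c: "c \<in> C" "c' \<in> C" for c c'
  proof (rule quot_coord_unique[OF W(1) C])
    have cV: "c \<in> V" using C c by (auto simp: quot_basis_def)
    then show "T c \<in> V" using T by auto
    have "T (c - (\<Sum>i\<in>I. scale (\<phi> i c) (e i))) \<in> W"
      using dual_frame_decompose[OF fr cV] T by auto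
    then have 1: "T c - (\<Sum>i\<in>I. scale (\<phi> i c) (T (e i))) \<in> W"
      by (simp add: T.diff T.sum T.scale)
    have "(\<Sum>i\<in>I. scale (\<phi> i c) (T (e i) - (\<Sum>c\<in>C. scale (?k (T (e i)) c) c))) \<in> W"
      using eV T(2) by (intro subspace_sum subspace_scale W k) auto
    from subspace_add[OF W(1) 1 this]
    have "T c - (\<Sum>i\<in>I. \<Sum>d\<in>C. scale (\<phi> i c * ?k (T (e i)) d) d) \<in> W"
      by (simp add: scale_right_diff_distrib sum_subtractf scale_sum_right)
    then show "T c - (\<Sum>d\<in>C. scale (\<Sum>i\<in>I. \<phi> i c * ?k (T (e i)) d) d) \<in> W"
      by (simp add: scale_sum_left sum.swap[of _ C I])
  qed (use c in auto)
  have "(\<Sum>c\<in>C. ?k (T c) c) = (\<Sum>c\<in>C. \<Sum>i\<in>I. \<phi> i c * ?k (T (e i)) c)"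
    using exp by simp
  also have "\<dots> = (\<Sum>i\<in>I. \<Sum>c\<in>C. ?k (T (e i)) c * \<phi> i c)"
    by (subst sum.swap) (simp add: mult.commute)
  also have "\<dots> = (\<Sum>i\<in>I. \<phi> i (T (e i)))"
  proof (rule sum.cong[OF refl])
    fix i assume i: "i \<in> I"
    have lin: "Vector_Spaces.linear scale (*) (\<phi> i)" using fr i by (simp add: dual_frame_def)
    have "\<phi> i (T (e i) - (\<Sum>c\<in>C. scale (?k (T (e i)) c) c)) = 0"
      using fr i k[of "T (e i)"] eV[OF i] T(2) by (auto simp: dual_frame_def)
    then show "(\<Sum>c\<in>C. ?k (T (e i)) c * \<phi> i c) = \<phi> i (T (e i))"
      by (simp add: linear_functional[OF lin])
  qed
  finally show ?thesis .
qed

lemma quot_trace_dual_frame: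
  assumes "subspace V" "subspace W" "W \<subseteq> V" "dual_frame scale V W I e \<phi>"
    "Vector_Spaces.linear scale scale T" "T ` V \<subseteq> V" "T ` W \<subseteq> W"
  shows "quot_trace scale V W T = (\<Sum>i\<in>I. \<phi> i (T (e i)))"
proof -
  have "quot_basis scale V W (SOME C. quot_basis scale V W C)"
    using quot_basis_dual_frame[OF assms(4)] by (rule someI)
  from sum_quot_coord_dual_frame[OF assms(1-4) this assms(5-7)] show ?thesis
    by (simp add: quot_trace_def)
qed

end

text \<open>In characteristic zero a dimension is determined by the trace of the identity.\<close>

lemma quot_dim_dual_frame:
  fixes sc :: "'f::field_char_0 \<Rightarrow> 'a::ab_group_add \<Rightarrow> 'a"
  assumes "vector_space sc" "module.subspace sc V" "module.subspace sc W" "W \<subseteq> V"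
    "dual_frame sc V W I e \<phi>"
  shows "quot_dim sc V W = card I"
proof -
  interpret vector_space sc by fact
  let ?C = "SOME C. quot_basis sc V W C"
  have ex: "quot_basis sc V W (e ` I)" by (rule quot_basis_dual_frame[OF assms(5)])
  then have C: "quot_basis sc V W ?C" by (rule someI)
  then have fin: "finite ?C" and sub: "?C \<subseteq> V" by (auto simp: quot_basis_def)
  have "(\<Sum>c\<in>?C. quot_coord sc W ?C (id c) c) = (\<Sum>i\<in>I. \<phi> i (id (e i)))"
    by (rule sum_quot_coord_dual_frame[OF assms(2-5) C]) (auto intro: linear_id linear_ident)
  moreover have "quot_coord sc W ?C c c = 1" if c: "c \<in> ?C" for c
  proof -
    have "c - (\<Sum>d\<in>?C. sc (of_bool (d = c)) d) = 0"
      using fin c by (simp add: of_bool_def if_distrib[of "\<lambda>x. sc x _"] cong: if_cong)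
    then show ?thesis
      using quot_coord_unique[OF assms(3) C, of c "\<lambda>d. of_bool (d = c)" c] c sub subspace_0[OF assms(3)]
      by auto
  qed
  moreover have "\<phi> i (e i) = 1" if "i \<in> I" for i using assms(5) that by (simp add: dual_frame_def)
  ultimately have "of_nat (card ?C) = (of_nat (card I) :: 'f)" by simp
  then show ?thesis using ex by (auto simp: quot_dim_def)
qed

lemma linear_functionalI:
  assumes "\<And>f g. \<phi> (f + g) = \<phi> f + \<phi> g" "\<And>c f. \<phi> (smul c f) = c * \<phi> f"
  shows "Vector_Spaces.linear smul (*) (\<phi> :: _ \<Rightarrow> 'f::field)"
proof -
  have "vector_space ((*) :: 'f \<Rightarrow> _)" by standard (simp_all add: algebra_simps)
  then show ?thesis using assms pm.vector_space_axioms by (simp add: Vector_Spaces.linear_iff)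
qed

lemma linear_lin_ext: "Vector_Spaces.linear smul smul (lin_ext smul g)"
  by (simp add: Vector_Spaces.linear_iff pm.vector_space_axioms pm.lin_ext_add pm.lin_ext_smul)

section \<open>Evaluation of differential polynomials\<close>

text \<open>
  \<open>U(L)\<close> is spanned by the products of elements of \<open>L\<close>, and these arise from \<open>1\<close> by
  multiplication from the left.
\<close>

lemma uea_induct [case_names one lie add scale]:
  fixes h :: "'f::field uea"
  assumes one: "P 1" and lie: "\<And>u h. P h \<Longrightarrow> P (lie_emb u * h)"
    and add: "\<And>g h. P g \<Longrightarrow> P h \<Longrightarrow> P (g + h)" and scale: "\<And>c h. P h \<Longrightarrow> P (uscale c h)"
  shows "P h"
proof -
  have "P (abs_uea p)" for p :: "('f ^ 2) list \<Rightarrow>\<^sub>0 'f"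
  proof (induction p rule: poly_mapping_induct_add)
    case zero
    show ?case using scale[OF one, of 0] by (simp flip: zero_uea_def)
  next
    case (add f g)
    then show ?case using assms(3) by (simp flip: plus_uea.abs_eq)
  next
    case (single w c)
    have "P (abs_uea (Poly_Mapping.single w 1))"
    proof (induction w)
      case Nil
      show ?case using one by (simp add: single_Nil flip: one_uea_def)
    next
      case (Cons u w)
      have "abs_uea (Poly_Mapping.single (u # w) 1) = lie_emb u * abs_uea (Poly_Mapping.single w 1)"
        by (simp add: lie_emb.abs_eq times_uea.abs_eq mult_single plus_list_def)
      then show ?case using lie Cons by simp
    qed
    from scale[OF this, of c] show ?case by (simp add: uscale.abs_eq)
  qed
  then show ?thesis by (metis Quotient3_abs_rep Quotient3_uea)
qed

abbreviation ok_word :: "'f::field uea set \<Rightarrow> (nat \<times> 'f uea) list \<Rightarrow> bool"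
  where "ok_word B w \<equiv> \<forall>(j, b)\<in>set w. 1 \<le> j \<and> b \<in> B"

lemma single_in_diff_polys: "w \<noteq> [] \<Longrightarrow> ok_word B w \<Longrightarrow> Poly_Mapping.single w c \<in> diff_polys B"
  by (auto simp: diff_polys_def)

lemma single_Cons: "Poly_Mapping.single (a # w) 1 =
    (Poly_Mapping.single [a] 1 * Poly_Mapping.single w 1 :: 'a list \<Rightarrow>\<^sub>0 'f::field)"
  by (simp add: mult_single plus_list_def)

lemma poly_mapping_as_sum:
  "f = (\<Sum>w\<in>Poly_Mapping.keys f. smul (Poly_Mapping.lookup f w) (Poly_Mapping.single w 1))"
  by (rule poly_mapping_eqI) (auto simp: lookup_sum lookup_single when_def sum.delta in_keys_iff)

lemma diff_polys_induct [consumes 1, case_names letter mult add smul zero]: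
  assumes f: "f \<in> diff_polys B"
    and letter: "\<And>j b. 1 \<le> j \<Longrightarrow> b \<in> B \<Longrightarrow> P (Poly_Mapping.single [(j, b)] 1)"
    and mult: "\<And>j b f. 1 \<le> j \<Longrightarrow> b \<in> B \<Longrightarrow> f \<in> diff_polys B \<Longrightarrow> P f \<Longrightarrow>
      P (Poly_Mapping.single [(j, b)] 1 * f)"
    and add: "\<And>f g. f \<in> diff_polys B \<Longrightarrow> g \<in> diff_polys B \<Longrightarrow> P f \<Longrightarrow> P g \<Longrightarrow> P (f + g)"
    and smul: "\<And>c f. f \<in> diff_polys B \<Longrightarrow> P f \<Longrightarrow> P (smul c f)"
    and zero: "P 0"
  shows "P f"
proof -
  have word: "P (Poly_Mapping.single w 1)" if "w \<noteq> []" "ok_word B w" for w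
    using that
  proof (induction w rule: list_nonempty_induct)
    case (single a)
    then show ?case by (cases a) (auto intro: letter)
  next
    case (cons a w)
    then show ?case
      by (cases a) (auto simp: single_Cons[of _ w] intro!: mult single_in_diff_polys)
  qed
  have "(\<Sum>w\<in>K. smul (Poly_Mapping.lookup f w) (Poly_Mapping.single w 1)) \<in> diff_polys B \<and>
      P (\<Sum>w\<in>K. smul (Poly_Mapping.lookup f w) (Poly_Mapping.single w 1))"
    if "finite K" "K \<subseteq> Poly_Mapping.keys f" for K
    using that
  proof (induction K)
    case empty
    show ?case using zero pm.subspace_0[OF subspace_diff_polys] by simp
  next
    case (insert w K)
    then have w: "w \<noteq> []" "ok_word B w" using f by (auto simp: diff_polys_def)
    from smul[OF single_in_diff_polys[OF w] word[OF w]] have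
      "P (smul (Poly_Mapping.lookup f w) (Poly_Mapping.single w 1))" .
    moreover have "smul (Poly_Mapping.lookup f w) (Poly_Mapping.single w 1) \<in> diff_polys B"
      using w by (simp add: single_in_diff_polys)
    ultimately show ?case using insert by (auto intro!: pm.subspace_add[OF subspace_diff_polys] add)
  qed
  from this[of "Poly_Mapping.keys f"] show ?thesis
    by (simp only: poly_mapping_as_sum[symmetric] finite_keys order_refl simp_thms)
qed

lemma free_L_algebra_sel [simp]:
  "carr (free_L_algebra B) = diff_polys B" "scl (free_L_algebra B) = smul"
  "mul (free_L_algebra B) = (*)" "act (free_L_algebra B) = dpoly_act B"
  by (simp_all add: free_L_algebra_def)

lemma xgen_in_diff_polys: "1 \<le> j \<Longrightarrow> xgen B j h \<in> diff_polys B"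
  using keys_xgen by (fastforce simp: diff_polys_def)

context L_algebra
begin

lemma zero_closed: "0 \<in> carr A"
  by (rule subspace_0[OF subspace_carr])

lemma uact_add_right:
  "a \<in> carr A \<Longrightarrow> b \<in> carr A \<Longrightarrow> uact A h (a + b) = uact A h a + uact A h b"
  by (cases h rule: abs_uea_cases)
    (simp add: uact_abs word_act_props subspace_add[OF subspace_carr])

lemma uact_scale_right: "a \<in> carr A \<Longrightarrow> uact A h (scl A c a) = scl A c (uact A h a)"
  by (cases h rule: abs_uea_cases)
    (simp add: uact_abs word_act_props subspace_scale[OF subspace_carr])

lemma uact_0_left: "a \<in> carr A \<Longrightarrow> uact A 0 a = 0"
  using uact_uscale[of a 0 0] by simp

lemma uact_0_right: "uact A h 0 = 0"
  using uact_scale_right[OF zero_closed, of h 0] by simp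

lemma uact_diff_right:
  "a \<in> carr A \<Longrightarrow> b \<in> carr A \<Longrightarrow> uact A h (a - b) = uact A h a - uact A h b"
  using uact_add_right[of "a - b" b h] subspace_diff[OF subspace_carr, of a b]
  by (simp add: algebra_simps)

lemma uact_sum: "a \<in> carr A \<Longrightarrow> uact A (sum g S) a = (\<Sum>s\<in>S. uact A (g s) a)"
  by (induction S rule: infinite_finite_induct) (simp_all add: uact_add uact_0_left)

lemma mul_0: "a \<in> carr A \<Longrightarrow> mul A 0 a = 0" "a \<in> carr A \<Longrightarrow> mul A a 0 = 0"
  using mul_scl_left[OF zero_closed, of a 0] mul_scl_right[OF _ zero_closed, of a 0] by simp_all

lemma list_mul_closed: "as \<noteq> [] \<Longrightarrow> set as \<subseteq> carr A \<Longrightarrow> list_mul (mul A) as \<in> carr A"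
  by (induction "mul A" as rule: list_mul.induct) (auto intro: mul_closed)

lemma dpoly_subst_linear:
  "dpoly_subst A \<phi> (f + g) = dpoly_subst A \<phi> f + dpoly_subst A \<phi> g"
  "dpoly_subst A \<phi> (f - g) = dpoly_subst A \<phi> f - dpoly_subst A \<phi> g"
  "dpoly_subst A \<phi> (smul c f) = scl A c (dpoly_subst A \<phi> f)"
  "dpoly_subst A \<phi> (sum F S) = (\<Sum>s\<in>S. dpoly_subst A \<phi> (F s))"
  "dpoly_subst A \<phi> 0 = 0"
  by (simp_all add: dpoly_subst_def lin_ext_add lin_ext_diff lin_ext_smul lin_ext_sum)

lemma dpoly_subst_letter: "dpoly_subst A \<phi> (Poly_Mapping.single [(j, b)] c) = scl A c (uact A b (\<phi> j))"
  by (simp add: dpoly_subst_def)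

context
  fixes B :: "'f uea set" and \<phi> :: "nat \<Rightarrow> 'a"
  assumes \<phi>: "range \<phi> \<subseteq> carr A"
begin

lemma uact_subst_closed: "uact A b (\<phi> j) \<in> carr A"
  using \<phi> by (intro uact_closed) auto

lemma dpoly_subst_word:
  "w \<noteq> [] \<Longrightarrow> dpoly_subst A \<phi> (Poly_Mapping.single ((j, b) # w) c) =
    mul A (uact A b (\<phi> j)) (dpoly_subst A \<phi> (Poly_Mapping.single w c))"
proof -
  assume w: "w \<noteq> []"
  then obtain x xs where "w = x # xs" by (cases w) auto
  moreover have "list_mul (mul A) (map (\<lambda>(j, b). uact A b (\<phi> j)) w) \<in> carr A"
    using w by (intro list_mul_closed) (auto simp: uact_subst_closed)
  ultimately show ?thesis
    by (simp add: dpoly_subst_def mul_scl_right uact_subst_closed)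
qed

lemma dpoly_subst_closed: "f \<in> diff_polys B \<Longrightarrow> dpoly_subst A \<phi> f \<in> carr A"
  unfolding dpoly_subst_def lin_ext_def
  by (intro subspace_sum subspace_scale subspace_carr list_mul_closed)
    (auto simp: diff_polys_def uact_subst_closed)

lemma dpoly_subst_letter_mult:
  assumes f: "f \<in> diff_polys B"
  shows "dpoly_subst A \<phi> (Poly_Mapping.single [(j, b)] 1 * f) =
    mul A (uact A b (\<phi> j)) (dpoly_subst A \<phi> f)"
proof -
  have "dpoly_subst A \<phi> (Poly_Mapping.single [(j, b)] 1 *
      (\<Sum>w\<in>K. smul (Poly_Mapping.lookup f w) (Poly_Mapping.single w 1))) =
    mul A (uact A b (\<phi> j))
      (dpoly_subst A \<phi> (\<Sum>w\<in>K. smul (Poly_Mapping.lookup f w) (Poly_Mapping.single w 1)))"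
    if "finite K" "K \<subseteq> Poly_Mapping.keys f" for K
    using that
  proof (induction K)
    case empty
    show ?case by (simp add: dpoly_subst_linear mul_0 uact_subst_closed)
  next
    case (insert w K)
    let ?s = "\<Sum>w\<in>K. smul (Poly_Mapping.lookup f w) (Poly_Mapping.single w 1)"
    let ?t = "Poly_Mapping.single w (Poly_Mapping.lookup f w)"
    have w: "w' \<noteq> []" "ok_word B w'" if "w' \<in> insert w K" for w'
      using f insert.prems that by (auto simp: diff_polys_def)
    then have t: "Poly_Mapping.single w' c \<in> diff_polys B" if "w' \<in> insert w K" for w' c
      using that by (intro single_in_diff_polys)
    then have cl: "?t \<in> diff_polys B" "?s \<in> diff_polys B"
      by (auto intro!: pm.subspace_sum subspace_diff_polys)
    have step: "dpoly_subst A \<phi> (Poly_Mapping.single [(j, b)] 1 * (?t + s)) =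
        mul A (uact A b (\<phi> j)) (dpoly_subst A \<phi> (?t + s))"
      if "s \<in> diff_polys B" "dpoly_subst A \<phi> (Poly_Mapping.single [(j, b)] 1 * s) =
        mul A (uact A b (\<phi> j)) (dpoly_subst A \<phi> s)" for s
      using that cl(1) w[of w]
      by (simp add: distrib_left dpoly_subst_linear mult_single plus_list_def dpoly_subst_word
          mul_add_right uact_subst_closed dpoly_subst_closed)
    have "dpoly_subst A \<phi> (Poly_Mapping.single [(j, b)] 1 * (?t + ?s)) =
        mul A (uact A b (\<phi> j)) (dpoly_subst A \<phi> (?t + ?s))"
      by (rule step[OF cl(2)]) (use insert in auto)
    then show ?case using insert by simp
  qed
  from this[of "Poly_Mapping.keys f"] show ?thesis
    by (simp only: poly_mapping_as_sum[symmetric] finite_keys order_refl simp_thms)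
qed

text \<open>
  Evaluation is the homomorphism of \<open>L\<close>-algebras that extends \<open>\<phi>\<close>: it is multiplicative,
  commutes with \<open>U(L)\<close>, and is compatible with substitutions. These are the closure properties that
  make the identities of an \<open>L\<close>-algebra a \<open>T\<^sub>L\<close>-ideal.
\<close>

lemma dpoly_subst_mult:
  assumes "f \<in> diff_polys B" "g \<in> diff_polys B"
  shows "dpoly_subst A \<phi> (f * g) = mul A (dpoly_subst A \<phi> f) (dpoly_subst A \<phi> g)"
  using assms(1)
proof (induction f rule: diff_polys_induct)
  case (letter j b)
  then show ?case using assms by (simp add: dpoly_subst_letter_mult dpoly_subst_letter)
next
  case (mult j b f)
  then show ?case
    using assms diff_polys_mult[of f B g]
    by (simp add: dpoly_subst_letter_mult mult.assoc mul_assoc dpoly_subst_closed uact_subst_closed)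
next
  case (add f g)
  then show ?case
    using assms by (simp add: distrib_right dpoly_subst_linear mul_add_left dpoly_subst_closed)
next
  case (smul c f)
  then show ?case
    using assms by (simp add: smul_mult_left dpoly_subst_linear mul_scl_left dpoly_subst_closed)
qed (use assms in \<open>simp add: dpoly_subst_linear mul_0 dpoly_subst_closed\<close>)

context
  assumes B: "U.independent B" "U.span B = UNIV"
begin

lemma dpoly_subst_xgen: "dpoly_subst A \<phi> (xgen B j h) = uact A h (\<phi> j)"
proof -
  let ?S = "{b. U.representation B h b \<noteq> 0}"
  have "dpoly_subst A \<phi> (xgen B j h) = (\<Sum>b\<in>?S. uact A (uscale (U.representation B h b) b) (\<phi> j))"
    using \<phi> by (simp add: xgen_def dpoly_subst_linear dpoly_subst_letter uact_uscale image_subset_iff)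
  also have "\<dots> = uact A (\<Sum>b\<in>?S. uscale (U.representation B h b) b) (\<phi> j)"
    using \<phi> by (simp add: uact_sum image_subset_iff)
  also have "(\<Sum>b\<in>?S. uscale (U.representation B h b) b) = h"
    using B by (simp add: U.sum_nonzero_representation_eq)
  finally show ?thesis .
qed

lemma dpoly_subst_dpoly_act:
  assumes "f \<in> diff_polys B"
  shows "dpoly_subst A \<phi> (dpoly_act B u f) = act A u (dpoly_subst A \<phi> f)"
  using assms
proof (induction f rule: diff_polys_induct)
  case (letter j b)
  then show ?case
    using \<phi> dpoly_act_xgen[OF B, of u j b] xgen_basis[OF B(1), of b j]
    by (simp add: dpoly_subst_letter dpoly_subst_xgen uact_mult uact_lie_emb uact_closed image_subset_iff)
next
  case (mult j b f)
  have x: "Poly_Mapping.single [(j, b)] 1 \<in> diff_polys B"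
    using mult by (auto intro: single_in_diff_polys)
  have "dpoly_subst A \<phi> (dpoly_act B u (Poly_Mapping.single [(j, b)] 1)) = act A u (uact A b (\<phi> j))"
    using \<phi> dpoly_act_xgen[OF B, of u j b] xgen_basis[OF B(1) mult(2), of j]
    by (simp add: dpoly_subst_letter dpoly_subst_xgen uact_mult uact_lie_emb uact_closed image_subset_iff)
  then show ?case
    using mult x by (simp add: dpoly_act_mult dpoly_subst_linear dpoly_subst_mult dpoly_act_closed
        dpoly_subst_letter act_props uact_subst_closed dpoly_subst_closed)
next
  case (add f g)
  then show ?case
    by (simp add: dpoly_act_linear dpoly_subst_linear act_props dpoly_subst_closed)
next
  case (smul c f)
  then show ?case
    by (simp add: dpoly_act_linear dpoly_subst_linear act_props dpoly_subst_closed)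
next
  case zero
  show ?case
    using act_props(3)[OF zero_closed, of u 0] by (simp add: dpoly_act_linear dpoly_subst_linear)
qed

lemma dpoly_subst_uact:
  assumes f: "f \<in> diff_polys B"
  shows "dpoly_subst A \<phi> (uact (free_L_algebra B) h f) = uact A h (dpoly_subst A \<phi> f)"
proof -
  interpret F: L_algebra "free_L_algebra B" by (rule L_algebra_free[OF B])
  have fc: "f \<in> carr (free_L_algebra B)" using f by simp
  have af: "dpoly_subst A \<phi> f \<in> carr A" using f by (rule dpoly_subst_closed)
  show ?thesis
  proof (induction h rule: uea_induct)
    case one
    show ?case by (simp only: F.uact_1[OF fc] uact_1[OF af])
  next
    case (lie u h)
    have "uact (free_L_algebra B) h f \<in> diff_polys B" using F.uact_closed[OF fc] by simp
    then show ?case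
      using F.uact_mult[OF fc, of "lie_emb u" h] F.uact_lie_emb[OF F.uact_closed[OF fc, of h], of u] lie
      by (simp add: dpoly_subst_dpoly_act uact_mult uact_lie_emb uact_closed af)
  next
    case (add g h)
    then show ?case by (simp add: F.uact_add[OF fc] dpoly_subst_linear uact_add af)
  next
    case (scale c h)
    then show ?case using F.uact_uscale[OF fc, of c h] by (simp add: dpoly_subst_linear uact_uscale af)
  qed
qed

lemma dpoly_subst_subst:
  assumes f: "f \<in> diff_polys B" and \<psi>: "range \<psi> \<subseteq> diff_polys B"
  shows "dpoly_subst A \<phi> (dpoly_subst (free_L_algebra B) \<psi> f) =
    dpoly_subst A (\<lambda>j. dpoly_subst A \<phi> (\<psi> j)) f"
proof -
  interpret F: L_algebra "free_L_algebra B" by (rule L_algebra_free[OF B])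
  have \<psi>': "range \<psi> \<subseteq> carr (free_L_algebra B)" using \<psi> by simp
  have Fcl: "dpoly_subst (free_L_algebra B) \<psi> g \<in> diff_polys B" if "g \<in> diff_polys B" for g
    using F.dpoly_subst_closed[OF \<psi>' that] by simp
  have \<phi>\<psi>: "range (\<lambda>j. dpoly_subst A \<phi> (\<psi> j)) \<subseteq> carr A"
    using \<psi> by (auto intro: dpoly_subst_closed)
  have uc: "uact (free_L_algebra B) b (\<psi> j) \<in> diff_polys B" for b j
    using F.uact_subst_closed[OF \<psi>', of b j] by simp
  have \<psi>j: "\<psi> j \<in> diff_polys B" for j using \<psi> by auto
  show ?thesis using f
  proof (induction f rule: diff_polys_induct)
    case (letter j b)
    show ?case
      using F.dpoly_subst_letter[of \<psi> j b 1]
      by (simp add: dpoly_subst_letter dpoly_subst_uact \<psi>j)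
  next
    case (mult j b f)
    have "dpoly_subst (free_L_algebra B) \<psi> (Poly_Mapping.single [(j, b)] 1 * f) =
      uact (free_L_algebra B) b (\<psi> j) * dpoly_subst (free_L_algebra B) \<psi> f"
      using F.dpoly_subst_letter_mult[OF \<psi>' mult(3), of j b] by simp
    then show ?case
      using mult Fcl L_algebra.dpoly_subst_letter_mult[OF L_algebra_axioms \<phi>\<psi> mult(3), of j b]
      by (simp add: dpoly_subst_mult uc dpoly_subst_uact \<psi>j)
  next
    case (add f g)
    then show ?case by (simp add: dpoly_subst_linear F.dpoly_subst_linear)
  next
    case (smul c f)
    then show ?case
      using F.dpoly_subst_linear(3)[of \<psi> c f] by (simp add: dpoly_subst_linear)
  qed (simp add: dpoly_subst_linear F.dpoly_subst_linear)
qed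

end

end

lemma T_L_ideal_diff_ids:
  assumes B: "U.independent B" "U.span B = UNIV"
  shows "T_L_ideal B (diff_ids B A)"
proof -
  interpret F: L_algebra "free_L_algebra B" by (rule L_algebra_free[OF B])
  have Fu: "uact (free_L_algebra B) h f \<in> diff_polys B" if "f \<in> diff_polys B" for h f
    using F.uact_closed[of f h] that by simp
  have Fs: "dpoly_subst (free_L_algebra B) \<psi> f \<in> diff_polys B"
    if "f \<in> diff_polys B" "range \<psi> \<subseteq> diff_polys B" for \<psi> f
    using F.dpoly_subst_closed[of \<psi> f B] that by simp
  show ?thesis unfolding T_L_ideal_def
  proof (intro conjI ballI allI impI)
    show "diff_ids B A \<subseteq> diff_polys B" by (auto simp: diff_ids_def)
    show "pm.subspace (diff_ids B A)"
      by (rule pm.subspaceI)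
        (auto simp: diff_ids_def dpoly_subst_linear intro: pm.subspace_0 pm.subspace_add
          pm.subspace_scale subspace_diff_polys)
    show "f * g \<in> diff_ids B A" "g * f \<in> diff_ids B A"
      if "f \<in> diff_ids B A" "g \<in> diff_polys B" for f g
      using that
      by (auto simp: diff_ids_def diff_polys_mult dpoly_subst_mult[where B = B] mul_0
          dpoly_subst_closed[where B = B])
    show "uact (free_L_algebra B) h f \<in> diff_ids B A" if "f \<in> diff_ids B A" for f h
      using that by (auto simp: diff_ids_def Fu dpoly_subst_uact[OF _ B] uact_0_right)
    show "dpoly_subst (free_L_algebra B) \<psi> f \<in> diff_ids B A"
      if "f \<in> diff_ids B A" "range \<psi> \<subseteq> diff_polys B" for f \<psi>
    proof -
      have "range (\<lambda>j. dpoly_subst A \<phi> (\<psi> j)) \<subseteq> carr A" if "range \<phi> \<subseteq> carr A" for \<phi>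
        using that \<open>range \<psi> \<subseteq> diff_polys B\<close> by (auto intro: dpoly_subst_closed[where B = B])
      then show ?thesis
        using that by (auto simp: diff_ids_def Fs dpoly_subst_subst[OF _ B])
    qed
  qed
qed

end

lemma T_L_ideal_generated:
  assumes B: "U.independent B" "U.span B = UNIV" and S: "S \<subseteq> diff_polys B"
  shows "T_L_ideal B (T_L_generated B S)" "S \<subseteq> T_L_generated B S"
    "T_L_ideal B I \<Longrightarrow> S \<subseteq> I \<Longrightarrow> T_L_generated B S \<subseteq> I"
proof -
  interpret F: L_algebra "free_L_algebra B" by (rule L_algebra_free[OF B])
  have "T_L_ideal B (diff_polys B)"
    unfolding T_L_ideal_def
    using subspace_diff_polys diff_polys_mult F.uact_closed F.dpoly_subst_closed[where B = B] by auto
  then show "T_L_ideal B (T_L_generated B S)"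
    unfolding T_L_generated_def T_L_ideal_def[of B "\<Inter> _"]
    apply (intro conjI ballI allI impI)
    subgoal using S by auto
    subgoal by (rule pm.subspace_Inter) (auto simp: T_L_ideal_def)
    by (auto simp: T_L_ideal_def)
qed (auto simp: T_L_generated_def)

section \<open>Derivations of \<open>M\<^sub>1\<close>\<close>

lemma derivations_cong:
  assumes A: "L_algebra A" and d: "\<And>m. m \<in> carr A \<Longrightarrow> d m = d' m"
  shows "d \<in> derivations A \<longleftrightarrow> d' \<in> derivations A"
proof -
  interpret L_algebra A by fact
  show ?thesis
    unfolding derivations_def
    using d subspace_add[OF subspace_carr] subspace_scale[OF subspace_carr] mul_closed by auto
qed

text \<open>
  The products \<open>e\<^sub>2\<^sub>2 e\<^sub>2\<^sub>2 = e\<^sub>2\<^sub>2\<close> and \<open>e\<^sub>2\<^sub>2 e\<^sub>1\<^sub>2 = 0\<close> force a derivation to send both basis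
  vectors to multiples of \<open>e\<^sub>1\<^sub>2\<close>; the two factors are the coordinates of \<open>u\<close>.
\<close>

lemma derivations_M1D_iff:
  "d \<in> derivations (M1D :: ('f::field, 'f ^ 2 ^ 2) L_struct) \<longleftrightarrow>
    (\<exists>!u. \<forall>m\<in>carr M1D. d m = act M1D u m)"
proof
  interpret L_algebra "M1D :: ('f, 'f ^ 2 ^ 2) L_struct" by (rule L_algebra_M1D)
  let ?e = "mat_unit 2 2 :: 'f ^ 2 ^ 2" and ?f = "mat_unit 1 2 :: 'f ^ 2 ^ 2"
  assume d: "d \<in> derivations (M1D :: ('f, 'f ^ 2 ^ 2) L_struct)"
  have ef: "?e \<in> carr M1D" "?f \<in> carr M1D" by (simp_all add: M1D_sel mat_unit_def)
  have prods: "?e ** ?e = ?e" "?e ** ?f = mat_scale 0 ?f"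
    by (simp_all add: mat2_eq_iff mat2_nth mat_unit_def)
  have cl: "d m \<in> carr M1D" if "m \<in> carr M1D" for m using d that by (simp add: derivations_def)
  have "d (?e ** ?e) = d ?e ** ?e + ?e ** d ?e" "d (?e ** ?f) = d ?e ** ?f + ?e ** d ?f"
    "d (mat_scale 0 ?f) = mat_scale 0 (d ?f)"
    using d ef by (simp_all add: derivations_def M1D_sel(2,3))
  then have "d ?e $ 2 $ 2 = (d ?e ** ?e + ?e ** d ?e) $ 2 $ 2"
    "mat_scale 0 (d ?f) $ 2 $ 2 = (d ?e ** ?f + ?e ** d ?f) $ 2 $ 2" by (simp_all add: prods)
  moreover have "(2 :: 'f) \<noteq> 1"
    by (metis add_cancel_right_right one_add_one zero_neq_one)
  ultimately have e: "d ?e $ 2 $ 2 = 0" "d ?f $ 2 $ 2 = 0"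
    using cl[OF ef(1)] by (simp_all add: mat2_nth mat_unit_def M1D_sel(1))
  show "\<exists>!u. \<forall>m\<in>carr M1D. d m = act M1D u m"
  proof (rule ex1I)
    let ?u = "d ?f $ 1 $ 2 *s lie_eps + d ?e $ 1 $ 2 *s lie_del"
    show "\<forall>m\<in>carr M1D. d m = act M1D ?u m"
    proof
      fix m :: "'f ^ 2 ^ 2" assume m: "m \<in> carr M1D"
      have "m = mat_scale (m $ 2 $ 2) ?e + mat_scale (m $ 1 $ 2) ?f"
        using m by (simp add: M1D_sel mat2_eq_iff mat2_nth mat_unit_def)
      then have "d m = d (mat_scale (m $ 2 $ 2) ?e + mat_scale (m $ 1 $ 2) ?f)" by (rule arg_cong)
      also have "\<dots> = d (mat_scale (m $ 2 $ 2) ?e) + d (mat_scale (m $ 1 $ 2) ?f)"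
        using d ef subspace_scale[OF subspace_carr] by (simp add: derivations_def M1D_sel(2))
      also have "\<dots> = mat_scale (m $ 2 $ 2) (d ?e) + mat_scale (m $ 1 $ 2) (d ?f)"
        using d ef by (simp add: derivations_def M1D_sel(2))
      also have "\<dots> = act M1D ?u m"
        using cl[OF ef(1)] cl[OF ef(2)] e
        by (simp add: mat2_eq_iff mat2_nth M1D_sel lie_eps_def lie_del_def axis_def)
      finally show "d m = act M1D ?u m" .
    qed
  next
    fix u assume "\<forall>m\<in>carr M1D. d m = act M1D u m"
    then have "d ?e $ 1 $ 2 = act M1D u ?e $ 1 $ 2" "d ?f $ 1 $ 2 = act M1D u ?f $ 1 $ 2"
      using ef by auto
    then show "u = d ?f $ 1 $ 2 *s lie_eps + d ?e $ 1 $ 2 *s lie_del"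
      by (simp add: M1D_sel mat_unit_def vec_eq_iff forall_2 lie_eps_def lie_del_def axis_def)
  qed
next
  assume "\<exists>!u. \<forall>m\<in>carr M1D. d m = act M1D u m"
  then obtain u where "\<forall>m\<in>carr M1D. d m = act M1D u m" by auto
  then show "d \<in> derivations (M1D :: ('f, 'f ^ 2 ^ 2) L_struct)"
    using derivations_cong[OF L_algebra_M1D, of d "act M1D u"] L_algebra.act_derivation[OF L_algebra_M1D]
    by blast
qed

section \<open>Consequences of the identities of \<open>M\<^sub>1\<close>\<close>

text \<open>
  The matrix entries of the action of \<open>h\<close> on \<open>M\<^sub>1\<close>. The first is the augmentation of \<open>U(L)\<close>, the
  last is the character with \<open>\<epsilon> \<mapsto> 1\<close> and \<open>\<delta> \<mapsto> 0\<close>.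
\<close>

definition aug :: "'f::field uea \<Rightarrow> 'f"
  where "aug h = uact M1D h (mat_unit 2 2) $ 2 $ 2"

definition del_coeff :: "'f::field uea \<Rightarrow> 'f"
  where "del_coeff h = uact M1D h (mat_unit 2 2) $ 1 $ 2"

definition eps_weight :: "'f::field uea \<Rightarrow> 'f"
  where "eps_weight h = uact M1D h (mat_unit 1 2) $ 1 $ 2"

interpretation M1: L_algebra M1D by (rule L_algebra_M1D)

lemma mat_unit_M1D [simp]: "mat_unit 2 2 \<in> carr M1D" "mat_unit 1 2 \<in> carr M1D"
  by (simp_all add: M1D_sel mat_unit_def)

lemma mat_unit_nth [simp]: "mat_unit a b $ r $ s = (if r = a \<and> s = b then 1 else 0)"
  by (simp add: mat_unit_def)

lemma U_functionals:
  "aug (1 :: 'f::field uea) = 1" "del_coeff (1 :: 'f uea) = 0" "eps_weight (1 :: 'f uea) = 1"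
  "aug (lie_emb u * h) = 0" "del_coeff (lie_emb u * h) = u $ 1 * del_coeff h + u $ 2 * aug h"
  "aug (g + h) = aug g + aug h" "del_coeff (g + h) = del_coeff g + del_coeff h"
  "eps_weight (g + h) = eps_weight g + eps_weight h"
  "aug (uscale c h) = c * aug h" "del_coeff (uscale c h) = c * del_coeff h"
  "eps_weight (uscale c h) = c * eps_weight h"
  by (simp_all add: aug_def del_coeff_def eps_weight_def M1.uact_1 M1.uact_mult M1.uact_lie_emb
    M1.uact_closed M1.uact_add M1.uact_uscale M1D_sel(2-) mat2_nth)

text \<open>
  The hypothesis holds for every \<open>h\<close>, but that is part of the next lemma, whose induction rests on
  this formula.
\<close>

lemma eps_weight_lie_aux:
  assumes "uact M1D h (mat_unit 1 2) $ 2 $ 2 = 0"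
  shows "eps_weight (lie_emb u * h) = u $ 1 * eps_weight h"
  using assms by (simp add: eps_weight_def M1.uact_mult M1.uact_lie_emb M1.uact_closed M1D_sel(2-))

lemma uact_M1D:
  "m \<in> carr M1D \<Longrightarrow> uact M1D h m $ 2 $ 2 = aug h * m $ 2 $ 2"
  "m \<in> carr M1D \<Longrightarrow> uact M1D h m $ 1 $ 2 = del_coeff h * m $ 2 $ 2 + eps_weight h * m $ 1 $ 2"
proof -
  have "\<forall>m\<in>carr M1D. uact M1D h m $ 2 $ 2 = aug h * m $ 2 $ 2 \<and>
    uact M1D h m $ 1 $ 2 = del_coeff h * m $ 2 $ 2 + eps_weight h * m $ 1 $ 2"
  proof (induction h rule: uea_induct)
    case one
    show ?case by (simp add: M1.uact_1 U_functionals)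
  next
    case (lie u h)
    have "uact M1D h (mat_unit 1 2) $ 2 $ 2 = 0" using lie by simp
    note ew = eps_weight_lie_aux[OF this, of u]
    show ?case
      using lie by (simp add: M1.uact_mult M1.uact_lie_emb M1.uact_closed M1D_sel(2-) algebra_simps
        U_functionals ew)
  next
    case (add g h)
    then show ?case by (simp add: M1.uact_add U_functionals algebra_simps)
  next
    case (scale c h)
    then show ?case by (simp add: M1.uact_uscale U_functionals algebra_simps M1D_sel(2) mat2_nth)
  qed
  then show "m \<in> carr M1D \<Longrightarrow> uact M1D h m $ 2 $ 2 = aug h * m $ 2 $ 2"
    "m \<in> carr M1D \<Longrightarrow> uact M1D h m $ 1 $ 2 = del_coeff h * m $ 2 $ 2 + eps_weight h * m $ 1 $ 2"
    by auto
qed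

lemma eps_weight_lie: "eps_weight (lie_emb u * h) = u $ 1 * eps_weight h"
  by (rule eps_weight_lie_aux) (simp add: uact_M1D)

abbreviation U_eps :: "'f::field uea" where "U_eps \<equiv> lie_emb lie_eps"
abbreviation U_del :: "'f::field uea" where "U_del \<equiv> lie_emb lie_del"

lemma U_functionals_lie:
  "aug (lie_emb u) = 0" "eps_weight (lie_emb u) = u $ 1" "del_coeff (lie_emb u) = u $ 2"
  using U_functionals(4,5)[of u 1] eps_weight_lie[of u 1] by (simp_all add: U_functionals(1-3))

lemma U_functionals_diff:
  "aug (g - h) = aug g - aug h" "del_coeff (g - h) = del_coeff g - del_coeff h"
  "eps_weight (g - h) = eps_weight g - eps_weight h"
  using U_functionals(6-8)[of "g - h" h] by (simp_all add: algebra_simps)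

lemma lie_basis_nth: "lie_eps $ 1 = 1" "lie_eps $ 2 = 0" "lie_del $ 1 = 0" "lie_del $ 2 = 1"
  by (simp_all add: lie_eps_def lie_del_def axis_def)

lemma M1D_mult_nth: "m \<in> carr M1D \<Longrightarrow> (m ** m') $ a $ 2 = m $ a $ 2 * m' $ 2 $ 2"
  for m m' :: "'f::field ^ 2 ^ 2"
  using exhaust_2[of a] by (auto simp: M1D_sel mat2_nth)

abbreviation (input) var_word :: "nat list \<Rightarrow> 'f::field dpoly"
  where "var_word js \<equiv> Poly_Mapping.single (map (\<lambda>j. (j, 1)) js) 1"

fun head_word :: "'f::field uea set \<Rightarrow> 'f uea \<Rightarrow> nat list \<Rightarrow> 'f dpoly"
  where "head_word B h [] = 0"
  | "head_word B h (l # ls) = xgen B l h * var_word ls"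

text \<open>
  The variable \<open>k\<close> of the unary identities is independent of \<open>i\<close> and \<open>j\<close>, because the passage to
  \<open>M\<^sub>2\<close> exchanges \<open>i\<close> and \<open>j\<close> in the binary identities only.
\<close>

locale M1_T_ideal =
  fixes B :: "'f::field uea set" and J :: "'f dpoly set" and i j k :: nat
  assumes B: "U.independent B" "U.span B = UNIV" "1 \<in> B"
    and J: "T_L_ideal B J"
    and ijk: "1 \<le> i" "1 \<le> j" "i \<noteq> j" "1 \<le> k"
    and gens: "xgen B i 1 * xgen B j U_eps \<in> J"
      "xgen B i U_eps * xgen B j 1 - xgen B j U_eps * xgen B i 1 -
        (xgen B i 1 * xgen B j 1 - xgen B j 1 * xgen B i 1) \<in> J"
      "xgen B k (U_eps\<^sup>2) - xgen B k U_eps \<in> J" "xgen B k (U_del * U_eps) \<in> J"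
      "xgen B k (U_eps * U_del) - xgen B k U_del \<in> J"
begin

sublocale F: L_algebra "free_L_algebra B" by (rule L_algebra_free[OF B(1,2)])

abbreviation act_on :: "'f uea \<Rightarrow> 'f dpoly \<Rightarrow> 'f dpoly" where "act_on \<equiv> uact (free_L_algebra B)"

abbreviation D where "D \<equiv> diff_polys B"

lemma J_closed:
  "J \<subseteq> D" "pm.subspace J" "f \<in> J \<Longrightarrow> g \<in> D \<Longrightarrow> f * g \<in> J" "f \<in> J \<Longrightarrow> g \<in> D \<Longrightarrow> g * f \<in> J"
  "f \<in> J \<Longrightarrow> act_on h f \<in> J"
  "f \<in> J \<Longrightarrow> range \<phi> \<subseteq> D \<Longrightarrow> dpoly_subst (free_L_algebra B) \<phi> f \<in> J"
  using J by (auto simp: T_L_ideal_def)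

lemma act_on_lie: "f \<in> D \<Longrightarrow> act_on (lie_emb u) f = dpoly_act B u f"
  using F.uact_lie_emb[of f u] by simp

lemma act_on_mult: "f \<in> D \<Longrightarrow> act_on (g * h) f = act_on g (act_on h f)"
  using F.uact_mult[of f g h] by simp

lemma act_on_xgen: "1 \<le> l \<Longrightarrow> act_on g (xgen B l h) = xgen B l (g * h)"
proof (induction g rule: uea_induct)
  case one
  then show ?case using F.uact_1 by (simp add: xgen_in_diff_polys)
next
  case (lie u g)
  then show ?case
    by (simp add: act_on_mult xgen_in_diff_polys act_on_lie dpoly_act_xgen[OF B(1,2)] mult.assoc)
next
  case (add g h)
  then show ?case
    using F.uact_add by (simp add: xgen_in_diff_polys distrib_right xgen_add[OF B(1,2)])
next
  case (scale c h)
  then show ?case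
    using F.uact_uscale by (simp add: xgen_in_diff_polys uscale_mult xgen_uscale[OF B(1,2)])
qed

text \<open>
  Stability of \<open>J\<close> under substitutions frees the generators from their variables.
\<close>

lemma J_relations:
  assumes f: "f \<in> D" and g: "g \<in> D"
  shows "f * act_on U_eps g \<in> J"
    "act_on U_eps f * g - act_on U_eps g * f - (f * g - g * f) \<in> J"
    "act_on (U_eps\<^sup>2) f - act_on U_eps f \<in> J" "act_on (U_del * U_eps) f \<in> J"
    "act_on (U_eps * U_del) f - act_on U_del f \<in> J"
proof -
  let ?\<phi> = "\<lambda>l. if l = i then f else g"
  have \<phi>: "range ?\<phi> \<subseteq> carr (free_L_algebra B)" using f g by auto
  have \<phi>f: "range (\<lambda>_. f) \<subseteq> carr (free_L_algebra B)" using f by auto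
  have x: "xgen B l h \<in> D" if "l = i \<or> l = j \<or> l = k" for l h
    using ijk that by (auto intro: xgen_in_diff_polys)
  note sub = F.dpoly_subst_linear F.dpoly_subst_mult[where B = B, OF \<phi>, simplified]
    F.dpoly_subst_xgen[OF \<phi> B(1,2)] F.dpoly_subst_xgen[OF \<phi>f B(1,2)]
  have one: "act_on 1 f = f" "act_on 1 g = g" using F.uact_1 f g by simp_all
  have ji: "j \<noteq> i" using ijk by simp
  show "f * act_on U_eps g \<in> J"
    using J_closed(6)[OF gens(1), of ?\<phi>] \<phi> ji by (simp add: sub x one)
  show "act_on U_eps f * g - act_on U_eps g * f - (f * g - g * f) \<in> J"
    using J_closed(6)[OF gens(2), of ?\<phi>] \<phi> ji by (simp add: sub x one)
  show "act_on (U_eps\<^sup>2) f - act_on U_eps f \<in> J"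
    using J_closed(6)[OF gens(3), of "\<lambda>_. f"] \<phi>f by (simp add: sub x one)
  show "act_on (U_del * U_eps) f \<in> J"
    using J_closed(6)[OF gens(4), of "\<lambda>_. f"] \<phi>f by (simp add: sub x one)
  show "act_on (U_eps * U_del) f - act_on U_del f \<in> J"
    using J_closed(6)[OF gens(5), of "\<lambda>_. f"] \<phi>f by (simp add: sub x one)
qed

definition cong :: "'f dpoly \<Rightarrow> 'f dpoly \<Rightarrow> bool" (infix \<open>\<cong>\<close> 50) where "f \<cong> g \<longleftrightarrow> f - g \<in> J"

lemma cong_refl [simp]: "f \<cong> f"
  using pm.subspace_0[OF J_closed(2)] by (simp add: cong_def)

lemma cong_sym: "f \<cong> g \<Longrightarrow> g \<cong> f"
  using pm.subspace_neg[OF J_closed(2)] by (force simp: cong_def)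

lemma cong_trans [trans]: "f \<cong> g \<Longrightarrow> g \<cong> h \<Longrightarrow> f \<cong> h"
  using pm.subspace_add[OF J_closed(2), of "f - g" "g - h"] by (simp add: cong_def)

lemma cong_add: "f \<cong> f' \<Longrightarrow> g \<cong> g' \<Longrightarrow> f + g \<cong> f' + g'"
  using pm.subspace_add[OF J_closed(2), of "f - f'" "g - g'"] by (simp add: cong_def algebra_simps)

lemma cong_smul: "f \<cong> f' \<Longrightarrow> smul c f \<cong> smul c f'"
  using pm.subspace_scale[OF J_closed(2), of "f - f'" c]
  by (simp add: cong_def pm.scale_right_diff_distrib)

lemma cong_sum: "(\<And>s. s \<in> S \<Longrightarrow> f s \<cong> g s) \<Longrightarrow> sum f S \<cong> sum g S"
  by (induction S rule: infinite_finite_induct) (auto intro: cong_add)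

lemma cong_mult_left: "f \<cong> f' \<Longrightarrow> g \<in> D \<Longrightarrow> g * f \<cong> g * f'"
  using J_closed(4)[of "f - f'" g] by (simp add: cong_def algebra_simps)

lemma cong_mult_word: "f \<cong> f' \<Longrightarrow> ok_word B w \<Longrightarrow>
    f * Poly_Mapping.single w 1 \<cong> f' * Poly_Mapping.single w 1"
  using J_closed(3)[of "f - f'" "Poly_Mapping.single w 1"] single_in_diff_polys[of w B 1]
  by (cases "w = []") (auto simp: cong_def algebra_simps single_Nil)

lemma cong_act: "f \<cong> f' \<Longrightarrow> f \<in> D \<Longrightarrow> f' \<in> D \<Longrightarrow> act_on h f \<cong> act_on h f'"
  using J_closed(5)[of "f - f'" h] F.uact_diff_right[of f f' h] by (simp add: cong_def)

lemma ok_var_word: "\<forall>j\<in>set js. 1 \<le> j \<Longrightarrow> ok_word B (map (\<lambda>j. (j, 1)) js)"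
  using B(3) by auto

lemma xgen_1: "xgen B l 1 = Poly_Mapping.single [(l, 1)] 1"
  by (simp add: xgen_basis B)

text \<open>
  Modulo \<open>J\<close> the span of \<open>1 - \<epsilon>\<close>, \<open>\<epsilon>\<close> and \<open>\<delta>\<close> is stable under multiplication by \<open>\<epsilon>\<close> and \<open>\<delta>\<close>
  from the left. The product that is not covered by a generator is \<open>\<delta>\<^sup>2\<close>: here \<open>x\<close> with exponent
  \<open>\<delta>\<epsilon>\<delta>\<close> is congruent both to \<open>0\<close> and to \<open>x\<close> with exponent \<open>\<delta>\<^sup>2\<close>.
\<close>

lemma xgen_reduce:
  assumes l: "1 \<le> l"
  shows "xgen B l h \<cong> smul (aug h) (xgen B l (1 - U_eps)) + smul (eps_weight h) (xgen B l U_eps)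
    + smul (del_coeff h) (xgen B l U_del)"
proof (induction h rule: uea_induct)
  case one
  show ?case by (simp add: U_functionals flip: xgen_add[OF B(1,2)])
next
  case (lie u h)
  let ?x = "xgen B l"
  have D: "?x h \<in> D" for h using l by (rule xgen_in_diff_polys)
  have 1: "?x (U_eps * U_eps) \<cong> ?x U_eps" "?x (U_del * U_eps) \<cong> 0" "?x (U_eps * U_del) \<cong> ?x U_del"
    using J_relations(3-5)[OF D D, of 1] by (simp_all add: act_on_xgen[OF l] cong_def power2_eq_square)
  have "?x (U_del * U_eps * U_del) \<cong> 0"
    using J_relations(4)[OF D D, of U_del] by (simp add: act_on_xgen[OF l] cong_def)
  moreover have "?x (U_del * U_eps * U_del) \<cong> ?x (U_del * U_del)"
    using cong_act[OF 1(3), of U_del] by (simp add: act_on_xgen[OF l] D mult.assoc)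
  ultimately have 2: "?x (U_del * U_del) \<cong> 0" using cong_sym cong_trans by blast
  have u: "lie_emb u = uscale (u $ 1) U_eps + uscale (u $ 2) U_del"
    by (subst lie_basis) (simp add: lie_emb_linear)
  have xl: "?x (lie_emb u * g) = smul (u $ 1) (?x (U_eps * g)) + smul (u $ 2) (?x (U_del * g))" for g
    by (simp add: u distrib_right uscale_mult xgen_add[OF B(1,2)] xgen_uscale[OF B(1,2)])
  have a: "?x (lie_emb u * U_eps) \<cong> smul (u $ 1) (?x U_eps) + smul (u $ 2) 0"
    unfolding xl by (intro cong_add cong_smul 1)
  have b: "?x (lie_emb u * U_del) \<cong> smul (u $ 1) (?x U_del) + smul (u $ 2) 0"
    unfolding xl by (intro cong_add cong_smul 1 2)
  have c: "?x (lie_emb u * (1 - U_eps)) \<cong> smul (u $ 2) (?x U_del)"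
  proof -
    have "?x (lie_emb u * 1) + smul (-1) (?x (lie_emb u * U_eps)) \<cong>
      ?x (lie_emb u * 1) + smul (-1) (smul (u $ 1) (?x U_eps) + smul (u $ 2) 0)"
      by (intro cong_add cong_smul a cong_refl)
    moreover have "?x (lie_emb u * 1) = smul (u $ 1) (?x U_eps) + smul (u $ 2) (?x U_del)"
      by (subst xl) simp
    moreover have "?x (lie_emb u * (1 - U_eps)) = ?x (lie_emb u * 1) + smul (-1) (?x (lie_emb u * U_eps))"
      by (simp add: right_diff_distrib xgen_diff[OF B(1,2)])
    ultimately show ?thesis by simp
  qed
  have "?x (lie_emb u * h) = act_on (lie_emb u) (?x h)" by (simp add: act_on_xgen[OF l])
  also have "\<dots> \<cong> act_on (lie_emb u) (smul (aug h) (?x (1 - U_eps)) + smul (eps_weight h) (?x U_eps)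
      + smul (del_coeff h) (?x U_del))"
    by (intro cong_act lie D pm.subspace_add pm.subspace_scale subspace_diff_polys)
  also have "\<dots> = smul (aug h) (?x (lie_emb u * (1 - U_eps))) + smul (eps_weight h) (?x (lie_emb u * U_eps))
      + smul (del_coeff h) (?x (lie_emb u * U_del))"
    by (simp add: act_on_lie D pm.subspace_add pm.subspace_scale subspace_diff_polys
      dpoly_act_linear dpoly_act_xgen[OF B(1,2)])
  also have "\<dots> \<cong> smul (aug h) (smul (u $ 2) (?x U_del)) +
      smul (eps_weight h) (smul (u $ 1) (?x U_eps) + smul (u $ 2) 0) +
      smul (del_coeff h) (smul (u $ 1) (?x U_del) + smul (u $ 2) 0)"
    by (intro cong_add cong_smul a b c)
  also have "\<dots> = smul (aug (lie_emb u * h)) (?x (1 - U_eps)) + smul (eps_weight (lie_emb u * h)) (?x U_eps)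
      + smul (del_coeff (lie_emb u * h)) (?x U_del)"
    by (simp add: U_functionals eps_weight_lie pm.scale_left_distrib mult.commute)
  finally show ?case .
next
  case (add g h)
  have "xgen B l (g + h) = xgen B l g + xgen B l h" by (rule xgen_add[OF B(1,2)])
  also note cong_add[OF add]
  finally show ?case by (simp add: U_functionals pm.scale_left_distrib algebra_simps)
next
  case (scale c h)
  have "xgen B l (uscale c h) = smul c (xgen B l h)" by (rule xgen_uscale[OF B(1,2)])
  also note cong_smul[OF scale]
  finally show ?case by (simp add: U_functionals pm.scale_right_distrib)
qed

text \<open>
  Behind a factor \<open>f\<close> the exponents \<open>\<epsilon>\<close> and \<open>\<delta>\<close> give \<open>0\<close>: the first by \<open>f x\<^sup>\<epsilon> \<in> J\<close>, the second
  because \<open>x\<^sup>\<delta>\<close> is congruent to \<open>\<epsilon>(x\<^sup>\<delta>)\<close>.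
\<close>

lemma tail_letter_reduce:
  assumes f: "f \<in> D" and l: "1 \<le> l"
  shows "f * xgen B l h \<cong> smul (aug h) (f * xgen B l 1)"
proof -
  let ?x = "xgen B l"
  have x: "?x h \<in> D" for h using l by (rule xgen_in_diff_polys)
  have e: "f * ?x (U_eps * g) \<cong> 0" for g
    using J_relations(1)[OF f x, of g] by (simp add: act_on_xgen[OF l] cong_def)
  have "?x (U_eps * U_del) \<cong> ?x U_del"
    using J_relations(5)[OF x x, of 1] by (simp add: act_on_xgen[OF l] cong_def)
  from cong_mult_left[OF this f] have d: "f * ?x U_del \<cong> 0"
    using e cong_sym cong_trans by blast
  have "f * ?x h \<cong> f * (smul (aug h) (?x (1 - U_eps)) + smul (eps_weight h) (?x U_eps)
    + smul (del_coeff h) (?x U_del))"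
    by (rule cong_mult_left[OF xgen_reduce[OF l] f])
  also have "\<dots> = smul (aug h) (f * ?x 1) + smul (eps_weight h - aug h) (f * ?x (U_eps * 1)) +
      smul (del_coeff h) (f * ?x U_del)"
    by (simp add: distrib_left smul_mult_right xgen_diff[OF B(1,2)] right_diff_distrib
      pm.scale_left_diff_distrib pm.scale_right_diff_distrib)
  also have "\<dots> \<cong> smul (aug h) (f * ?x 1) + smul (eps_weight h - aug h) 0 + smul (del_coeff h) 0"
    by (intro cong_add cong_smul e d cong_refl)
  finally show ?thesis by simp
qed

lemma tail_reduce:
  assumes "f \<in> D" "ok_word B w"
  shows "f * Poly_Mapping.single w 1 \<cong> smul (\<Prod>(j, b)\<leftarrow>w. aug b) (f * var_word (map fst w))"
  using assms
proof (induction w arbitrary: f)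
  case Nil
  show ?case by (simp add: single_Nil)
next
  case (Cons a w)
  obtain l b where a: "a = (l, b)" by (cases a)
  have l: "1 \<le> l" "b \<in> B" and w: "ok_word B w" using Cons.prems a by auto
  have x: "xgen B l h \<in> D" for h using l(1) by (rule xgen_in_diff_polys)
  have "f * Poly_Mapping.single (a # w) 1 = (f * xgen B l b) * Poly_Mapping.single w 1"
    by (simp add: single_Cons[of "(l, b)" w] a xgen_basis[OF B(1) l(2)] mult.assoc)
  also have "\<dots> \<cong> smul (aug b) (f * xgen B l 1) * Poly_Mapping.single w 1"
    by (intro cong_mult_word tail_letter_reduce Cons.prems l w)
  also have "\<dots> = smul (aug b) ((f * xgen B l 1) * Poly_Mapping.single w 1)"
    by (rule smul_mult_left)
  also have "\<dots> \<cong> smul (aug b) (smul (\<Prod>(j, b)\<leftarrow>w. aug b) ((f * xgen B l 1) * var_word (map fst w)))"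
    by (intro cong_smul Cons.IH diff_polys_mult Cons.prems x w)
  also have "\<dots> = smul (\<Prod>(j, b)\<leftarrow>a # w. aug b) (f * var_word (map fst (a # w)))"
    using single_Cons[of "(l, 1 :: 'f uea)" "map (\<lambda>j. (j, 1)) (map fst w)", where 'f = 'f]
    by (simp add: a xgen_1 mult.assoc)
  finally show ?case .
qed

text \<open>
  The commutator of \<open>g\<close> and \<open>h\<close> is congruent to \<open>g\<^sup>\<epsilon> h - h\<^sup>\<epsilon> g\<close>, and multiplication by \<open>f\<close> from
  the left sends both terms into \<open>J\<close>.
\<close>

lemma tail_commute:
  assumes f: "f \<in> D" and g: "g \<in> D" and h: "h \<in> D"
  shows "f * g * h \<cong> f * h * g"
proof -
  have "f * (act_on U_eps g * h - act_on U_eps h * g - (g * h - h * g)) \<in> J"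
    by (rule J_closed(4)[OF J_relations(2)[OF g h] f])
  moreover have "f * act_on U_eps g * h \<in> J" "f * act_on U_eps h * g \<in> J"
    by (rule J_closed(3)[OF J_relations(1)[OF f g] h] J_closed(3)[OF J_relations(1)[OF f h] g])+
  ultimately have "f * act_on U_eps g * h - f * act_on U_eps h * g -
      f * (act_on U_eps g * h - act_on U_eps h * g - (g * h - h * g)) \<in> J"
    by (intro pm.subspace_diff[OF J_closed(2)])
  then show ?thesis by (simp add: cong_def algebra_simps)
qed

lemma var_word_Cons: "f * var_word (l # ls) = f * xgen B l 1 * var_word ls"
  using single_Cons[of "(l, 1 :: 'f uea)" "map (\<lambda>j. (j, 1)) ls", where 'f = 'f]
  by (simp add: xgen_1 mult.assoc)

lemma tail_insort:
  assumes "f \<in> D" "1 \<le> x" "\<forall>l\<in>set ls. 1 \<le> l"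
  shows "f * var_word (x # ls) \<cong> f * var_word (insort x ls)"
  using assms
proof (induction ls arbitrary: f)
  case (Cons y ls)
  have x: "xgen B x 1 \<in> D" "xgen B y 1 \<in> D" using Cons.prems by (auto intro: xgen_in_diff_polys)
  show ?case
  proof (cases "x \<le> y")
    case False
    have "f * var_word (x # y # ls) = f * xgen B x 1 * xgen B y 1 * var_word ls"
      by (simp only: var_word_Cons)
    also have "\<dots> \<cong> f * xgen B y 1 * xgen B x 1 * var_word ls"
      using Cons.prems x by (intro cong_mult_word tail_commute ok_var_word) auto
    also have "\<dots> = f * xgen B y 1 * var_word (x # ls)"
      by (simp only: var_word_Cons)
    also have "\<dots> \<cong> f * xgen B y 1 * var_word (insort x ls)"
      using Cons.prems x by (intro Cons.IH diff_polys_mult) auto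
    also have "\<dots> = f * var_word (insort x (y # ls))"
      using False by (simp only: var_word_Cons insort_key.simps if_False)
    finally show ?thesis .
  qed simp
qed simp

lemma tail_sort:
  assumes "f \<in> D" "\<forall>l\<in>set ls. 1 \<le> l"
  shows "f * var_word ls \<cong> f * var_word (sort ls)"
  using assms
proof (induction ls arbitrary: f)
  case (Cons x ls)
  have x: "xgen B x 1 \<in> D" using Cons.prems by (auto intro: xgen_in_diff_polys)
  have "f * var_word (x # ls) = f * xgen B x 1 * var_word ls" by (rule var_word_Cons)
  also have "\<dots> \<cong> f * xgen B x 1 * var_word (sort ls)"
    using Cons.prems x by (intro Cons.IH diff_polys_mult) auto
  also have "\<dots> = f * var_word (x # sort ls)" by (rule var_word_Cons[symmetric])
  also have "\<dots> \<cong> f * var_word (insort x (sort ls))"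
    using Cons.prems by (intro tail_insort) auto
  finally show ?case by simp
qed simp

text \<open>
  For \<open>1 - \<epsilon>\<close> this is the second generator with its terms rearranged. For \<open>\<delta>\<close> it is the image of
  that generator under \<open>\<delta>\<close>, in which every term other than \<open>x\<^sup>\<delta> y\<close> and \<open>y\<^sup>\<delta> x\<close> lies in \<open>J\<close>.
\<close>

lemma head_exchange:
  assumes xy: "1 \<le> x" "1 \<le> y" and h: "h = 1 - U_eps \<or> h = U_del"
  shows "xgen B x h * xgen B y 1 \<cong> xgen B y h * xgen B x 1"
proof -
  let ?x = "xgen B x" and ?y = "xgen B y"
  have D: "?x h \<in> D" "?y h \<in> D" for h using xy by (auto intro: xgen_in_diff_polys)
  have comm: "?x U_eps * ?y 1 - ?y U_eps * ?x 1 - (?x 1 * ?y 1 - ?y 1 * ?x 1) \<in> J"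
    using J_relations(2)[OF D, of 1 1] by (simp add: act_on_xgen[OF xy(1)] act_on_xgen[OF xy(2)])
  from h show ?thesis
  proof
    assume h: "h = 1 - U_eps"
    show ?thesis
      using pm.subspace_neg[OF J_closed(2) comm]
      by (simp add: h cong_def xgen_diff[OF B(1,2)] left_diff_distrib) (simp add: algebra_simps)
  next
    assume h: "h = U_del"
    let ?c = "?x U_eps * ?y 1 - ?y U_eps * ?x 1 - (?x 1 * ?y 1 - ?y 1 * ?x 1)"
    have d0: "f * ?y U_del \<cong> 0" "f * ?x U_del \<cong> 0" if "f \<in> D" for f
    proof -
      have "aug (U_del :: 'f uea) = 0" by (rule U_functionals_lie)
      then show "f * ?y U_del \<cong> 0" "f * ?x U_del \<cong> 0"
        using tail_letter_reduce[OF that xy(2), of U_del] tail_letter_reduce[OF that xy(1), of U_del]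
        by simp_all
    qed
    have de: "?x (U_del * U_eps) * ?y 1 \<in> J" "?y (U_del * U_eps) * ?x 1 \<in> J"
      using J_relations(4)[OF D(1) D(1), of 1] J_relations(4)[OF D(2) D(2), of 1]
      by (auto intro!: J_closed(3) D simp: act_on_xgen[OF xy(1)] act_on_xgen[OF xy(2)])
    have "dpoly_act B lie_del ?c = ?x (U_del * U_eps) * ?y 1 + ?x U_eps * ?y U_del -
      (?y (U_del * U_eps) * ?x 1 + ?y U_eps * ?x U_del) -
      (?x U_del * ?y 1 + ?x 1 * ?y U_del - (?y U_del * ?x 1 + ?y 1 * ?x U_del))"
      by (simp add: dpoly_act_linear dpoly_act_mult dpoly_act_xgen[OF B(1,2)])
    moreover have "dpoly_act B lie_del ?c \<in> J"
      using J_closed(5)[OF comm, of U_del] comm J_closed(1) by (auto simp: act_on_lie)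
    ultimately have "?x (U_del * U_eps) * ?y 1 + ?x U_eps * ?y U_del -
      (?y (U_del * U_eps) * ?x 1 + ?y U_eps * ?x U_del) -
      (?x U_del * ?y 1 + ?x 1 * ?y U_del - (?y U_del * ?x 1 + ?y 1 * ?x U_del)) \<in> J" by simp
    moreover have "?x U_eps * ?y U_del \<in> J" "?y U_eps * ?x U_del \<in> J" "?x 1 * ?y U_del \<in> J"
       "?y 1 * ?x U_del \<in> J"
      using d0 D by (auto simp: cong_def)
    moreover have "w - z \<in> J" if "a + b - (c + d) - (w + e - (z + g)) \<in> J"
      "a \<in> J" "b \<in> J" "c \<in> J" "d \<in> J" "e \<in> J" "g \<in> J" for a b c d e g w z
    proof -
      have "a + b - c - d - e + g - (a + b - (c + d) - (w + e - (z + g))) \<in> J"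
        by (rule that pm.subspace_diff[OF J_closed(2)] pm.subspace_add[OF J_closed(2)])+
      then show ?thesis by (simp add: algebra_simps)
    qed
    ultimately show ?thesis using de unfolding cong_def h by blast
  qed
qed

text \<open>
  The letters behind the head are sorted first; then one exchange puts the least letter at the head.
\<close>

lemma head_sort:
  assumes h: "h = 1 - U_eps \<or> h = U_del" and ls: "\<forall>l\<in>set ls. 1 \<le> l"
  shows "head_word B h ls \<cong> head_word B h (sort ls)"
proof (cases ls)
  case (Cons x l)
  have x: "xgen B y g \<in> D" if "y \<in> set ls" for y g using ls that by (auto intro: xgen_in_diff_polys)
  have pos: "\<forall>y\<in>set l. 1 \<le> y" "1 \<le> x" using ls Cons by auto
  have 1: "head_word B h ls \<cong> xgen B x h * var_word (sort l)"
    unfolding Cons head_word.simps by (intro tail_sort x) (use ls Cons in auto)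
  show ?thesis
  proof (cases "sort l")
    case Nil
    then show ?thesis using 1 Cons by (simp add: insort_key.simps)
  next
    case (Cons y m)
    have "set (y # m) = set l" "sorted (y # m)" unfolding Cons[symmetric] by simp_all
    then have y: "y \<in> set l" "set m \<subseteq> set l" by auto
    then have ym: "1 \<le> y" "\<forall>z\<in>set m. 1 \<le> z" using pos by auto
    show ?thesis
    proof (cases "x \<le> y")
      case True
      then show ?thesis using 1 Cons \<open>ls = x # l\<close> by simp
    next
      case False
      have "xgen B x h * var_word (y # m) = xgen B x h * xgen B y 1 * var_word m"
        by (rule var_word_Cons)
      also have "\<dots> \<cong> xgen B y h * xgen B x 1 * var_word m"
        by (intro cong_mult_word head_exchange ok_var_word h pos ym)
      also have "\<dots> = xgen B y h * var_word (x # m)" by (rule var_word_Cons[symmetric])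
      also have "\<dots> \<cong> xgen B y h * var_word (insort x m)"
        by (intro tail_insort pos ym xgen_in_diff_polys)
      also have "\<dots> = head_word B h (sort ls)"
        using False Cons \<open>ls = x # l\<close> by simp
      finally show ?thesis using 1 Cons cong_trans by simp
    qed
  qed
qed simp

text \<open>
  The tail loses its exponents, the head splits into three summands, and each summand is sorted as
  far as its head permits: completely for \<open>1 - \<epsilon>\<close> and \<open>\<delta>\<close>, only behind the head for \<open>\<epsilon>\<close>.
\<close>

lemma word_reduce:
  assumes w: "ok_word B ((l, b) # w)"
  defines "p \<equiv> (\<Prod>(j, b)\<leftarrow>w. aug b)" and "ls \<equiv> map fst w"
  shows "Poly_Mapping.single ((l, b) # w) 1 \<cong>
    smul (p * aug b) (head_word B (1 - U_eps) (sort (l # ls))) +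
    smul (p * eps_weight b) (head_word B U_eps (l # sort ls)) +
    smul (p * del_coeff b) (head_word B U_del (sort (l # ls)))"
proof -
  have l: "1 \<le> l" "b \<in> B" and w': "ok_word B w" and ls: "\<forall>j\<in>set ls. 1 \<le> j"
    using w by (auto simp: ls_def)
  have x: "xgen B l h \<in> D" for h using l(1) by (rule xgen_in_diff_polys)
  have "Poly_Mapping.single ((l, b) # w) 1 = xgen B l b * Poly_Mapping.single w 1"
    by (simp add: single_Cons[of _ w] xgen_basis[OF B(1) l(2)])
  also have "\<dots> \<cong> smul p (xgen B l b * var_word ls)"
    unfolding p_def ls_def by (intro tail_reduce x w')
  also have "\<dots> \<cong> smul p ((smul (aug b) (xgen B l (1 - U_eps)) + smul (eps_weight b) (xgen B l U_eps)
      + smul (del_coeff b) (xgen B l U_del)) * var_word ls)"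
    by (intro cong_smul cong_mult_word xgen_reduce l ok_var_word ls)
  also have "\<dots> = smul (p * aug b) (head_word B (1 - U_eps) (l # ls)) +
    smul (p * eps_weight b) (xgen B l U_eps * var_word ls) +
    smul (p * del_coeff b) (head_word B U_del (l # ls))"
    by (simp add: distrib_right smul_mult_left pm.scale_right_distrib)
  also have "\<dots> \<cong> smul (p * aug b) (head_word B (1 - U_eps) (sort (l # ls))) +
    smul (p * eps_weight b) (xgen B l U_eps * var_word (sort ls)) +
    smul (p * del_coeff b) (head_word B U_del (sort (l # ls)))"
    using ls l by (intro cong_add cong_smul head_sort tail_sort x) auto
  finally show ?thesis by simp
qed

end

section \<open>The identities of \<open>M\<^sub>1\<close>\<close>

text \<open>
  The point with a single coordinate \<open>2\<close> and all others \<open>1\<close> distinguishes the exponents of one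
  variable, since the powers of \<open>2\<close> are distinct in characteristic zero.
\<close>

lemma monomials_distinct:
  assumes "M \<noteq> N"
  obtains \<beta> :: "'v \<Rightarrow> 'f::field_char_0" where "(\<Prod>x\<in>#M. \<beta> x) \<noteq> (\<Prod>x\<in>#N. \<beta> x)"
proof -
  obtain v where v: "count M v \<noteq> count N v" using assms by (meson multiset_eqI)
  let ?\<beta> = "\<lambda>x. if x = v then 2 else 1 :: 'f"
  have "(\<Prod>x\<in>#K. ?\<beta> x) = of_nat (2 ^ count K v)" for K
    by (induction K) auto
  moreover have "(of_nat (2 ^ count M v) :: 'f) \<noteq> of_nat (2 ^ count N v)"
    using v unfolding of_nat_eq_iff by simp
  ultimately show ?thesis using that by metis
qed

text \<open>
  Monomials are multiplicative functions of the point at which they are evaluated, so this is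
  Dedekind's argument for the independence of characters.
\<close>

lemma monomials_independent:
  fixes d :: "'v multiset \<Rightarrow> 'f::field_char_0"
  assumes "finite X" "\<And>\<alpha>. (\<Sum>M\<in>X. d M * (\<Prod>x\<in>#M. \<alpha> x)) = 0" "M \<in> X"
  shows "d M = 0"
  using assms
proof (induction X arbitrary: d M)
  case (insert N X)
  let ?ev = "\<lambda>M (\<alpha> :: 'v \<Rightarrow> 'f). \<Prod>x\<in>#M. \<alpha> x"
  have dX: "d M = 0" if M: "M \<in> X" for M
  proof -
    have "M \<noteq> N" using M insert.hyps by auto
    then obtain \<beta> where \<beta>: "?ev M \<beta> \<noteq> ?ev N \<beta>" by (rule monomials_distinct)
    have "d M * (?ev M \<beta> - ?ev N \<beta>) = 0"
    proof (rule insert.IH[OF _ M])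
      fix \<alpha> :: "'v \<Rightarrow> 'f"
      have "d N * ?ev N (\<lambda>x. \<alpha> x * \<beta> x) + (\<Sum>M\<in>X. d M * ?ev M (\<lambda>x. \<alpha> x * \<beta> x)) = 0"
        "?ev N \<beta> * (d N * ?ev N \<alpha> + (\<Sum>M\<in>X. d M * ?ev M \<alpha>)) = 0"
        using insert.prems(1)[of "\<lambda>x. \<alpha> x * \<beta> x"] insert.prems(1)[of \<alpha>] insert.hyps by simp_all
      then have "(\<Sum>M\<in>X. d M * (?ev M \<alpha> * ?ev M \<beta>)) - (\<Sum>M\<in>X. ?ev N \<beta> * (d M * ?ev M \<alpha>)) = 0"
        by (simp add: prod_mset.distrib algebra_simps sum_distrib_left) (metis add_left_cancel)
      then show "(\<Sum>M\<in>X. d M * (?ev M \<beta> - ?ev N \<beta>) * ?ev M \<alpha>) = 0"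
        by (simp add: algebra_simps sum_subtractf)
    qed
    then show ?thesis using \<beta> by simp
  qed
  moreover have "d N = 0"
    using insert.prems(1)[of "\<lambda>_. 1"] insert.hyps dX by simp
  ultimately show ?case using insert.prems by auto
qed simp

text \<open>
  Vector-valued form of the independence of monomials: it turns the vanishing of a polynomial
  function into the vanishing of a combination of normal words that are indexed by monomials.
\<close>

lemma sum_over_monomials_eq_0:
  fixes c :: "'w \<Rightarrow> 'f::field_char_0" and M :: "'w \<Rightarrow> 'v multiset"
  assumes S: "finite S" and ev: "\<And>\<alpha>. (\<Sum>w\<in>S. c w * (\<Prod>x\<in>#M w. \<alpha> x)) = 0"
  shows "(\<Sum>w\<in>S. smul (c w) (g (M w))) = 0"
proof -
  let ?d = "\<lambda>N. \<Sum>w | w \<in> S \<and> M w = N. c w"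
  have d: "?d N = 0" if "N \<in> M ` S" for N
  proof (rule monomials_independent[of "M ` S" ?d])
    fix \<alpha> :: "'v \<Rightarrow> 'f"
    have "(\<Sum>N\<in>M ` S. ?d N * (\<Prod>x\<in>#N. \<alpha> x)) =
      (\<Sum>N\<in>M ` S. \<Sum>w | w \<in> S \<and> M w = N. c w * (\<Prod>x\<in>#M w. \<alpha> x))"
      by (simp add: sum_distrib_right)
    also have "\<dots> = (\<Sum>w\<in>S. c w * (\<Prod>x\<in>#M w. \<alpha> x))"
      by (rule sum.image_gen[OF S, symmetric])
    finally show "(\<Sum>N\<in>M ` S. ?d N * (\<Prod>x\<in>#N. \<alpha> x)) = 0" using ev by simp
  qed (use S that in auto)
  have "(\<Sum>w\<in>S. smul (c w) (g (M w))) = (\<Sum>N\<in>M ` S. \<Sum>w | w \<in> S \<and> M w = N. smul (c w) (g (M w)))"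
    by (rule sum.image_gen[OF S])
  also have "\<dots> = (\<Sum>N\<in>M ` S. smul (?d N) (g N))"
    by (intro sum.cong) (auto simp: pm.scale_sum_left)
  also have "\<dots> = 0" using d by simp
  finally show ?thesis .
qed

definition pt :: "'f::field \<Rightarrow> 'f \<Rightarrow> 'f ^ 2 ^ 2"
  where "pt \<alpha> \<beta> = mat_scale \<alpha> (mat_unit 2 2) + mat_scale \<beta> (mat_unit 1 2)"

lemma pt_simps [simp]: "pt \<alpha> \<beta> \<in> carr M1D" "pt \<alpha> \<beta> $ 2 $ 2 = \<alpha>" "pt \<alpha> \<beta> $ 1 $ 2 = \<beta>"
  by (simp_all add: pt_def M1D_sel mat2_nth)

text \<open>
  This is \<open>a a' = \<alpha>' a\<close>, iterated over the letters of \<open>w\<close>.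
\<close>

lemma M1D_subst_tail:
  assumes \<phi>: "range \<phi> \<subseteq> carr M1D" and g: "g \<in> diff_polys B" and w: "ok_word B w"
  shows "dpoly_subst M1D \<phi> (g * Poly_Mapping.single w 1) $ a $ 2 =
    dpoly_subst M1D \<phi> g $ a $ 2 * (\<Prod>(j, b)\<leftarrow>w. aug b) * (\<Prod>x\<in>#mset (map fst w). \<phi> x $ 2 $ 2)"
  using g w
proof (induction w arbitrary: g)
  case Nil
  show ?case by (simp add: single_Nil)
next
  case (Cons y w)
  obtain j b where y: "y = (j, b)" by (cases y)
  have x: "Poly_Mapping.single [(j, b)] 1 \<in> diff_polys B" and w: "ok_word B w"
    using Cons.prems y by (auto intro: single_in_diff_polys)
  have "dpoly_subst M1D \<phi> (g * Poly_Mapping.single (y # w) 1) =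
    dpoly_subst M1D \<phi> ((g * Poly_Mapping.single [(j, b)] 1) * Poly_Mapping.single w 1)"
    by (simp add: single_Cons[of "(j, b)" w] y mult.assoc)
  moreover have "dpoly_subst M1D \<phi> (g * Poly_Mapping.single [(j, b)] 1) =
    dpoly_subst M1D \<phi> g ** uact M1D b (\<phi> j)"
    using M1.dpoly_subst_mult[OF \<phi> Cons.prems(1) x] M1.dpoly_subst_letter[of \<phi> j b 1]
    by (simp add: M1D_sel mat_scale_def vec_eq_iff)
  moreover have "\<phi> j \<in> carr M1D" using \<phi> by auto
  ultimately show ?case
    using Cons.IH[OF diff_polys_mult[OF Cons.prems(1) x] w]
      M1.dpoly_subst_closed[OF \<phi> Cons.prems(1)]
    by (simp add: M1D_mult_nth uact_M1D y mult_ac)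
qed

lemma M1D_subst_word:
  assumes B: "U.independent B" "U.span B = UNIV"
    and \<phi>: "range \<phi> \<subseteq> carr M1D" and l: "1 \<le> l" and w: "ok_word B w"
  defines "p \<equiv> \<Prod>(j, b)\<leftarrow>w. aug b" and "\<alpha> \<equiv> \<Prod>x\<in>#mset (map fst w). \<phi> x $ 2 $ 2"
  shows "dpoly_subst M1D \<phi> (xgen B l h * Poly_Mapping.single w 1) $ 2 $ 2 =
      aug h * \<phi> l $ 2 $ 2 * p * \<alpha>"
    "dpoly_subst M1D \<phi> (xgen B l h * Poly_Mapping.single w 1) $ 1 $ 2 =
      (del_coeff h * \<phi> l $ 2 $ 2 + eps_weight h * \<phi> l $ 1 $ 2) * p * \<alpha>"
proof -
  have "\<phi> l \<in> carr M1D" using \<phi> by auto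
  then show "dpoly_subst M1D \<phi> (xgen B l h * Poly_Mapping.single w 1) $ 2 $ 2 =
      aug h * \<phi> l $ 2 $ 2 * p * \<alpha>"
    "dpoly_subst M1D \<phi> (xgen B l h * Poly_Mapping.single w 1) $ 1 $ 2 =
      (del_coeff h * \<phi> l $ 2 $ 2 + eps_weight h * \<phi> l $ 1 $ 2) * p * \<alpha>"
    by (simp_all add: M1D_subst_tail[OF \<phi> xgen_in_diff_polys[OF l] w] p_def \<alpha>_def
        M1.dpoly_subst_xgen[OF \<phi> B] uact_M1D)
qed

lemma M1_T_ideal_diff_ids:
  assumes B: "U.independent B" "U.span B = UNIV" "1 \<in> B" and ijk: "1 \<le> i" "1 \<le> j" "i \<noteq> j" "1 \<le> k"
  shows "M1_T_ideal B (diff_ids B M1D) i j k"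
proof -
  note x = xgen_in_diff_polys[OF ijk(1), of B] xgen_in_diff_polys[OF ijk(2), of B]
    xgen_in_diff_polys[OF ijk(4), of B]
  have val: "dpoly_subst M1D \<phi> f = 0"
    if "range \<phi> \<subseteq> carr M1D" "f \<in> diff_polys B"
      "dpoly_subst M1D \<phi> f $ 1 $ 2 = 0" "dpoly_subst M1D \<phi> f $ 2 $ 2 = 0" for f \<phi>
    using that M1.dpoly_subst_closed[OF that(1,2)] by (simp add: mat2_eq_iff M1D_sel)
  have D: "f + g \<in> diff_polys B" "f - g \<in> diff_polys B"
    if "f \<in> diff_polys B" "g \<in> diff_polys B" for f g
    using that by (auto intro: pm.subspace_add pm.subspace_diff subspace_diff_polys)
  have ids: "f \<in> diff_ids B M1D" if f: "f \<in> diff_polys B"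
    and 0: "\<And>\<phi>. range \<phi> \<subseteq> carr M1D \<Longrightarrow> dpoly_subst M1D \<phi> f $ 1 $ 2 = 0 \<and>
      dpoly_subst M1D \<phi> f $ 2 $ 2 = 0" for f
    using f 0 val by (simp add: diff_ids_def)
  have c: "uact M1D h (\<phi> l) \<in> carr M1D" "\<phi> l \<in> carr M1D" if "range \<phi> \<subseteq> carr M1D" for \<phi> h l
    using that by (auto intro: M1.uact_closed)
  note simps = M1.dpoly_subst_linear M1.dpoly_subst_mult[where B = B] M1.dpoly_subst_xgen[OF _ B(1,2)]
    M1D_mult_nth c uact_M1D U_functionals U_functionals_lie eps_weight_lie lie_basis_nth
    diff_polys_mult D power2_eq_square M1D_sel(2,3)
  show ?thesis
  proof (rule M1_T_ideal.intro)
    show "T_L_ideal B (diff_ids B M1D)" by (rule M1.T_L_ideal_diff_ids[OF B(1,2)])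
  qed (use B ijk in \<open>auto intro!: ids diff_polys_mult D x simp: simps x algebra_simps\<close>)
qed

text \<open>
  A differential identity is congruent to its normal form, whose coefficients are those of the
  polynomial functions that its values define; hence they vanish.
\<close>

lemma diff_ids_M1D_subset:
  fixes B :: "'f::field_char_0 uea set"
  assumes J: "M1_T_ideal B J i j k"
  shows "diff_ids B M1D \<subseteq> J"
proof
  interpret M1_T_ideal B J i j k by (rule J)
  fix f :: "'f dpoly" assume f: "f \<in> diff_ids B M1D"
  define S where "S = Poly_Mapping.keys f"
  define l b t where "l w = fst (hd w)" and "b w = snd (hd w)" and "t w = tl w"
    for w :: "(nat \<times> 'f uea) list"
  define c where "c w = Poly_Mapping.lookup f w * (\<Prod>(j, b)\<leftarrow>t w. aug b)" for w
  define ls where "ls w = map fst (t w)" for w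
  have S: "finite S" by (simp add: S_def)
  have w: "w = (l w, b w) # t w" "1 \<le> l w" "b w \<in> B" "ok_word B (t w)" if "w \<in> S" for w
  proof -
    have "w \<noteq> []" "ok_word B w" using f that by (auto simp: diff_ids_def diff_polys_def S_def)
    then show "w = (l w, b w) # t w" "1 \<le> l w" "b w \<in> B" "ok_word B (t w)"
      by (cases w; auto simp: l_def b_def t_def)+
  qed
  have fS: "f = (\<Sum>w\<in>S. smul (Poly_Mapping.lookup f w) (xgen B (l w) (b w) * Poly_Mapping.single (t w) 1))"
  proof -
    have "f = (\<Sum>w\<in>S. smul (Poly_Mapping.lookup f w) (Poly_Mapping.single w 1))"
      unfolding S_def by (rule poly_mapping_as_sum)
    also have "\<dots> = (\<Sum>w\<in>S. smul (Poly_Mapping.lookup f w) (xgen B (l w) (b w) * Poly_Mapping.single (t w) 1))"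
    proof (rule sum.cong[OF refl])
      fix w assume "w \<in> S"
      note w' = w[OF this]
      have "Poly_Mapping.single w 1 = xgen B (l w) (b w) * Poly_Mapping.single (t w) 1"
        using single_Cons[of "(l w, b w)" "t w", where 'f = 'f] w'(1) by (simp add: xgen_basis[OF B(1) w'(3)])
      then show "smul (Poly_Mapping.lookup f w) (Poly_Mapping.single w 1) =
        smul (Poly_Mapping.lookup f w) (xgen B (l w) (b w) * Poly_Mapping.single (t w) 1)" by simp
    qed
    finally show ?thesis .
  qed
  \<comment> \<open>The entries of the value of \<open>f\<close> at a general point, grouped by words.\<close>
  have value0: "(\<Sum>w\<in>S. c w * aug (b w) * (\<Prod>x\<in>#mset (l w # ls w). \<alpha> x)) = 0"
    "(\<Sum>w\<in>S. c w * (del_coeff (b w) * \<alpha> (l w) + eps_weight (b w) * \<beta> (l w)) *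
      (\<Prod>x\<in>#mset (ls w). \<alpha> x)) = 0" for \<alpha> \<beta> :: "nat \<Rightarrow> 'f"
  proof -
    let ?\<phi> = "\<lambda>x. pt (\<alpha> x) (\<beta> x)"
    have \<phi>: "range ?\<phi> \<subseteq> carr M1D" by auto
    have 0: "dpoly_subst M1D ?\<phi> f = 0" using f \<phi> by (simp add: diff_ids_def)
    have nth: "dpoly_subst M1D ?\<phi> f $ a $ 2 = (\<Sum>w\<in>S. Poly_Mapping.lookup f w *
        dpoly_subst M1D ?\<phi> (xgen B (l w) (b w) * Poly_Mapping.single (t w) 1) $ a $ 2)" for a
      by (subst fS) (simp add: M1.dpoly_subst_linear M1D_sel mat2_nth)
    show "(\<Sum>w\<in>S. c w * aug (b w) * (\<Prod>x\<in>#mset (l w # ls w). \<alpha> x)) = 0"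
    proof -
      have "(\<Sum>w\<in>S. c w * aug (b w) * (\<Prod>x\<in>#mset (l w # ls w). \<alpha> x)) = dpoly_subst M1D ?\<phi> f $ 2 $ 2"
        unfolding nth
      proof (rule sum.cong[OF refl])
        fix v assume "v \<in> S"
        note v = w[OF this]
        show "c v * aug (b v) * (\<Prod>x\<in>#mset (l v # ls v). \<alpha> x) = Poly_Mapping.lookup f v *
          dpoly_subst M1D ?\<phi> (xgen B (l v) (b v) * Poly_Mapping.single (t v) 1) $ 2 $ 2"
          unfolding M1D_subst_word(1)[OF B(1,2) \<phi> v(2,4)] by (simp add: c_def ls_def mult_ac)
      qed
      then show ?thesis by (simp add: 0)
    qed
    show "(\<Sum>w\<in>S. c w * (del_coeff (b w) * \<alpha> (l w) + eps_weight (b w) * \<beta> (l w)) *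
      (\<Prod>x\<in>#mset (ls w). \<alpha> x)) = 0"
    proof -
      have "(\<Sum>w\<in>S. c w * (del_coeff (b w) * \<alpha> (l w) + eps_weight (b w) * \<beta> (l w)) *
        (\<Prod>x\<in>#mset (ls w). \<alpha> x)) = dpoly_subst M1D ?\<phi> f $ 1 $ 2"
        unfolding nth
      proof (rule sum.cong[OF refl])
        fix v assume "v \<in> S"
        note v = w[OF this]
        show "c v * (del_coeff (b v) * \<alpha> (l v) + eps_weight (b v) * \<beta> (l v)) *
          (\<Prod>x\<in>#mset (ls v). \<alpha> x) = Poly_Mapping.lookup f v *
          dpoly_subst M1D ?\<phi> (xgen B (l v) (b v) * Poly_Mapping.single (t v) 1) $ 1 $ 2"
          unfolding M1D_subst_word(2)[OF B(1,2) \<phi> v(2,4)] by (simp add: c_def ls_def mult_ac)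
      qed
      then show ?thesis by (simp add: 0)
    qed
  qed
  have sum1: "(\<Sum>w\<in>S. smul (c w * aug (b w)) (head_word B (1 - U_eps) (sort (l w # ls w)))) = 0"
    using sum_over_monomials_eq_0[OF S value0(1),
        where g = "\<lambda>M. head_word B (1 - U_eps) (sorted_list_of_multiset M)"]
    by (simp only: sorted_list_of_multiset_mset)
  \<comment> \<open>At points with \<open>\<beta> = 0\<close> the words with head exponent \<open>\<epsilon>\<close> have value \<open>0\<close>.\<close>
  have del0: "(\<Sum>w\<in>S. c w * del_coeff (b w) * (\<Prod>x\<in>#mset (l w # ls w). \<alpha> x)) = 0" for \<alpha>
    using value0(2)[of \<alpha> "\<lambda>_. 0"] by (simp add: mult_ac)
  have sum2: "(\<Sum>w\<in>S. smul (c w * del_coeff (b w)) (head_word B U_del (sort (l w # ls w)))) = 0"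
    using sum_over_monomials_eq_0[OF S del0,
        where g = "\<lambda>M. head_word B U_del (sorted_list_of_multiset M)"]
    by (simp only: sorted_list_of_multiset_mset)
  \<comment> \<open>Words with head \<open>x\<close> and exponent \<open>\<epsilon>\<close> are isolated by letting \<open>\<beta>\<close> vanish except at \<open>x\<close>.\<close>
  have sum3: "(\<Sum>w\<in>S. smul (c w * eps_weight (b w)) (head_word B U_eps (l w # sort (ls w)))) = 0"
  proof -
    have "(\<Sum>w | w \<in> S \<and> l w = x. smul (c w * eps_weight (b w)) (head_word B U_eps (l w # sort (ls w)))) = 0"
      for x
    proof -
      have "(\<Sum>w | w \<in> S \<and> l w = x. c w * eps_weight (b w) * (\<Prod>x\<in>#mset (ls w). \<alpha> x)) = 0" for \<alpha>
      proof -
        have "(\<Sum>w\<in>S. if l w = x then c w * eps_weight (b w) * (\<Prod>x\<in>#mset (ls w). \<alpha> x) else 0) =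
          (\<Sum>w\<in>S. c w * (del_coeff (b w) * \<alpha> (l w) + eps_weight (b w) * of_bool (l w = x)) *
            (\<Prod>x\<in>#mset (ls w). \<alpha> x)) - (\<Sum>w\<in>S. c w * del_coeff (b w) * (\<Prod>x\<in>#mset (l w # ls w). \<alpha> x))"
          unfolding sum_subtractf[symmetric] by (intro sum.cong) (auto simp: algebra_simps)
        also have "\<dots> = 0" using value0(2)[of \<alpha> "\<lambda>y. of_bool (y = x)"] del0[of \<alpha>] by simp
        finally show ?thesis using S by (simp add: sum.inter_filter)
      qed
      from sum_over_monomials_eq_0[OF _ this,
          where g = "\<lambda>M. head_word B U_eps (x # sorted_list_of_multiset M)"] S
      show ?thesis by (simp only: sorted_list_of_multiset_mset mem_Collect_eq cong: sum.cong) simp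
    qed
    then show ?thesis by (subst sum.image_gen[OF S, of _ l]) (simp only: sum.neutral_const)
  qed
  have "f \<cong> (\<Sum>w\<in>S. smul (c w * aug (b w)) (head_word B (1 - U_eps) (sort (l w # ls w))) +
      smul (c w * eps_weight (b w)) (head_word B U_eps (l w # sort (ls w))) +
      smul (c w * del_coeff (b w)) (head_word B U_del (sort (l w # ls w))))"
  proof -
    have "f = (\<Sum>w\<in>S. smul (Poly_Mapping.lookup f w) (Poly_Mapping.single w 1))"
      unfolding S_def by (rule poly_mapping_as_sum)
    also have "\<dots> \<cong> (\<Sum>w\<in>S. smul (Poly_Mapping.lookup f w)
      (smul ((\<Prod>(j, b)\<leftarrow>t w. aug b) * aug (b w)) (head_word B (1 - U_eps) (sort (l w # ls w))) +
      smul ((\<Prod>(j, b)\<leftarrow>t w. aug b) * eps_weight (b w)) (head_word B U_eps (l w # sort (ls w))) +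
      smul ((\<Prod>(j, b)\<leftarrow>t w. aug b) * del_coeff (b w)) (head_word B U_del (sort (l w # ls w)))))"
    proof (intro cong_sum cong_smul)
      fix v assume "v \<in> S"
      note v = w[OF this]
      have "ok_word B ((l v, b v) # t v)" using v(2-4) by auto
      from word_reduce[OF this] show "Poly_Mapping.single v 1 \<cong>
        smul ((\<Prod>(j, b)\<leftarrow>t v. aug b) * aug (b v)) (head_word B (1 - U_eps) (sort (l v # ls v))) +
        smul ((\<Prod>(j, b)\<leftarrow>t v. aug b) * eps_weight (b v)) (head_word B U_eps (l v # sort (ls v))) +
        smul ((\<Prod>(j, b)\<leftarrow>t v. aug b) * del_coeff (b v)) (head_word B U_del (sort (l v # ls v)))"
        unfolding v(1)[symmetric] ls_def .
    qed
    finally show ?thesis by (simp add: pm.scale_right_distrib c_def mult.assoc)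
  qed
  also have "\<dots> = 0" by (simp only: sum.distrib sum1 sum2 sum3 add_0_right)
  finally show "f \<in> J" by (simp add: cong_def)
qed

text \<open>
  Both ideals contain the generators; the right one is the least such, and \<open>diff_ids_M1D_subset\<close>
  bounds the left one from above.
\<close>

lemma diff_ids_M1D_eq:
  fixes B :: "'f::field_char_0 uea set"
  assumes B: "U.independent B" "U.span B = UNIV" "1 \<in> B" and ijk: "1 \<le> i" "1 \<le> j" "i \<noteq> j" "1 \<le> k"
  shows "diff_ids B M1D = T_L_generated B
    {xgen B i 1 * xgen B j U_eps,
     xgen B i U_eps * xgen B j 1 - xgen B j U_eps * xgen B i 1 -
       (xgen B i 1 * xgen B j 1 - xgen B j 1 * xgen B i 1),
     xgen B k (U_eps\<^sup>2) - xgen B k U_eps, xgen B k (U_del * U_eps),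
     xgen B k (U_eps * U_del) - xgen B k U_del}" (is "_ = T_L_generated B ?S")
proof
  interpret I: M1_T_ideal B "diff_ids B M1D" i j k by (rule M1_T_ideal_diff_ids[OF assms])
  have sub: "?S \<subseteq> diff_ids B M1D" using I.gens by simp
  then have S: "?S \<subseteq> diff_polys B" by (auto simp: diff_ids_def)
  show "T_L_generated B ?S \<subseteq> diff_ids B M1D"
    by (rule T_L_ideal_generated(3)[OF B(1,2) S I.J sub])
  have "M1_T_ideal B (T_L_generated B ?S) i j k"
    using B ijk T_L_ideal_generated(1,2)[OF B(1,2) S] by (intro M1_T_ideal.intro) auto
  then show "diff_ids B M1D \<subseteq> T_L_generated B ?S" by (rule diff_ids_M1D_subset)
qed

section \<open>Codimensions and cocharacters of \<open>M\<^sub>1\<close>\<close>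

lemma perm_act_single: "perm_act \<sigma> (Poly_Mapping.single w c) = Poly_Mapping.single (map (map_prod \<sigma> id) w) c"
  by (simp add: perm_act_def)

lemma linear_perm_act: "Vector_Spaces.linear smul smul (perm_act \<sigma>)"
  unfolding perm_act_def by (rule linear_lin_ext)

lemma dpoly_subst_perm_act:
  assumes A: "L_algebra A"
  shows "dpoly_subst A \<phi> (perm_act \<sigma> f) = dpoly_subst A (\<phi> \<circ> \<sigma>) f"
proof -
  interpret L_algebra A by fact
  have *: "map ((\<lambda>(j, b). uact A b (\<phi> j)) \<circ> map_prod \<sigma> id) w =
    map (\<lambda>(j, b). uact A b ((\<phi> \<circ> \<sigma>) j)) w" for w :: "(nat \<times> _) list"
    by auto
  show ?thesis
  proof (induction f rule: poly_mapping_induct_add)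
    case (single w c)
    show ?case by (simp add: perm_act_single dpoly_subst_def * del: o_apply)
  qed (simp_all add: perm_act_def pm.lin_ext_add dpoly_subst_linear)
qed

lemma multilin_word:
  assumes B: "1 \<in> B" and w: "distinct (map fst w)" "set (map fst w) = {1..n}" "snd ` set w \<subseteq> B"
  shows "Poly_Mapping.single w 1 \<in> multilin B n"
proof -
  define \<sigma> where "\<sigma> k = (if k \<in> {1..n} then fst (w ! (k - 1)) else k)" for k
  define h where "h k = (if k \<in> {1..n} then snd (w ! (k - 1)) else 1)" for k
  have len: "length w = n" using distinct_card[OF w(1)] w(2) by simp
  have "w = map (\<lambda>k. (\<sigma> k, h k)) [1..<Suc n]"
    by (rule nth_equalityI) (auto simp: len \<sigma>_def h_def simp del: upt_Suc)
  moreover have "\<sigma> permutes {1..n}"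
  proof (rule bij_imp_permutes)
    have "map \<sigma> [1..<Suc n] = map fst w"
      by (rule nth_equalityI) (auto simp: len \<sigma>_def simp del: upt_Suc)
    moreover have "set [1..<Suc n] = {1..n}" by auto
    ultimately have "inj_on \<sigma> {1..n}" "\<sigma> ` {1..n} = {1..n}"
      using w by (metis distinct_map, metis set_map)
    then show "bij_betw \<sigma> {1..n} {1..n}" by (simp add: bij_betw_def)
  qed (auto simp: \<sigma>_def)
  moreover have "range h \<subseteq> B"
    using B w(3) len by (force simp: h_def)
  ultimately show ?thesis unfolding multilin_def by (intro pm.span_base) blast
qed

lemma multilin_gen:
  assumes "\<sigma> permutes {1..n}" "range h \<subseteq> B"
  shows "distinct (map fst (map (\<lambda>k. (\<sigma> k, h k)) [1..<Suc n]))"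
    "set (map fst (map (\<lambda>k. (\<sigma> k, h k)) [1..<Suc n])) = {1..n}"
    "snd ` set (map (\<lambda>k. (\<sigma> k, h k)) [1..<Suc n]) \<subseteq> B"
proof -
  have "inj_on \<sigma> {1..n}" using assms(1) by (rule permutes_inj_on)
  then show "distinct (map fst (map (\<lambda>k. (\<sigma> k, h k)) [1..<Suc n]))"
    by (simp add: distinct_map atLeastLessThanSuc_atLeastAtMost comp_def del: upt_Suc)
  show "set (map fst (map (\<lambda>k. (\<sigma> k, h k)) [1..<Suc n])) = {1..n}"
    using permutes_image[OF assms(1)] by (simp add: atLeastLessThanSuc_atLeastAtMost comp_def del: upt_Suc)
  show "snd ` set (map (\<lambda>k. (\<sigma> k, h k)) [1..<Suc n]) \<subseteq> B" using assms(2) by auto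
qed

lemma multilin_eq:
  assumes "1 \<in> (B :: 'f::field uea set)"
  shows "multilin B n = pm.span {Poly_Mapping.single w 1 | w. distinct (map fst w) \<and>
    set (map fst w) = {1..n} \<and> snd ` set w \<subseteq> B}"
(is "_ = pm.span ?S")
proof (rule subset_antisym)
  show "multilin B n \<subseteq> pm.span ?S"
    unfolding multilin_def
  proof (rule pm.span_mono, rule subsetI)
    fix f :: "'f dpoly"
    assume "f \<in> {Poly_Mapping.single (map (\<lambda>k. (\<sigma> k, h k)) [1..<Suc n]) 1 | \<sigma> h.
      \<sigma> permutes {1..n} \<and> range h \<subseteq> B}"
    then obtain \<sigma> h where f: "f = Poly_Mapping.single (map (\<lambda>k. (\<sigma> k, h k)) [1..<Suc n]) 1"
      and \<sigma>: "\<sigma> permutes {1..n}" "range h \<subseteq> B" by blast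
    show "f \<in> ?S"
      by (rule CollectI, rule exI, intro conjI, rule f) (rule multilin_gen[OF \<sigma>])+
  qed
  show "pm.span ?S \<subseteq> multilin B n"
  proof (rule pm.span_minimal)
    show "pm.subspace (multilin B n)" by (simp add: multilin_def)
    show "?S \<subseteq> multilin B n"
    proof
      fix f assume "f \<in> ?S"
      then obtain w where "f = Poly_Mapping.single w 1" "distinct (map fst w)"
        "set (map fst w) = {1..n}" "snd ` set w \<subseteq> B" by (elim CollectE exE conjE)
      then show "f \<in> multilin B n" using multilin_word[OF assms] by (simp only:)
    qed
  qed
qed

lemma multilin_induct [consumes 3, case_names zero add smul word]:
  fixes f :: "'f::field dpoly"
  assumes B: "1 \<in> B" and n: "1 \<le> n" and f: "f \<in> multilin B n"
    and P: "P 0" "\<And>f g. P f \<Longrightarrow> P g \<Longrightarrow> P (f + g)" "\<And>c f. P f \<Longrightarrow> P (smul c f)"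
    and word: "\<And>l b w. distinct (l # map fst w) \<Longrightarrow> set (l # map fst w) = {1..n} \<Longrightarrow>
      ok_word B ((l, b) # w) \<Longrightarrow> P (Poly_Mapping.single ((l, b) # w) 1)"
  shows "P f"
proof -
  show ?thesis
    using f unfolding multilin_eq[OF B]
  proof (rule pm.span_induct)
    show "pm.subspace (Collect P)" by (rule pm.subspaceI) (use P in auto)
    fix g :: "'f dpoly"
    assume "g \<in> {Poly_Mapping.single w 1 | w. distinct (map fst w) \<and>
      set (map fst w) = {1..n} \<and> snd ` set w \<subseteq> B}"
    then obtain w where w: "g = Poly_Mapping.single w 1" "distinct (map fst w)"
      "set (map fst w) = {1..n}" "snd ` set w \<subseteq> B" by (elim CollectE exE conjE)
    from w(3) n have "w \<noteq> []" by auto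
    then obtain l b v where v: "w = (l, b) # v" by (cases w) auto
    have ok: "1 \<le> j \<and> b \<in> B" if "(j, b) \<in> set w" for j b
    proof
      have "fst (j, b) \<in> set (map fst w)" unfolding set_map using that by (rule imageI)
      then show "1 \<le> j" unfolding w(3) by simp
      have "snd (j, b) \<in> snd ` set w" using that by (rule imageI)
      then show "b \<in> B" using w(4) by auto
    qed
    have "P (Poly_Mapping.single ((l, b) # v) 1)"
    proof (rule word)
      show "distinct (l # map fst v)" "set (l # map fst v) = {1..n}"
        using w(2,3) unfolding v list.map fst_conv by this+
      show "ok_word B ((l, b) # v)" unfolding v[symmetric] using ok by blast
    qed
    then show "P g" unfolding w(1) v .
  qed
qed

lemma multilin_in_diff_polys: "1 \<in> B \<Longrightarrow> 1 \<le> n \<Longrightarrow> multilin B n \<subseteq> diff_polys B"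
proof
  fix f assume B: "1 \<in> B" and n: "1 \<le> n" and f: "f \<in> multilin B n"
  from B n f show "f \<in> diff_polys B"
  proof (induction f rule: multilin_induct)
    case zero
    show ?case by (rule pm.subspace_0[OF subspace_diff_polys])
  next
    case (add f g)
    then show ?case by (rule pm.subspace_add[OF subspace_diff_polys])
  next
    case (smul c f)
    then show ?case by (rule pm.subspace_scale[OF subspace_diff_polys])
  next
    case (word l b w)
    then show ?case by (intro single_in_diff_polys) auto
  qed
qed

lemma perm_act_multilin:
  assumes B: "1 \<in> B" and n: "1 \<le> n" and \<sigma>: "\<sigma> permutes {1..n}" and f: "f \<in> multilin B n"
  shows "perm_act \<sigma> f \<in> multilin B n"
  using B n f
proof (induction f rule: multilin_induct)
  case (word l b w)
  let ?w = "(l, b) # w"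
  have m: "map fst (map (map_prod \<sigma> id) ?w) = map \<sigma> (map fst ?w)" by simp
  show ?case unfolding perm_act_single
  proof (rule multilin_word[OF B])
    show "distinct (map fst (map (map_prod \<sigma> id) ?w))"
      unfolding m distinct_map[of \<sigma>]
    proof
      show "distinct (map fst ?w)" using word(1) by simp
      show "inj_on \<sigma> (set (map fst ?w))" by (rule inj_on_subset[OF permutes_inj[OF \<sigma>] subset_UNIV])
    qed
    have "set (map fst ?w) = {1..n}" using word(2) by simp
    then show "set (map fst (map (map_prod \<sigma> id) ?w)) = {1..n}"
      unfolding m set_map[of \<sigma>] using permutes_image[OF \<sigma>] by metis
    show "snd ` set (map (map_prod \<sigma> id) ?w) \<subseteq> B" using word(3) by auto
  qed
qed (simp_all add: perm_act_def pm.lin_ext_add pm.lin_ext_smul multilin_def pm.span_zero pm.span_add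
    pm.span_scale)

lemma head_word_multilin:
  assumes B: "1 \<in> B" "U.independent B" and ls: "distinct ls" "set ls = {1..n}"
  shows "head_word B h ls \<in> multilin B n"
proof (cases ls)
  case Nil
  then show ?thesis by (simp add: multilin_def pm.span_zero)
next
  case (Cons l js)
  have "head_word B h ls = (\<Sum>b | U.representation B h b \<noteq> 0. smul (U.representation B h b)
    (Poly_Mapping.single ((l, b) # map (\<lambda>j. (j, 1)) js) 1))"
    by (simp add: Cons xgen_def sum_distrib_right mult_single plus_list_def)
  also have "\<dots> \<in> multilin B n"
  proof (unfold multilin_def, intro pm.span_sum pm.span_scale, fold multilin_def)
    fix b assume "b \<in> {b. U.representation B h b \<noteq> 0}"
    then have b: "b \<in> B" using U.representation_ne_zero by auto
    have m: "map fst ((l, b) # map (\<lambda>j. (j, 1)) js) = ls" using Cons by (simp add: comp_def)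
    show "Poly_Mapping.single ((l, b) # map (\<lambda>j. (j, 1)) js) 1 \<in> multilin B n"
      by (rule multilin_word[OF B(1)]) (use m ls b B(1) in \<open>auto simp del: list.map\<close>)
  qed
  finally show ?thesis .
qed

text \<open>
  The normal multilinear words. The indices \<open>0\<close> and \<open>n + 1\<close> belong to the sorted words with head
  exponent \<open>1 - \<epsilon>\<close> and \<open>\<delta>\<close>, an index \<open>i\<close> between them to the word with head \<open>x\<^sub>i\<^sup>\<epsilon>\<close>.
\<close>

definition frame_elem :: "'f::field uea set \<Rightarrow> nat \<Rightarrow> nat \<Rightarrow> 'f dpoly"
  where "frame_elem B n i =
    (if i = 0 then head_word B (1 - U_eps) [1..<Suc n]
     else if i = Suc n then head_word B U_del [1..<Suc n]
     else head_word B U_eps (i # remove1 i [1..<Suc n]))"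

text \<open>
  A multilinear polynomial has a value of the form
  \<open>a \<alpha>\<^sub>1\<dots>\<alpha>\<^sub>n e\<^sub>2\<^sub>2 + (d \<alpha>\<^sub>1\<dots>\<alpha>\<^sub>n + \<Sum>\<^sub>i b\<^sub>i \<beta>\<^sub>i \<Prod>\<^sub>k\<^sub>\<noteq>\<^sub>i \<alpha>\<^sub>k) e\<^sub>1\<^sub>2\<close>; the functionals with indices \<open>0\<close>, \<open>n + 1\<close> and \<open>i\<close>
  read off \<open>a\<close>, \<open>d\<close> and \<open>b\<^sub>i\<close>.
\<close>

definition frame_functional :: "nat \<Rightarrow> nat \<Rightarrow> 'f::field dpoly \<Rightarrow> 'f"
  where "frame_functional n i f =
    (if i = 0 then dpoly_subst M1D (\<lambda>_. pt 1 0) f $ 2 $ 2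
     else if i = Suc n then dpoly_subst M1D (\<lambda>_. pt 1 0) f $ 1 $ 2
     else dpoly_subst M1D (\<lambda>k. pt 1 (of_bool (k = i))) f $ 1 $ 2 - dpoly_subst M1D (\<lambda>_. pt 1 0) f $ 1 $ 2)"

definition frame_index :: "nat \<Rightarrow> nat set" where "frame_index n = insert 0 (insert (Suc n) {1..n})"

lemma frame_index [simp]: "finite (frame_index n)" "card (frame_index n) = n + 2"
  "sum F (frame_index n) = F 0 + (F (Suc n) + sum F {1..n})" for F :: "nat \<Rightarrow> 'a::comm_monoid_add"
  by (auto simp: frame_index_def)

lemma linear_frame_functional: "Vector_Spaces.linear smul (*) (frame_functional n i :: 'f::field dpoly \<Rightarrow> 'f)"
  by (rule linear_functionalI)
    (simp_all add: frame_functional_def M1.dpoly_subst_linear M1D_sel(2) mat2_nth algebra_simps)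

lemma dpoly_subst_head_word:
  assumes B: "U.independent B" "U.span B = UNIV" "1 \<in> B" and ls: "\<forall>j\<in>set (l # ls). 1 \<le> j"
  shows "dpoly_subst M1D (\<lambda>k. pt 1 (\<beta> k)) (head_word B h (l # ls)) $ 2 $ 2 = aug h"
    "dpoly_subst M1D (\<lambda>k. pt 1 (\<beta> k)) (head_word B h (l # ls)) $ 1 $ 2 = del_coeff h + eps_weight h * \<beta> l"
proof -
  have \<phi>: "range (\<lambda>k. pt 1 (\<beta> k)) \<subseteq> carr M1D" by auto
  have ok: "ok_word B (map (\<lambda>j. (j, 1)) ls)" "1 \<le> l" using ls B(3) by auto
  have "(\<Prod>(j, b)\<leftarrow>map (\<lambda>j. (j :: nat, 1)) ls. aug b) = (1 :: 'a)"
    by (induction ls) (simp_all add: U_functionals)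
  moreover have "(\<Prod>x\<in>#mset (map fst (map (\<lambda>j. (j, 1)) ls)). pt 1 (\<beta> x) $ 2 $ 2) = 1"
    by (simp add: image_mset.compositionality comp_def)
  ultimately show "dpoly_subst M1D (\<lambda>k. pt 1 (\<beta> k)) (head_word B h (l # ls)) $ 2 $ 2 = aug h"
    "dpoly_subst M1D (\<lambda>k. pt 1 (\<beta> k)) (head_word B h (l # ls)) $ 1 $ 2 = del_coeff h + eps_weight h * \<beta> l"
    using M1D_subst_word[OF B(1,2) \<phi> ok(2,1), of h] by simp_all
qed

text \<open>
  The value of \<open>\<sigma> f\<close> at a point is the value of \<open>f\<close> at the permuted point. With \<open>\<sigma> = id\<close> this is the
  duality of words and functionals; with \<open>i = j\<close> it gives the diagonal of \<open>\<sigma>\<close>.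
\<close>

lemma frame_functional_perm_act:
  assumes B: "U.independent B" "U.span B = UNIV" "1 \<in> (B :: 'f::field uea set)" and n: "1 \<le> n"
  assumes ij: "i \<in> frame_index n" "j \<in> frame_index n"
  shows "frame_functional n i (perm_act \<sigma> (frame_elem B n j)) =
    (if j = 0 \<or> j = Suc n then of_bool (i = j) else of_bool (i \<in> {1..n} \<and> \<sigma> j = i))"
proof -
  have l1: "[1..<Suc n] = 1 # [2..<Suc n]" using n by (simp add: upt_conv_Cons numeral_2_eq_2 del: upt_Suc)
  note val = dpoly_subst_head_word[OF B]
  have v1: "dpoly_subst M1D (\<lambda>k. pt 1 (\<beta> k)) (head_word B h [1..<Suc n]) $ 2 $ 2 = aug h"
    "dpoly_subst M1D (\<lambda>k. pt 1 (\<beta> k)) (head_word B h [1..<Suc n]) $ 1 $ 2 = del_coeff h + eps_weight h * \<beta> 1"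
    for \<beta> h unfolding l1 by (rule val; auto)+
  have v2: "dpoly_subst M1D (\<lambda>k. pt 1 (\<beta> k)) (head_word B h (m # remove1 m [1..<Suc n])) $ 2 $ 2 = aug h"
    "dpoly_subst M1D (\<lambda>k. pt 1 (\<beta> k)) (head_word B h (m # remove1 m [1..<Suc n])) $ 1 $ 2 =
      del_coeff h + eps_weight h * \<beta> m" if "1 \<le> m" for \<beta> h m
  proof -
    have "\<forall>k\<in>set (m # remove1 m [1..<Suc n]). 1 \<le> k"
      using that set_remove1_subset[of m "[1..<Suc n]"] by (auto simp del: upt_Suc)
    then show "dpoly_subst M1D (\<lambda>k. pt 1 (\<beta> k)) (head_word B h (m # remove1 m [1..<Suc n])) $ 2 $ 2 = aug h"
      "dpoly_subst M1D (\<lambda>k. pt 1 (\<beta> k)) (head_word B h (m # remove1 m [1..<Suc n])) $ 1 $ 2 =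
        del_coeff h + eps_weight h * \<beta> m" by (rule val)+
  qed
  have comp: "(\<lambda>k. pt 1 (\<beta> k)) \<circ> \<sigma> = (\<lambda>k. pt 1 (\<beta> (\<sigma> k)) :: 'f ^ 2 ^ 2)" for \<beta> by auto
  have comp0: "(\<lambda>_. pt 1 0) \<circ> \<sigma> = (\<lambda>_. pt 1 0 :: 'f ^ 2 ^ 2)" by auto
  have j: "j = 0 \<or> j = Suc n \<or> 1 \<le> j \<and> j \<le> n" and i: "i = 0 \<or> i = Suc n \<or> 1 \<le> i \<and> i \<le> n"
    using ij by (auto simp: frame_index_def)
  note vals = v1 v2 v1[of "\<lambda>_. 0"] v2[of _ "\<lambda>_. 0"]
  show ?thesis
    unfolding frame_functional_def dpoly_subst_perm_act[OF L_algebra_M1D] comp comp0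
    using j i
    by (elim disjE; simp add: frame_elem_def vals U_functionals U_functionals_lie
      U_functionals_diff lie_basis_nth del: upt_Suc head_word.simps One_nat_def)
qed

lemma mset_perm_list: "distinct ls \<Longrightarrow> set ls = {1..n} \<Longrightarrow> mset ls = mset [1..<Suc n]"
  by (metis atLeastLessThanSuc_atLeastAtMost distinct_upt mset_set_set set_upt)

text \<open>
  That the normal words span modulo identities is \<open>word_reduce\<close>, applied to the ideal of identities
  itself.
\<close>

lemma dual_frame_M1D:
  assumes B: "U.independent B" "U.span B = UNIV" "1 \<in> (B :: 'f::field uea set)" and n: "1 \<le> n"
  shows "dual_frame smul (multilin B n) (multilin B n \<inter> diff_ids B M1D) (frame_index n)
    (frame_elem B n) (frame_functional n)"
proof -
  interpret M1_T_ideal B "diff_ids B M1D" 1 2 1 by (rule M1_T_ideal_diff_ids[OF B]) auto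
  have elem: "frame_elem B n i \<in> multilin B n" if "i \<in> frame_index n" for i
  proof -
    have "distinct (i # remove1 i [1..<Suc n])" "set (i # remove1 i [1..<Suc n]) = {1..n}" if "i \<in> {1..n}"
      using that by (auto simp: set_remove1_eq simp del: upt_Suc)
    moreover have "distinct [1..<Suc n]" "set [1..<Suc n] = {1..n}" by auto
    ultimately show ?thesis using that unfolding frame_elem_def frame_index_def
      by (auto intro!: head_word_multilin[OF B(3,1)] simp del: upt_Suc head_word.simps)
  qed
  show ?thesis unfolding dual_frame_def
  proof (intro conjI ballI)
    show "finite (frame_index n)" by simp
    show "frame_elem B n ` frame_index n \<subseteq> multilin B n" using elem by auto
    show "Vector_Spaces.linear smul (*) (frame_functional n i :: 'f dpoly \<Rightarrow> _)" for i
      by (rule linear_frame_functional)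
    show "frame_functional n i w = 0" if "w \<in> multilin B n \<inter> diff_ids B M1D" for i w
    proof -
      have "dpoly_subst M1D (\<lambda>k. pt 1 (\<beta> k)) w = 0" for \<beta>
      proof -
        have "range (\<lambda>k. pt 1 (\<beta> k)) \<subseteq> carr M1D" by auto
        then show ?thesis using that by (simp add: diff_ids_def)
      qed
      from this this[of "\<lambda>_. 0"] show ?thesis by (simp add: frame_functional_def)
    qed
    show "frame_functional n i (frame_elem B n j) = of_bool (i = j)"
      if "i \<in> frame_index n" "j \<in> frame_index n" for i j
    proof -
      have "perm_act id f = (f :: 'f dpoly)" for f
      proof (induction f rule: poly_mapping_induct_add)
        case (single w c)
        have "map (map_prod id id) w = w" by (induction w) auto
        then show ?case by (simp only: perm_act_single)
      qed (simp_all add: perm_act_def pm.lin_ext_add)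
      then show ?thesis
        using frame_functional_perm_act[OF B n that, of id] that by (auto simp: frame_index_def)
    qed
    fix v assume v: "v \<in> multilin B n"
    have "\<exists>a. cong v (\<Sum>i\<in>frame_index n. smul (a i) (frame_elem B n i))"
      using B(3) n v
    proof (induction v rule: multilin_induct)
      case zero
      show ?case by (rule exI[of _ "\<lambda>_. 0"]) (simp del: frame_index(3))
    next
      case (add f g)
      then obtain a b where "cong f (\<Sum>i\<in>frame_index n. smul (a i) (frame_elem B n i))"
        "cong g (\<Sum>i\<in>frame_index n. smul (b i) (frame_elem B n i))" by blast
      from cong_add[OF this] show ?case
        by (intro exI[of _ "\<lambda>i. a i + b i"])
          (simp add: pm.scale_left_distrib sum.distrib del: frame_index(3))
    next
      case (smul c f)
      then obtain a where "cong f (\<Sum>i\<in>frame_index n. smul (a i) (frame_elem B n i))" by blast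
      from cong_smul[OF this, of c] show ?case
        by (intro exI[of _ "\<lambda>i. c * a i"]) (simp add: pm.scale_sum_right del: frame_index(3))
    next
      case (word l b w)
      let ?ls = "map fst w"
      define p where "p = (\<Prod>(j, b)\<leftarrow>w. aug b)"
      have l: "l \<in> {1..n}" using word(2) by auto
      have m: "mset (l # ?ls) = mset [1..<Suc n]" by (rule mset_perm_list[OF word(1,2)])
      then have "sort (l # ?ls) = [1..<Suc n]"
        by (intro properties_for_sort) (simp_all del: upt_Suc)
      moreover have "sort ?ls = remove1 l [1..<Suc n]"
      proof (rule properties_for_sort)
        have "mset (remove1 l [1..<Suc n]) = mset (l # ?ls) - {#l#}" unfolding m by (rule mset_remove1)
        then show "mset (remove1 l [1..<Suc n]) = mset ?ls" by simp
      qed (simp add: sorted_remove1 del: upt_Suc)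
      ultimately have "cong (Poly_Mapping.single ((l, b) # w) 1)
        (smul (p * aug b) (frame_elem B n 0) + smul (p * eps_weight b) (frame_elem B n l) +
        smul (p * del_coeff b) (frame_elem B n (Suc n)))"
        using word_reduce[OF word(3)] l by (simp add: p_def frame_elem_def del: upt_Suc head_word.simps)
      moreover have "(\<Sum>i\<in>{1..n}. smul (if i = l then p * eps_weight b else 0) (frame_elem B n i)) =
        smul (p * eps_weight b) (frame_elem B n l)"
        using l by (simp add: if_distrib[of "\<lambda>c. smul c _"] cong: if_cong)
      ultimately show ?case
        using l by (intro exI[of _ "\<lambda>i. if i = 0 then p * aug b else if i = Suc n then p * del_coeff b
          else if i = l then p * eps_weight b else 0"]) (simp add: algebra_simps)
    qed
    then obtain a where a: "cong v (\<Sum>i\<in>frame_index n. smul (a i) (frame_elem B n i))" by blast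
    show "\<exists>a. v - (\<Sum>i\<in>frame_index n. smul (a i) (frame_elem B n i)) \<in> multilin B n \<inter> diff_ids B M1D"
    proof (intro exI IntI)
      show "v - (\<Sum>i\<in>frame_index n. smul (a i) (frame_elem B n i)) \<in> diff_ids B M1D"
        using a by (simp only: cong_def)
      have "pm.subspace (multilin B n)" by (simp add: multilin_def)
      then show "v - (\<Sum>i\<in>frame_index n. smul (a i) (frame_elem B n i)) \<in> multilin B n"
        by (intro pm.subspace_diff pm.subspace_sum pm.subspace_scale v elem)
    qed
  qed
qed

lemma frame_trace:
  assumes B: "U.independent B" "U.span B = UNIV" "1 \<in> (B :: 'f::field uea set)" and n: "1 \<le> n"
    and \<sigma>: "\<sigma> permutes {1..n}"
  shows "(\<Sum>i\<in>frame_index n. frame_functional n i (perm_act \<sigma> (frame_elem B n i))) =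
    of_nat (card {k \<in> {1..n}. \<sigma> k = k}) + 2"
proof -
  have "(\<Sum>i\<in>frame_index n. frame_functional n i (perm_act \<sigma> (frame_elem B n i))) =
    (\<Sum>i\<in>frame_index n. if i = 0 \<or> i = Suc n then 1 else of_bool (i \<in> {1..n} \<and> \<sigma> i = i))"
    by (rule sum.cong[OF refl]) (simp add: frame_functional_perm_act[OF B n])
  also have "\<dots> = 1 + (1 + (\<Sum>i\<in>{1..n}. of_bool (\<sigma> i = i)))"
  proof -
    have "(\<Sum>i\<in>{1..n}. if i = 0 \<or> i = Suc n then 1 else of_bool (i \<in> {1..n} \<and> \<sigma> i = i)) =
      (\<Sum>i\<in>{1..n}. of_bool (\<sigma> i = i) :: 'f)" by (rule sum.cong[OF refl]) auto
    then show ?thesis unfolding frame_index(3) by (simp only: simp_thms if_True)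
  qed
  also have "(\<Sum>i\<in>{1..n}. of_bool (\<sigma> i = i)) = (of_nat (card {k \<in> {1..n}. \<sigma> k = k}) :: 'f)"
    by (simp add: of_bool_def sum.If_cases Int_def)
  finally show ?thesis by simp
qed

section \<open>Reversal of words and \<open>M\<^sub>2\<close>\<close>

definition rev_poly :: "'f::field dpoly \<Rightarrow> 'f dpoly"
  where "rev_poly = lin_ext smul (\<lambda>w. Poly_Mapping.single (rev w) 1)"

lemma rev_poly_linear:
  "rev_poly (f + g) = rev_poly f + rev_poly g" "rev_poly (f - g) = rev_poly f - rev_poly g"
  "rev_poly (smul c f) = smul c (rev_poly f)" "rev_poly (sum F S) = (\<Sum>s\<in>S. rev_poly (F s))"
  "rev_poly 0 = 0"
  by (simp_all add: rev_poly_def pm.lin_ext_add pm.lin_ext_diff pm.lin_ext_smul pm.lin_ext_sum)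

lemma rev_poly_single [simp]: "rev_poly (Poly_Mapping.single w c) = Poly_Mapping.single (rev w) c"
  by (simp add: rev_poly_def)

lemma rev_poly_rev_poly [simp]: "rev_poly (rev_poly f) = f"
  by (induction f rule: poly_mapping_induct_add) (simp_all add: rev_poly_linear)

lemma rev_poly_mult: "rev_poly (f * g) = rev_poly g * rev_poly f"
proof (induction f rule: poly_mapping_induct_add)
  case (single v c)
  show ?case
    by (induction g rule: poly_mapping_induct_add)
      (simp_all add: rev_poly_linear distrib_left distrib_right mult_single plus_list_def mult.commute)
qed (simp_all add: rev_poly_linear distrib_left distrib_right)

lemma rev_poly_xgen [simp]: "rev_poly (xgen B j h) = xgen B j h"
  by (simp add: xgen_def rev_poly_linear)

lemma rev_poly_diff_polys: "f \<in> diff_polys B \<Longrightarrow> rev_poly f \<in> diff_polys B"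
proof (induction f rule: diff_polys_induct)
  case (letter j b)
  then show ?case by (auto intro: single_in_diff_polys)
next
  case (mult j b f)
  then show ?case by (auto simp: rev_poly_mult intro!: diff_polys_mult single_in_diff_polys)
qed (simp_all add: rev_poly_linear pm.subspace_add[OF subspace_diff_polys]
  pm.subspace_scale[OF subspace_diff_polys] pm.subspace_0[OF subspace_diff_polys])

lemma rev_poly_dpoly_act: "rev_poly (dpoly_act B u f) = dpoly_act B u (rev_poly f)"
proof (induction f rule: poly_mapping_induct_add)
  case (single w c)
  have "rev_poly (dpoly_act B u (Poly_Mapping.single w 1)) = dpoly_act B u (Poly_Mapping.single (rev w) 1)"
  proof (induction w)
    case Nil
    show ?case by (simp add: dpoly_act_Nil rev_poly_linear)
  next
    case (Cons a w)
    have a: "dpoly_act B u (Poly_Mapping.single [a] 1) = xgen B (fst a) (lie_emb u * snd a)"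
      by (simp add: dpoly_act_Cons dpoly_act_Nil single_Nil)
    have "rev_poly (dpoly_act B u (Poly_Mapping.single (a # w) 1)) =
      Poly_Mapping.single (rev w) 1 * xgen B (fst a) (lie_emb u * snd a) +
      dpoly_act B u (Poly_Mapping.single (rev w) 1) * Poly_Mapping.single [a] 1"
      by (simp add: dpoly_act_Cons[of B u a w] rev_poly_linear rev_poly_mult Cons)
    then show ?case by (simp add: dpoly_act_append a)
  qed
  then show ?case
    using single_smul[of w c] single_smul[of "rev w" c] dpoly_act_linear(3) rev_poly_linear(3)
    by (metis rev_poly_single)
qed (simp_all add: dpoly_act_linear rev_poly_linear)

context
  fixes B :: "'f::field uea set" assumes B: "U.independent B" "U.span B = UNIV"
begin

interpretation F: L_algebra "free_L_algebra B" by (rule L_algebra_free[OF B])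

lemma rev_poly_uact:
  assumes f: "f \<in> diff_polys B"
  shows "rev_poly (uact (free_L_algebra B) h f) = uact (free_L_algebra B) h (rev_poly f)"
proof -
  have c: "f \<in> carr (free_L_algebra B)" "rev_poly f \<in> carr (free_L_algebra B)"
    using f rev_poly_diff_polys by simp_all
  show ?thesis
  proof (induction h rule: uea_induct)
    case one
    show ?case using F.uact_1[OF c(1)] F.uact_1[OF c(2)] by simp
  next
    case (lie u h)
    then show ?case
      by (simp add: F.uact_mult[OF c(1)] F.uact_mult[OF c(2)] F.uact_lie_emb F.uact_closed[OF c(1)]
        F.uact_closed[OF c(2)] rev_poly_dpoly_act
        F.uact_lie_emb[OF F.uact_closed[OF c(1)]] F.uact_lie_emb[OF F.uact_closed[OF c(2)]])
  next
    case (add g h)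
    then show ?case by (simp add: F.uact_add[OF c(1)] F.uact_add[OF c(2)] rev_poly_linear)
  next
    case (scale c h)
    then show ?case using F.uact_uscale[OF c(1), of c h] F.uact_uscale[OF c(2), of c h]
      by (simp add: rev_poly_linear)
  qed
qed

lemma rev_poly_subst:
  assumes f: "f \<in> diff_polys B" and \<psi>: "range \<psi> \<subseteq> diff_polys B"
  shows "dpoly_subst (free_L_algebra B) \<psi> (rev_poly f) =
    rev_poly (dpoly_subst (free_L_algebra B) (rev_poly \<circ> \<psi>) f)"
proof -
  have \<psi>': "range \<psi> \<subseteq> carr (free_L_algebra B)" "range (rev_poly \<circ> \<psi>) \<subseteq> carr (free_L_algebra B)"
    using \<psi> rev_poly_diff_polys by auto
  have u: "rev_poly (uact (free_L_algebra B) b (rev_poly (\<psi> j))) = uact (free_L_algebra B) b (\<psi> j)" for b j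
    using rev_poly_uact[of "rev_poly (\<psi> j)" b] \<psi>'(2) by (auto simp: image_subset_iff)
  show ?thesis using f
  proof (induction f rule: diff_polys_induct)
    case (letter j b)
    show ?case
      using F.dpoly_subst_letter[of \<psi> j b 1] F.dpoly_subst_letter[of "rev_poly \<circ> \<psi>" j b 1] u
      by (simp add: comp_def)
  next
    case (mult j b f)
    have l: "Poly_Mapping.single [(j, b)] 1 \<in> diff_polys B" using mult by (auto intro: single_in_diff_polys)
    have "dpoly_subst (free_L_algebra B) \<psi> (rev_poly (Poly_Mapping.single [(j, b)] 1 * f)) =
      dpoly_subst (free_L_algebra B) \<psi> (rev_poly f) * uact (free_L_algebra B) b (\<psi> j)"
      using F.dpoly_subst_mult[OF \<psi>'(1) rev_poly_diff_polys[OF mult(3)] l]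
        F.dpoly_subst_letter[of \<psi> j b 1] by (simp add: rev_poly_mult)
    moreover have "dpoly_subst (free_L_algebra B) (rev_poly \<circ> \<psi>) (Poly_Mapping.single [(j, b)] 1 * f) =
      uact (free_L_algebra B) b (rev_poly (\<psi> j)) * dpoly_subst (free_L_algebra B) (rev_poly \<circ> \<psi>) f"
      using F.dpoly_subst_letter_mult[OF \<psi>'(2) mult(3), of j b] by simp
    ultimately show ?case using mult by (simp add: rev_poly_mult u comp_def)
  next
    case (smul c f)
    then show ?case
      using F.dpoly_subst_linear(3)[of \<psi> c] F.dpoly_subst_linear(3)[of "rev_poly \<circ> \<psi>" c]
      by (simp add: rev_poly_linear comp_def)
  qed (simp_all add: rev_poly_linear F.dpoly_subst_linear)
qed

text \<open>
  Reversal is an anti-automorphism of the free algebra that commutes with \<open>L\<close> and with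
  substitutions, and a \<open>T\<^sub>L\<close>-ideal is two-sided.
\<close>

lemma T_L_ideal_rev:
  assumes I: "T_L_ideal B I"
  shows "T_L_ideal B (rev_poly ` I)"
proof -
  have mem: "f \<in> rev_poly ` I \<longleftrightarrow> rev_poly f \<in> I" for f
    by (metis image_iff rev_poly_rev_poly)
  have sub: "I \<subseteq> diff_polys B" "pm.subspace I" using I by (auto simp: T_L_ideal_def)
  show ?thesis
    unfolding T_L_ideal_def
  proof (intro conjI ballI allI impI)
    show "rev_poly ` I \<subseteq> diff_polys B" using sub rev_poly_diff_polys by auto
    show "pm.subspace (rev_poly ` I)"
      using sub(2) unfolding pm.subspace_def mem by (simp add: rev_poly_linear)
    fix f assume f: "f \<in> rev_poly ` I"
    then have fI: "rev_poly f \<in> I" using mem by simp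
    then have fD: "f \<in> diff_polys B" using sub rev_poly_diff_polys[of "rev_poly f" B] by auto
    show "f * g \<in> rev_poly ` I" "g * f \<in> rev_poly ` I" if "g \<in> diff_polys B" for g
      using fI rev_poly_diff_polys[OF that] I unfolding mem rev_poly_mult T_L_ideal_def by blast+
    show "uact (free_L_algebra B) h f \<in> rev_poly ` I" for h
      using fI I unfolding mem rev_poly_uact[OF fD] T_L_ideal_def by blast
    show "dpoly_subst (free_L_algebra B) \<psi> f \<in> rev_poly ` I" if \<psi>: "range \<psi> \<subseteq> diff_polys B" for \<psi>
    proof -
      have r: "range (rev_poly \<circ> \<psi>) \<subseteq> diff_polys B" using \<psi> rev_poly_diff_polys by auto
      have "rev_poly (dpoly_subst (free_L_algebra B) \<psi> f) =
        dpoly_subst (free_L_algebra B) (rev_poly \<circ> \<psi>) (rev_poly f)"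
        using rev_poly_subst[OF fD r] by (simp add: comp_def)
      also have "\<dots> \<in> I" using fI I r unfolding T_L_ideal_def by blast
      finally show ?thesis unfolding mem .
    qed
  qed
qed

lemma T_L_generated_rev:
  assumes S: "S \<subseteq> diff_polys B"
  shows "T_L_generated B (rev_poly ` S) = rev_poly ` T_L_generated B S"
proof
  have rS: "rev_poly ` S \<subseteq> diff_polys B" using S rev_poly_diff_polys by auto
  note gS = T_L_ideal_generated[OF B S] and gR = T_L_ideal_generated[OF B rS]
  show "T_L_generated B (rev_poly ` S) \<subseteq> rev_poly ` T_L_generated B S"
    by (rule gR(3)[OF T_L_ideal_rev[OF gS(1)]]) (use gS(2) in blast)
  have "T_L_generated B S \<subseteq> rev_poly ` T_L_generated B (rev_poly ` S)"
  proof (rule gS(3)[OF T_L_ideal_rev[OF gR(1)]])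
    have "rev_poly ` rev_poly ` S \<subseteq> rev_poly ` T_L_generated B (rev_poly ` S)"
      by (rule image_mono[OF gR(2)])
    then show "S \<subseteq> rev_poly ` T_L_generated B (rev_poly ` S)" by (simp add: image_image)
  qed
  then have "rev_poly ` T_L_generated B S \<subseteq> rev_poly ` rev_poly ` T_L_generated B (rev_poly ` S)"
    by (rule image_mono)
  then show "rev_poly ` T_L_generated B S \<subseteq> T_L_generated B (rev_poly ` S)" by (simp add: image_image)
qed

end

text \<open>
  Reflection in the antidiagonal: it fixes \<open>e\<^sub>1\<^sub>2\<close> and exchanges \<open>e\<^sub>1\<^sub>1\<close> with \<open>e\<^sub>2\<^sub>2\<close>.
\<close>

definition anti_transpose :: "'f ^ 2 ^ 2 \<Rightarrow> 'f::field ^ 2 ^ 2"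
  where "anti_transpose m = (\<chi> r s. m $ (if s = 1 then 2 else 1) $ (if r = 1 then 2 else 1))"

lemma anti_transpose_nth [simp]:
  "anti_transpose m $ 1 $ 1 = m $ 2 $ 2" "anti_transpose m $ 2 $ 2 = m $ 1 $ 1"
  "anti_transpose m $ 1 $ 2 = m $ 1 $ 2" "anti_transpose m $ 2 $ 1 = m $ 2 $ 1"
  by (simp_all add: anti_transpose_def)

lemma anti_transpose:
  "anti_transpose (anti_transpose m) = m"
  "anti_transpose (m ** m') = anti_transpose m' ** anti_transpose m"
  "anti_transpose (m + m') = anti_transpose m + anti_transpose m'"
  "anti_transpose (mat_scale c m) = mat_scale c (anti_transpose m)"
  "anti_transpose m = 0 \<longleftrightarrow> m = 0"
  "anti_transpose m \<in> carr M2D \<longleftrightarrow> m \<in> carr M1D"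
  "act M2D u (anti_transpose m) = anti_transpose (act M1D u m)"
  by (auto simp: mat2_eq_iff mat2_nth M1D_sel M2D_sel algebra_simps)

lemma mat_scale_1 [simp]: "mat_scale 1 m = m"
  by (simp add: mat2_eq_iff mat2_nth)

text \<open>
  Conjugation by \<^const>\<open>anti_transpose\<close> carries derivations of \<open>M\<^sub>2\<close> to derivations of \<open>M\<^sub>1\<close>.
\<close>

lemma derivations_M2D_iff:
  "d \<in> derivations (M2D :: ('f::field, 'f ^ 2 ^ 2) L_struct) \<longleftrightarrow>
    (\<exists>!u. \<forall>m\<in>carr M2D. d m = act M2D u m)"
proof
  assume d: "d \<in> derivations (M2D :: ('f, 'f ^ 2 ^ 2) L_struct)"
  let ?d = "\<lambda>m. anti_transpose (d (anti_transpose m))"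
  have mem: "anti_transpose m \<in> carr M2D" if "m \<in> carr M1D" for m :: "'f ^ 2 ^ 2"
    using that by (simp add: anti_transpose)
  have mem': "anti_transpose m \<in> carr M1D" if "m \<in> carr M2D" for m :: "'f ^ 2 ^ 2"
    using that anti_transpose(6)[of "anti_transpose m"] by (simp add: anti_transpose(1))
  have "?d \<in> derivations M1D"
    using d mem mem' unfolding derivations_def M1D_sel(2,3) M2D_sel(2,3)
    by (simp add: anti_transpose(1-4) add.commute)
  then have "\<exists>!u. \<forall>m\<in>carr M1D. ?d m = act M1D u m" by (simp only: derivations_M1D_iff)
  moreover have "(\<forall>m\<in>carr M1D. ?d m = act M1D u m) \<longleftrightarrow> (\<forall>m\<in>carr M2D. d m = act M2D u m)" for u
  proof (intro iffI ballI)
    fix m :: "'f ^ 2 ^ 2" assume "\<forall>m\<in>carr M1D. ?d m = act M1D u m" "m \<in> carr M2D"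
    then have "anti_transpose (?d (anti_transpose m)) = anti_transpose (act M1D u (anti_transpose m))"
      using mem' by simp
    then show "d m = act M2D u m" by (simp add: anti_transpose(1) flip: anti_transpose(7))
  next
    fix m :: "'f ^ 2 ^ 2" assume "\<forall>m\<in>carr M2D. d m = act M2D u m" "m \<in> carr M1D"
    then show "?d m = act M1D u m" using mem by (simp add: anti_transpose(1,7))
  qed
  ultimately show "\<exists>!u. \<forall>m\<in>carr M2D. d m = act M2D u m" by (simp only:)
next
  assume "\<exists>!u. \<forall>m\<in>carr M2D. d m = act M2D u m"
  then obtain u where "\<forall>m\<in>carr M2D. d m = act M2D u m" by auto
  then show "d \<in> derivations (M2D :: ('f, 'f ^ 2 ^ 2) L_struct)"
    using derivations_cong[OF L_algebra_M2D, of d "act M2D u"] L_algebra.act_derivation[OF L_algebra_M2D]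
    by blast
qed

interpretation M2: L_algebra M2D by (rule L_algebra_M2D)

lemma uact_M2D:
  assumes m: "m \<in> carr M1D"
  shows "uact M2D h (anti_transpose m) = anti_transpose (uact M1D h m)"
proof -
  have m2: "anti_transpose m \<in> carr M2D" using m by (simp add: anti_transpose)
  show ?thesis
  proof (induction h rule: uea_induct)
    case one
    show ?case by (simp add: M1.uact_1[OF m] M2.uact_1[OF m2])
  next
    case (lie u h)
    have "anti_transpose (uact M1D h m) \<in> carr M2D" using M1.uact_closed[OF m] by (simp add: anti_transpose)
    then show ?case
      using lie by (simp add: M1.uact_mult[OF m] M2.uact_mult[OF m2] M1.uact_lie_emb[OF M1.uact_closed[OF m]]
        M2.uact_lie_emb anti_transpose)
  next
    case (add g h)
    then show ?case by (simp add: M1.uact_add[OF m] M2.uact_add[OF m2] anti_transpose)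
  next
    case (scale c h)
    then show ?case
      by (simp add: M1.uact_uscale[OF m] M2.uact_uscale[OF m2] anti_transpose M1D_sel(2) M2D_sel(2))
  qed
qed

text \<open>
  An anti-isomorphism reverses products, hence the value of a word is the value of the reversed word.
\<close>

lemma dpoly_subst_M2D:
  assumes f: "f \<in> diff_polys B" and \<phi>: "range \<phi> \<subseteq> carr M1D"
  shows "dpoly_subst M2D (anti_transpose \<circ> \<phi>) (rev_poly f) = anti_transpose (dpoly_subst M1D \<phi> f)"
proof -
  have \<phi>2: "range (anti_transpose \<circ> \<phi>) \<subseteq> carr M2D" and \<phi>j: "\<phi> j \<in> carr M1D" for j
    using \<phi> by (auto simp: anti_transpose)
  show ?thesis using f
  proof (induction f rule: diff_polys_induct)
    case (letter j b)
    show ?case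
      using M1.dpoly_subst_letter[of \<phi> j b 1] M2.dpoly_subst_letter[of "anti_transpose \<circ> \<phi>" j b 1]
      by (simp add: M1D_sel(2) M2D_sel(2) uact_M2D[OF \<phi>j] anti_transpose comp_def)
  next
    case (mult j b f)
    have l: "Poly_Mapping.single [(j, b)] 1 \<in> diff_polys B" using mult by (auto intro: single_in_diff_polys)
    have "dpoly_subst M2D (anti_transpose \<circ> \<phi>) (rev_poly (Poly_Mapping.single [(j, b)] 1 * f)) =
      dpoly_subst M2D (anti_transpose \<circ> \<phi>) (rev_poly f) **
      dpoly_subst M2D (anti_transpose \<circ> \<phi>) (Poly_Mapping.single [(j, b)] 1)"
      using M2.dpoly_subst_mult[OF \<phi>2 rev_poly_diff_polys[OF mult(3)] l] by (simp add: rev_poly_mult M2D_sel(3))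
    also have "dpoly_subst M2D (anti_transpose \<circ> \<phi>) (Poly_Mapping.single [(j, b)] 1) =
      anti_transpose (uact M1D b (\<phi> j))"
      using M2.dpoly_subst_letter[of "anti_transpose \<circ> \<phi>" j b 1] M2.scale_one
      by (simp add: M2D_sel(2) uact_M2D[OF \<phi>j] comp_def)
    finally show ?case
      using mult M1.dpoly_subst_letter_mult[OF \<phi> mult(3), of j b] by (simp add: anti_transpose M1D_sel(3) comp_def)
  next
    case (smul c f)
    then show ?case
      by (simp add: rev_poly_linear M1.dpoly_subst_linear M2.dpoly_subst_linear anti_transpose
        M1D_sel(2) M2D_sel(2))
  next
    case zero
    show ?case by (simp add: rev_poly_linear M1.dpoly_subst_linear M2.dpoly_subst_linear anti_transpose)
  qed (simp add: rev_poly_linear M1.dpoly_subst_linear M2.dpoly_subst_linear anti_transpose)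
qed

lemma diff_ids_M2D_iff:
  fixes f :: "'f::field dpoly"
  shows "f \<in> diff_ids B M2D \<longleftrightarrow> rev_poly f \<in> diff_ids B M1D"
proof -
  have "(\<forall>\<phi>. range \<phi> \<subseteq> carr M2D \<longrightarrow> dpoly_subst M2D \<phi> f = 0) \<longleftrightarrow>
    (\<forall>\<phi>. range \<phi> \<subseteq> carr M1D \<longrightarrow> dpoly_subst M1D \<phi> (rev_poly f) = 0)" if f: "f \<in> diff_polys B"
  proof -
    note val = dpoly_subst_M2D[OF rev_poly_diff_polys[OF f], simplified]
    show ?thesis
    proof (intro iffI allI impI)
      fix \<phi> :: "nat \<Rightarrow> 'f ^ 2 ^ 2" assume "\<forall>\<phi>. range \<phi> \<subseteq> carr M2D \<longrightarrow> dpoly_subst M2D \<phi> f = 0" "range \<phi> \<subseteq> carr M1D"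
      moreover from this(2) have "range (anti_transpose \<circ> \<phi>) \<subseteq> carr M2D" by (auto simp: anti_transpose)
      ultimately show "dpoly_subst M1D \<phi> (rev_poly f) = 0" using val[of \<phi>] by (simp add: anti_transpose)
    next
      fix \<phi> :: "nat \<Rightarrow> 'f ^ 2 ^ 2" assume *: "\<forall>\<phi>. range \<phi> \<subseteq> carr M1D \<longrightarrow> dpoly_subst M1D \<phi> (rev_poly f) = 0" "range \<phi> \<subseteq> carr M2D"
      have "range (anti_transpose \<circ> \<phi>) \<subseteq> carr M1D"
        using *(2) by (auto simp: anti_transpose(6)[symmetric] anti_transpose(1))
      moreover have "anti_transpose \<circ> (anti_transpose \<circ> \<phi>) = \<phi>" by (auto simp: anti_transpose)
      ultimately show "dpoly_subst M2D \<phi> f = 0"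
        using *(1) val[of "anti_transpose \<circ> \<phi>"] by (simp add: anti_transpose del: o_apply)
    qed
  qed
  moreover have "f \<in> diff_polys B \<longleftrightarrow> rev_poly f \<in> diff_polys B"
    using rev_poly_diff_polys[of f B] rev_poly_diff_polys[of "rev_poly f" B] by auto
  ultimately show ?thesis by (auto simp: diff_ids_def)
qed

lemma diff_ids_M2D:
  fixes B :: "'f::field uea set"
  shows "diff_ids B M2D = rev_poly ` diff_ids B M1D"
proof (intro subset_antisym subsetI)
  fix f assume "f \<in> diff_ids B M2D"
  then have "rev_poly f \<in> diff_ids B M1D" by (simp only: diff_ids_M2D_iff)
  from imageI[OF this, of rev_poly] show "f \<in> rev_poly ` diff_ids B M1D" by simp
qed (auto simp: diff_ids_M2D_iff)

text \<open>
  The reversals of the generators for \<open>M\<^sub>1\<close> in \<open>x\<^sub>j\<close> and \<open>x\<^sub>i\<close> are those for \<open>M\<^sub>2\<close> in \<open>x\<^sub>i\<close> and \<open>x\<^sub>j\<close>, in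
  this order.
\<close>

lemma diff_ids_M2D_eq:
  fixes B :: "'f::field_char_0 uea set"
  assumes B: "U.independent B" "U.span B = UNIV" "1 \<in> B" and ij: "1 \<le> i" "1 \<le> j" "i \<noteq> j"
  shows "diff_ids B M2D = T_L_generated B
    {xgen B i U_eps * xgen B j 1,
     xgen B i 1 * xgen B j U_eps - xgen B j 1 * xgen B i U_eps -
       (xgen B i 1 * xgen B j 1 - xgen B j 1 * xgen B i 1),
     xgen B i (U_eps\<^sup>2) - xgen B i U_eps, xgen B i (U_del * U_eps),
     xgen B i (U_eps * U_del) - xgen B i U_del}"
proof -
  let ?S = "{xgen B j 1 * xgen B i U_eps,
     xgen B j U_eps * xgen B i 1 - xgen B i U_eps * xgen B j 1 -
       (xgen B j 1 * xgen B i 1 - xgen B i 1 * xgen B j 1),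
     xgen B i (U_eps\<^sup>2) - xgen B i U_eps, xgen B i (U_del * U_eps),
     xgen B i (U_eps * U_del) - xgen B i U_del}"
  interpret I: M1_T_ideal B "diff_ids B M1D" j i i by (rule M1_T_ideal_diff_ids) (use B ij in auto)
  have S: "?S \<subseteq> diff_polys B" using I.gens by (auto simp: diff_ids_def)
  have "diff_ids B M2D = rev_poly ` diff_ids B M1D" by (rule diff_ids_M2D)
  also have "\<dots> = rev_poly ` T_L_generated B ?S"
    using B ij by (subst diff_ids_M1D_eq[of B j i i]) auto
  also have "\<dots> = T_L_generated B (rev_poly ` ?S)"
    by (rule T_L_generated_rev[OF B(1,2) S, symmetric])
  finally show ?thesis by (simp add: rev_poly_linear rev_poly_mult)
qed

lemma perm_act_rev_poly: "rev_poly (perm_act \<sigma> f) = perm_act \<sigma> (rev_poly f)"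
proof (induction f rule: poly_mapping_induct_add)
  case (single w c)
  show ?case by (simp add: perm_act_single rev_map)
qed (simp_all add: perm_act_def pm.lin_ext_add rev_poly_linear)

lemma rev_poly_multilin:
  assumes "1 \<in> B" "1 \<le> n" "f \<in> multilin B n"
  shows "rev_poly f \<in> multilin B n"
  using assms
proof (induction f rule: multilin_induct)
  case (word l b w)
  have "Poly_Mapping.single (rev ((l, b) # w)) 1 \<in> multilin B n"
  proof (rule multilin_word[OF assms(1)])
    show "distinct (map fst (rev ((l, b) # w)))" using word(1) by (simp add: rev_map[symmetric])
    show "set (map fst (rev ((l, b) # w))) = {1..n}" using word(2) by simp
    show "snd ` set (rev ((l, b) # w)) \<subseteq> B" using word(3) by auto
  qed
  then show ?case by simp
qed (simp_all add: rev_poly_linear multilin_def pm.span_zero pm.span_add pm.span_scale)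

lemma dual_frame_M2D:
  assumes B: "U.independent B" "U.span B = UNIV" "1 \<in> (B :: 'f::field uea set)" and n: "1 \<le> n"
  shows "dual_frame smul (multilin B n) (multilin B n \<inter> diff_ids B M2D) (frame_index n)
    (\<lambda>i. rev_poly (frame_elem B n i)) (\<lambda>i f. frame_functional n i (rev_poly f))"
proof -
  note fr = dual_frame_M1D[OF B n]
  note rm = rev_poly_multilin[OF B(3) n]
  show ?thesis unfolding dual_frame_def
  proof (intro conjI ballI)
    show "(\<lambda>i. rev_poly (frame_elem B n i)) ` frame_index n \<subseteq> multilin B n"
      using fr rm by (auto simp: dual_frame_def simp del: One_nat_def)
    show "Vector_Spaces.linear smul (*) (\<lambda>f. frame_functional n i (rev_poly f) :: 'f)" for i
      by (rule linear_functionalI)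
        (simp_all add: rev_poly_linear linear_functional[OF linear_frame_functional])
    show "frame_functional n i (rev_poly w) = 0"
      if "i \<in> frame_index n" "w \<in> multilin B n \<inter> diff_ids B M2D" for i w
      using fr that rm[of w] by (auto simp: dual_frame_def diff_ids_M2D_iff)
    show "frame_functional n i (rev_poly (rev_poly (frame_elem B n j))) = of_bool (i = j)"
      if "i \<in> frame_index n" "j \<in> frame_index n" for i j
      using fr that by (simp add: dual_frame_def)
    fix v assume v: "v \<in> multilin B n"
    from fr rm[OF v] obtain a where
      a: "rev_poly v - (\<Sum>i\<in>frame_index n. smul (a i) (frame_elem B n i)) \<in> multilin B n \<inter> diff_ids B M1D"
      unfolding dual_frame_def by blast
    have "v - (\<Sum>i\<in>frame_index n. smul (a i) (rev_poly (frame_elem B n i))) =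
      rev_poly (rev_poly v - (\<Sum>i\<in>frame_index n. smul (a i) (frame_elem B n i)))"
      by (simp only: rev_poly_linear rev_poly_rev_poly)
    also have "\<dots> \<in> multilin B n \<inter> diff_ids B M2D"
      using a rm by (simp only: Int_iff diff_ids_M2D_iff rev_poly_rev_poly simp_thms)
    finally show "\<exists>a. v - (\<Sum>i\<in>frame_index n. smul (a i) (rev_poly (frame_elem B n i))) \<in>
      multilin B n \<inter> diff_ids B M2D" by blast
  qed simp
qed

lemma perm_act_diff_ids:
  assumes A: "L_algebra A" and B: "1 \<in> B" and n: "1 \<le> n" and \<sigma>: "\<sigma> permutes {1..n}"
    and f: "f \<in> multilin B n \<inter> diff_ids B A"
  shows "perm_act \<sigma> f \<in> multilin B n \<inter> diff_ids B A"
proof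
  show m: "perm_act \<sigma> f \<in> multilin B n" using f by (intro perm_act_multilin[OF B n \<sigma>]) simp
  have "range (\<phi> \<circ> \<sigma>) \<subseteq> carr A" if "range \<phi> \<subseteq> carr A" for \<phi> using that by auto
  then show "perm_act \<sigma> f \<in> diff_ids B A"
    using f m multilin_in_diff_polys[OF B n] by (auto simp: diff_ids_def dpoly_subst_perm_act[OF A] simp del: o_apply)
qed

lemma diff_codim_cochar_dual_frame:
  fixes B :: "'f::field_char_0 uea set"
  assumes B: "U.independent B" "U.span B = UNIV" "1 \<in> B" and n: "1 \<le> n"
    and A: "L_algebra A"
    and fr: "dual_frame smul (multilin B n) (multilin B n \<inter> diff_ids B A) (frame_index n) e \<phi>"
  shows "diff_codim B A n = n + 2"
    "\<sigma> permutes {1..n} \<Longrightarrow> diff_cochar B A n \<sigma> = (\<Sum>i\<in>frame_index n. \<phi> i (perm_act \<sigma> (e i)))"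
proof -
  have V: "pm.subspace (multilin B n)" by (simp add: multilin_def)
  have "pm.subspace (diff_ids B A)"
    using L_algebra.T_L_ideal_diff_ids[OF A B(1,2)] by (simp add: T_L_ideal_def)
  then have W: "pm.subspace (multilin B n \<inter> diff_ids B A)" using V by (intro pm.subspace_inter)
  show "diff_codim B A n = n + 2"
    unfolding diff_codim_def
    using quot_dim_dual_frame[OF pm.vector_space_axioms V W Int_lower1 fr] by simp
  show "diff_cochar B A n \<sigma> = (\<Sum>i\<in>frame_index n. \<phi> i (perm_act \<sigma> (e i)))" if "\<sigma> permutes {1..n}"
    unfolding diff_cochar_def
    by (rule pm.quot_trace_dual_frame[OF V W Int_lower1 fr linear_perm_act])
      (use perm_act_multilin[OF B(3) n that] perm_act_diff_ids[OF A B(3) n that] in blast)+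
qed

section \<open>The irreducible characters of shape \<open>(n)\<close> and \<open>(n - 1, 1)\<close>\<close>

lemma lookup_left_mult:
  assumes "bij \<sigma>"
  shows "Poly_Mapping.lookup (left_mult \<sigma> f) \<pi> = Poly_Mapping.lookup f (inv \<sigma> \<circ> \<pi>)"
proof (induction f rule: poly_mapping_induct_add)
  case (single p c)
  have "\<sigma> \<circ> p = \<pi> \<longleftrightarrow> p = inv \<sigma> \<circ> \<pi>"
    by (auto simp: fun_eq_iff bij_inv_eq_iff[OF assms])
  then show ?case by (simp add: left_mult_def lookup_single when_def del: o_apply)
qed (simp_all add: left_mult_def pm.lin_ext_add lookup_add)

lemma inv_comp_permutes_iff:
  assumes \<sigma>: "\<sigma> permutes S"
  shows "inv \<sigma> \<circ> \<pi> permutes S \<longleftrightarrow> \<pi> permutes S"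
proof
  assume "inv \<sigma> \<circ> \<pi> permutes S"
  then have "\<sigma> \<circ> (inv \<sigma> \<circ> \<pi>) permutes S" using \<sigma> by (rule permutes_compose)
  then show "\<pi> permutes S" using \<sigma> by (simp add: o_assoc permutes_inv_o)
qed (rule permutes_compose[OF _ permutes_inv[OF \<sigma>]])

lemma symmetrizer_row:
  "young_symmetrizer [n] = (\<Sum>p | p permutes {1..n}. Poly_Mapping.single p (1 :: 'f::field))"
proof -
  have tab: "{tableau [n] 0 j | j. j < n} = {1..n}"
    by (auto simp: tableau_def Suc_le_eq gr0_conv_Suc)
  have "row_group [n] = {p. p permutes {1..n}}"
    by (simp add: row_group_def tab permutes_image cong: conj_cong)
  moreover have "col_group [n] = {id}"
  proof -
    have "{tableau [n] i j | i. i < length [n] \<and> j < [n] ! i} = (if j < n then {j + 1} else {})" for j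
      by (auto simp: tableau_def)
    then have "q \<in> col_group [n] \<longleftrightarrow> q permutes {1..n} \<and> (\<forall>j<n. q (j + 1) = j + 1)" for q
      unfolding col_group_def by (auto split: if_splits)
    moreover have "q = id" if "q permutes {1..n}" "\<forall>j<n. q (j + 1) = j + 1" for q
    proof
      fix x show "q x = id x"
        using that(2)[rule_format, of "x - 1"] permutes_not_in[OF that(1), of x] by (cases "x \<in> {1..n}") auto
    qed
    ultimately show ?thesis by (auto simp: permutes_id)
  qed
  ultimately show ?thesis by (simp add: young_symmetrizer_def)
qed

text \<open>
  The symmetrizer is the sum of all permutations, so it is invariant and spans the module.
\<close>

lemma irr_char_row:
  assumes \<sigma>: "\<sigma> permutes {1..n}"
  shows "irr_char [n] \<sigma> = (1 :: 'f::field)"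
proof -
  let ?e = "young_symmetrizer [n] :: _ \<Rightarrow>\<^sub>0 'f"
  have lookup: "Poly_Mapping.lookup ?e \<pi> = of_bool (\<pi> permutes {1..n})" for \<pi>
    by (simp add: symmetrizer_row lookup_sum lookup_single when_def of_bool_def finite_permutations)
  have fix_e: "left_mult \<tau> ?e = ?e" if \<tau>: "\<tau> permutes {1..n}" for \<tau>
  proof (rule poly_mapping_eqI)
    fix \<pi>
    show "Poly_Mapping.lookup (left_mult \<tau> ?e) \<pi> = Poly_Mapping.lookup ?e \<pi>"
      unfolding lookup_left_mult[OF permutes_bij[OF \<tau>]] lookup inv_comp_permutes_iff[OF \<tau>] ..
  qed
  have "{left_mult \<tau> ?e | \<tau>. \<tau> permutes {1..sum_list [n]}} = {?e}"
    using fix_e by auto (metis permutes_id)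
  then have specht: "specht [n] = range (\<lambda>c. smul c ?e)"
    by (simp add: specht_def pm.span_singleton)
  have fr: "dual_frame smul (specht [n]) {0} {()} (\<lambda>_. ?e) (\<lambda>_ f. Poly_Mapping.lookup f id)"
    unfolding dual_frame_def
  proof (intro conjI ballI)
    show "\<exists>a. v - (\<Sum>i\<in>{()}. smul (a i) ?e) \<in> {0}" if v: "v \<in> specht [n]" for v
    proof -
      from v obtain c where "v = smul c ?e" by (auto simp: specht)
      then show ?thesis by (intro exI[of _ "\<lambda>_. c"]) simp
    qed
    have "?e \<in> specht [n]" unfolding specht by (rule range_eqI[of _ _ 1]) simp
    then show "(\<lambda>_. ?e) ` {()} \<subseteq> specht [n]" by simp
  qed (auto simp: lookup permutes_id lookup_add intro!: linear_functionalI)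
  have "irr_char [n] \<sigma> = (\<Sum>i\<in>{()}. Poly_Mapping.lookup (left_mult \<sigma> ?e) id)"
    unfolding irr_char_def
  proof (rule pm.quot_trace_dual_frame[OF _ _ _ fr])
    show "pm.subspace (specht [n])" by (simp add: specht_def)
    show "{0} \<subseteq> specht [n]" by (simp add: specht_def pm.span_zero)
    show "Vector_Spaces.linear smul smul (left_mult \<sigma>)" unfolding left_mult_def by (rule linear_lin_ext)
    show "left_mult \<sigma> ` specht [n] \<subseteq> (specht [n] :: (_ \<Rightarrow>\<^sub>0 'f) set)"
      using fix_e[OF \<sigma>] by (auto simp: specht left_mult_def pm.lin_ext_smul)
  qed (auto simp: left_mult_def pm.subspace_single_0)
  then show ?thesis using fix_e[OF \<sigma>] by (simp add: lookup permutes_id)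
qed

context
  fixes n :: nat assumes n: "2 \<le> n"
begin

lemma row_group_hook: "row_group [n - 1, 1] = {p. p permutes {1..n} \<and> p n = n}"
proof -
  have "p ` {1..n - 1} = {1..n - 1}" if p: "p permutes {1..n}" "p n = n" for p
  proof -
    have "p permutes {1..n - 1}"
    proof (rule permutes_superset[OF p(1)])
      fix x assume "x \<in> {1..n} - {1..n - 1}"
      then have "x = n" by auto
      then show "p x = x" using p by simp
    qed
    then show ?thesis by (rule permutes_image)
  qed
  moreover have "{tableau [n - 1, 1] 0 j | j. j < n - 1} = {1..n - 1}"
    by (auto simp: tableau_def Suc_le_eq gr0_conv_Suc)
  moreover have "{tableau [n - 1, 1] (Suc 0) j | j. j < 1} = {n}"
    using n by (auto simp: tableau_def)
  ultimately show ?thesis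
    using n by (auto simp: row_group_def less_Suc_eq)
qed

lemma col_group_hook: "col_group [n - 1, 1] = {id, Transposition.transpose 1 n}"
proof -
  have "{tableau [n - 1, 1] i j | i. i < length [n - 1, 1] \<and> j < [n - 1, 1] ! i} =
    (if j < n - 1 then {j + 1} else {}) \<union> (if j = 0 then {n} else {})" (is "?L = ?R") for j
  proof -
    have "x \<in> ?L \<longleftrightarrow> x = tableau [n - 1, 1] 0 j \<and> j < n - 1 \<or> x = tableau [n - 1, 1] 1 j \<and> j < 1" for x
    proof -
      have "x \<in> ?L \<longleftrightarrow> (\<exists>i. (i = 0 \<or> i = 1) \<and> x = tableau [n - 1, 1] i j \<and> j < [n - 1, 1] ! i)"
        by (simp add: less_Suc_eq conj_ac)
      then show ?thesis by (simp add: ex_disj_distrib conj_disj_distribR)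
    qed
    moreover have "tableau [n - 1, 1] 0 j = j + 1" "tableau [n - 1, 1] 1 j = n + j"
      using n by (simp_all add: tableau_def)
    ultimately show ?thesis by (intro set_eqI) (simp only:, simp)
  qed
  moreover have "(if j < n - 1 then {j + 1} else {}) \<union> (if j = 0 then {n} else {}) =
    (if j = 0 then {1, n} else if j < n - 1 then {j + 1} else {})" for j
    using n by auto
  ultimately have T: "{tableau [n - 1, 1] i j | i. i < length [n - 1, 1] \<and> j < [n - 1, 1] ! i} =
    (if j = 0 then {1, n} else if j < n - 1 then {j + 1} else {})" (is "_ = ?S j") for j by (rule trans)
  have sl: "sum_list [n - 1, 1] = n" using n by simp
  have col: "q \<in> col_group [n - 1, 1] \<longleftrightarrow> q permutes {1..n} \<and> (\<forall>j. q ` ?S j = ?S j)" for q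
    by (simp only: col_group_def mem_Collect_eq sl T)
  have eq: "q \<in> col_group [n - 1, 1] \<longleftrightarrow> q permutes {1, n}" for q
    unfolding col
  proof
    assume q: "q permutes {1..n} \<and> (\<forall>j. q ` ?S j = ?S j)"
    show "q permutes {1, n}"
    proof (rule permutes_superset[OF q[THEN conjunct1]])
      fix x assume x: "x \<in> {1..n} - {1, n}"
      then have "x - 1 \<noteq> 0" "x - 1 < n - 1" "x - 1 + 1 = x" by auto
      then show "q x = x" using q[THEN conjunct2, rule_format, of "x - 1"] by simp
    qed
  next
    assume q: "q permutes {1, n}"
    have "q ` ?S j = ?S j" for j
    proof (cases "j = 0 \<or> \<not> j < n - 1")
      case False
      then have "q (j + 1) = j + 1" by (intro permutes_not_in[OF q]) auto
      then show ?thesis using False by (simp only: if_False if_True image_insert image_empty de_Morgan_disj not_not)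
    qed (use permutes_image[OF q] in \<open>simp only: if_False if_True image_empty split: if_split; blast\<close>)
    moreover have "q permutes {1..n}" by (rule permutes_subset[OF q]) (use n in auto)
    ultimately show "q permutes {1..n} \<and> (\<forall>j. q ` ?S j = ?S j)" by blast
  qed
  show ?thesis
    by (rule set_eqI) (simp only: eq permutes_doubleton_iff insert_iff empty_iff simp_thms)
qed

text \<open>
  The coefficient of \<open>\<pi>\<close> in this vector is \<open>1\<close> for \<open>\<pi> n = k\<close> and \<open>-1\<close> for \<open>\<pi> 1 = k\<close>; see
  \<open>lookup_hook_vec\<close>. The transposition is a convenient permutation that sends \<open>n\<close> to \<open>k\<close>.
\<close>

definition hook_vec :: "nat \<Rightarrow> (nat \<Rightarrow> nat) \<Rightarrow>\<^sub>0 'f::field"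
  where "hook_vec k = left_mult (Transposition.transpose k n) (young_symmetrizer [n - 1, 1])"

text \<open>
  The row group is the stabilizer of \<open>n\<close> and the column group is generated by the transposition of
  \<open>1\<close> and \<open>n\<close>. So the symmetrizer is the sum of the \<open>\<pi>\<close> with \<open>\<pi> n = n\<close> minus the sum of those with
  \<open>\<pi> 1 = n\<close>, and translation by \<open>\<sigma>\<close> replaces the value \<open>n\<close> by \<open>\<sigma> n\<close>.
\<close>

lemma lookup_translate:
  assumes \<sigma>: "\<sigma> permutes {1..n}"
  shows "Poly_Mapping.lookup (left_mult \<sigma> (young_symmetrizer [n - 1, 1])) \<pi> =
    (if \<pi> permutes {1..n} then of_bool (\<pi> n = \<sigma> n) - of_bool (\<pi> 1 = \<sigma> n) else (0 :: 'f::field))"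
proof -
  let ?R = "{p. p permutes {1..n} \<and> p n = n}" and ?t = "Transposition.transpose 1 n"
  have t: "?t permutes {1..n}" using n by (intro permutes_swap_id) auto
  have fin: "finite ?R" by (rule finite_subset[OF _ finite_permutations[of "{1..n}"]]) auto
  have 1: "1 \<noteq> n" using n by simp
  have tt: "?t \<circ> ?t = id" by (rule transpose_comp_involutory)
  have "id n \<noteq> ?t n" using 1 by simp
  then have "id \<noteq> ?t" by metis
  then have sum_q: "(\<Sum>q\<in>{id, ?t}. Poly_Mapping.single (p \<circ> q) (of_int (sign q))) =
    Poly_Mapping.single p (1 :: 'f) + Poly_Mapping.single (p \<circ> ?t) (- 1)" for p :: "nat \<Rightarrow> nat"
    using 1 by (simp add: sign_swap_id)
  have e: "young_symmetrizer [n - 1, 1] =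
    (\<Sum>p\<in>?R. Poly_Mapping.single p (1 :: 'f) + Poly_Mapping.single (p \<circ> ?t) (- 1))"
    unfolding young_symmetrizer_def row_group_hook col_group_hook sum_q ..
  have pt: "(p \<circ> ?t = \<rho>) = (p = \<rho> \<circ> ?t)" for p \<rho> :: "nat \<Rightarrow> nat"
    using tt by (metis comp_assoc comp_id)
  have "Poly_Mapping.lookup (young_symmetrizer [n - 1, 1]) \<rho> =
    of_bool (\<rho> \<in> ?R) - (of_bool (\<rho> \<circ> ?t \<in> ?R) :: 'f)" for \<rho>
  proof -
    have "Poly_Mapping.lookup (young_symmetrizer [n - 1, 1]) \<rho> =
      (\<Sum>p\<in>?R. if p = \<rho> then 1 else (0 :: 'f)) - (\<Sum>p\<in>?R. if p = \<rho> \<circ> ?t then 1 else 0)"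
      unfolding e by (simp add: lookup_sum lookup_add lookup_single when_def pt sum.distrib
        if_distrib[of uminus] sum_negf[symmetric] del: mem_Collect_eq One_nat_def cong: if_cong)
    also have "\<dots> = of_bool (\<rho> \<in> ?R) - of_bool (\<rho> \<circ> ?t \<in> ?R)"
      using fin by (simp only: sum.delta' sum.delta of_bool_def)
    finally show ?thesis .
  qed
  then have "Poly_Mapping.lookup (left_mult \<sigma> (young_symmetrizer [n - 1, 1])) \<pi> =
    of_bool (inv \<sigma> \<circ> \<pi> \<in> ?R) - (of_bool (inv \<sigma> \<circ> \<pi> \<circ> ?t \<in> ?R) :: 'f)"
    unfolding lookup_left_mult[OF permutes_bij[OF \<sigma>]] .
  moreover have R: "inv \<sigma> \<circ> \<rho> \<in> ?R \<longleftrightarrow> \<rho> permutes {1..n} \<and> \<rho> n = \<sigma> n" for \<rho>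
    unfolding mem_Collect_eq inv_comp_permutes_iff[OF \<sigma>] o_apply permutes_inv_eq[OF \<sigma>]
    by (auto simp del: One_nat_def)
  moreover have "\<pi> \<circ> ?t permutes {1..n} \<longleftrightarrow> \<pi> permutes {1..n}"
  proof
    assume "\<pi> \<circ> ?t permutes {1..n}"
    from permutes_compose[OF t this] show "\<pi> permutes {1..n}"
      by (simp only: comp_assoc tt comp_id)
  qed (rule permutes_compose[OF t])
  moreover have "(\<pi> \<circ> ?t) n = \<pi> 1" by simp
  ultimately show ?thesis by (simp only: comp_assoc R) simp
qed

lemma lookup_hook_vec:
  assumes "k \<in> {1..n}"
  shows "Poly_Mapping.lookup (hook_vec k) \<pi> =
    (if \<pi> permutes {1..n} then of_bool (\<pi> n = k) - of_bool (\<pi> 1 = k) else (0 :: 'f::field))"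
  unfolding hook_vec_def using assms n by (subst lookup_translate) (auto intro!: permutes_swap_id)

lemma translate_hook_vec:
  assumes \<sigma>: "\<sigma> permutes {1..n}" and k: "k \<in> {1..n}"
  shows "left_mult \<sigma> (hook_vec k) = (hook_vec (\<sigma> k) :: _ \<Rightarrow>\<^sub>0 'f::field)"
proof (rule poly_mapping_eqI)
  fix \<pi>
  have \<sigma>k: "\<sigma> k \<in> {1..n}" using permutes_in_image[OF \<sigma>] k by blast
  show "Poly_Mapping.lookup (left_mult \<sigma> (hook_vec k)) \<pi> = (Poly_Mapping.lookup (hook_vec (\<sigma> k)) \<pi> :: 'f)"
    unfolding lookup_left_mult[OF permutes_bij[OF \<sigma>]] lookup_hook_vec[OF k] lookup_hook_vec[OF \<sigma>k]
      inv_comp_permutes_iff[OF \<sigma>] o_apply permutes_inv_eq[OF \<sigma>] eq_commute[of _ "\<sigma> k"] by (rule refl)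
qed

lemma translate_symmetrizer:
  assumes \<sigma>: "\<sigma> permutes {1..n}"
  shows "left_mult \<sigma> (young_symmetrizer [n - 1, 1]) = (hook_vec (\<sigma> n) :: _ \<Rightarrow>\<^sub>0 'f::field)"
proof (rule poly_mapping_eqI)
  fix \<pi>
  have *: "\<sigma> n \<in> {1..n}" using permutes_in_image[OF \<sigma>, of n] n by auto
  show "Poly_Mapping.lookup (left_mult \<sigma> (young_symmetrizer [n - 1, 1])) \<pi> =
    (Poly_Mapping.lookup (hook_vec (\<sigma> n)) \<pi> :: 'f)"
    unfolding lookup_translate[OF \<sigma>] lookup_hook_vec[OF *] ..
qed

lemma specht_hook: "specht [n - 1, 1] = pm.span ((hook_vec :: _ \<Rightarrow> _ \<Rightarrow>\<^sub>0 'f::field) ` {1..n})"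
proof -
  have "{left_mult \<sigma> (young_symmetrizer [n - 1, 1]) | \<sigma>. \<sigma> permutes {1..n}} =
    (hook_vec :: _ \<Rightarrow> _ \<Rightarrow>\<^sub>0 'f) ` {1..n}" (is "?L = ?R")
  proof
    show "?L \<subseteq> ?R"
    proof
      fix f :: "_ \<Rightarrow>\<^sub>0 'f" assume "f \<in> ?L"
      then obtain \<sigma> where \<sigma>: "f = left_mult \<sigma> (young_symmetrizer [n - 1, 1])" "\<sigma> permutes {1..n}"
        by blast
      moreover have "\<sigma> n \<in> {1..n}" using permutes_in_image[OF \<sigma>(2), of n] n by auto
      ultimately show "f \<in> ?R" unfolding translate_symmetrizer[OF \<sigma>(2)] by blast
    qed
    show "?R \<subseteq> ?L"
    proof
      fix f :: "_ \<Rightarrow>\<^sub>0 'f" assume "f \<in> ?R"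
      then obtain k where "f = hook_vec k" "k \<in> {1..n}" by blast
      moreover have "Transposition.transpose k n permutes {1..n}"
        using \<open>k \<in> {1..n}\<close> n by (intro permutes_swap_id) auto
      ultimately show "f \<in> ?L" unfolding hook_vec_def by blast
    qed
  qed
  moreover have "sum_list [n - 1, 1] = n" using n by simp
  ultimately show ?thesis by (simp only: specht_def)
qed

lemma sum_hook_vec: "(\<Sum>k\<in>{1..n}. hook_vec k) = (0 :: _ \<Rightarrow>\<^sub>0 'f::field)"
proof (rule poly_mapping_eqI)
  fix \<pi> :: "nat \<Rightarrow> nat"
  have one: "(\<Sum>k\<in>{1..n}. of_bool (\<pi> m = k) :: 'f) = 1" if "\<pi> permutes {1..n}" "m \<in> {1..n}" for m
  proof -
    have "\<pi> m \<in> {1..n}" using permutes_in_image[OF that(1)] that(2) by blast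
    have "(\<Sum>k\<in>{1..n}. of_bool (\<pi> m = k) :: 'f) = (\<Sum>k\<in>{1..n}. if \<pi> m = k then 1 else 0)"
      unfolding of_bool_def ..
    also have "\<dots> = 1" using \<open>\<pi> m \<in> {1..n}\<close> by (subst sum.delta') auto
    finally show ?thesis .
  qed
  have "Poly_Mapping.lookup (\<Sum>k\<in>{1..n}. hook_vec k) \<pi> = (\<Sum>k\<in>{1..n}.
    if \<pi> permutes {1..n} then of_bool (\<pi> n = k) - of_bool (\<pi> 1 = k) else (0 :: 'f))"
    unfolding lookup_sum by (rule sum.cong[OF refl]) (rule lookup_hook_vec)
  also have "\<dots> = 0"
  proof (cases "\<pi> permutes {1..n}")
    case True
    have "(\<Sum>k\<in>{1..n}. of_bool (\<pi> n = k) - of_bool (\<pi> 1 = k) :: 'f) = 1 - 1"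
      unfolding sum_subtractf by (intro arg_cong2[of _ _ _ _ minus] one[OF True]) (use n in auto)
    then show ?thesis using True by simp
  qed simp
  finally show "Poly_Mapping.lookup (\<Sum>k\<in>{1..n}. hook_vec k) \<pi> = (Poly_Mapping.lookup 0 \<pi> :: 'f)"
    by simp
qed

text \<open>
  The vectors with \<open>k < n\<close> form a basis, dual to the coefficients at permutations that send \<open>1\<close> to
  \<open>n\<close> and \<open>n\<close> to \<open>k\<close>. In this basis the diagonal entry of \<open>\<sigma>\<close> at \<open>k\<close> is \<open>[\<sigma> k = k] - [\<sigma> k = n]\<close>, where
  the second term comes from \<open>hook_vec n = - \<Sum>\<^sub>k\<^sub><\<^sub>n hook_vec k\<close>.
\<close>

lemma irr_char_hook:
  assumes \<sigma>: "\<sigma> permutes {1..n}"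
  shows "irr_char [n - 1, 1] \<sigma> = (of_nat (card {k \<in> {1..n}. \<sigma> k = k}) - 1 :: 'f::field)"
proof -
  let ?v = "hook_vec :: nat \<Rightarrow> _ \<Rightarrow>\<^sub>0 'f"
  let ?I = "{1..n - 1}"
  define \<pi> where "\<pi> k = Transposition.transpose 1 k \<circ> Transposition.transpose 1 n" for k :: nat
  have \<pi>: "\<pi> k permutes {1..n}" "\<pi> k n = k" "\<pi> k 1 = n" if "k \<in> ?I" for k
    using that n by (auto simp: \<pi>_def intro!: permutes_compose permutes_swap_id)
  have dual: "Poly_Mapping.lookup (?v m) (\<pi> k) = of_bool (m = k) - of_bool (m = n)"
    if "k \<in> ?I" "m \<in> {1..n}" for k m
    using that \<pi>[OF that(1)] by (auto simp: lookup_hook_vec)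
  have I: "{1..n} = insert n ?I" "n \<notin> ?I" using n by auto
  have vn: "?v n = (\<Sum>k\<in>?I. smul (- 1) (?v k))"
  proof -
    have "?v n + sum ?v ?I = sum ?v {1..n}" unfolding I(1) using I(2) by (subst sum.insert) auto
    also have "\<dots> = 0" by (rule sum_hook_vec)
    finally show ?thesis
      by (simp add: pm.scale_minus_left sum_negf eq_neg_iff_add_eq_0)
  qed
  have span: "specht [n - 1, 1] = pm.span (?v ` ?I)"
  proof -
    have "?v n \<in> pm.span (?v ` ?I)"
      unfolding vn by (intro pm.span_sum pm.span_scale pm.span_base) auto
    then show ?thesis unfolding specht_hook I(1) by (simp add: pm.span_redundant)
  qed
  have fr: "dual_frame smul (specht [n - 1, 1]) {0} ?I ?v (\<lambda>k f. Poly_Mapping.lookup f (\<pi> k))"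
    unfolding dual_frame_def
  proof (intro conjI ballI)
    show "?v ` ?I \<subseteq> specht [n - 1, 1]" unfolding span by (rule pm.span_superset)
    show "Poly_Mapping.lookup (?v j) (\<pi> i) = of_bool (i = j)" if "i \<in> ?I" "j \<in> ?I" for i j
      using that by (subst dual) auto
    fix v assume "v \<in> (specht [n - 1, 1] :: (_ \<Rightarrow>\<^sub>0 'f) set)"
    then show "\<exists>a. v - (\<Sum>i\<in>?I. smul (a i) (?v i)) \<in> {0}"
      unfolding span
    proof (induction rule: pm.span_induct_alt)
      case base
      show ?case by (rule exI[of _ "\<lambda>_. 0"]) simp
    next
      case (step c x y)
      then obtain a k where "y = (\<Sum>i\<in>?I. smul (a i) (?v i))" "k \<in> ?I" "x = ?v k" by auto
      then have "smul c x + y = (\<Sum>i\<in>?I. smul ((if i = k then c else 0) + a i) (?v i))"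
        by (simp add: pm.scale_left_distrib sum.distrib if_distrib[of "\<lambda>c. smul c _"] cong: if_cong)
      then show ?case by auto
    qed
  qed (auto simp: lookup_add intro!: linear_functionalI)
  have "irr_char [n - 1, 1] \<sigma> = (\<Sum>k\<in>?I. Poly_Mapping.lookup (left_mult \<sigma> (?v k)) (\<pi> k))"
    unfolding irr_char_def
  proof (rule pm.quot_trace_dual_frame[OF _ _ _ fr])
    interpret T: Vector_Spaces.linear smul smul "left_mult \<sigma> :: _ \<Rightarrow> _ \<Rightarrow>\<^sub>0 'f"
      unfolding left_mult_def by (rule linear_lin_ext)
    show "Vector_Spaces.linear smul smul (left_mult \<sigma> :: _ \<Rightarrow> _ \<Rightarrow>\<^sub>0 'f)" by (rule T.linear_axioms)
    have "left_mult \<sigma> ` (?v ` {1..n}) \<subseteq> ?v ` {1..n}"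
      using translate_hook_vec[OF \<sigma>, where 'f = 'f] permutes_in_image[OF \<sigma>] by auto
    then show "left_mult \<sigma> ` specht [n - 1, 1] \<subseteq> (specht [n - 1, 1] :: (_ \<Rightarrow>\<^sub>0 'f) set)"
      unfolding specht_hook T.span_image[symmetric] by (rule pm.span_mono)
    show "left_mult \<sigma> ` {0} \<subseteq> {0 :: _ \<Rightarrow>\<^sub>0 'f}" by (simp add: T.zero)
    show "pm.subspace (specht [n - 1, 1] :: (_ \<Rightarrow>\<^sub>0 'f) set)" by (simp add: specht_def)
    show "{0} \<subseteq> (specht [n - 1, 1] :: (_ \<Rightarrow>\<^sub>0 'f) set)" by (simp add: specht_def pm.span_zero)
  qed (simp add: pm.subspace_single_0)
  also have "\<dots> = (\<Sum>k\<in>?I. of_bool (\<sigma> k = k) - of_bool (\<sigma> k = n))"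
  proof (rule sum.cong[OF refl])
    fix k assume k: "k \<in> ?I"
    then have k': "k \<in> {1..n}" by auto
    then show "Poly_Mapping.lookup (left_mult \<sigma> (?v k)) (\<pi> k) = of_bool (\<sigma> k = k) - of_bool (\<sigma> k = n)"
      using permutes_in_image[OF \<sigma>, of k] by (simp only: translate_hook_vec[OF \<sigma> k'] dual[OF k])
  qed
  \<comment> \<open>The term for \<open>k = n\<close> is \<open>0\<close>.\<close>
  also have "\<dots> = (\<Sum>k\<in>{1..n}. of_bool (\<sigma> k = k) - of_bool (\<sigma> k = n))"
    unfolding I(1) using I(2) by simp
  also have "\<dots> = of_nat (card {k \<in> {1..n}. \<sigma> k = k}) - (\<Sum>k\<in>{1..n}. of_bool (\<sigma> k = n))"
    by (simp add: sum_subtractf of_bool_def sum.If_cases Int_def)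
  also have "(\<Sum>k\<in>{1..n}. of_bool (\<sigma> k = n)) = (\<Sum>k\<in>{1..n}. of_bool (k = inv \<sigma> n) :: 'f)"
    by (intro sum.cong refl arg_cong[of _ _ of_bool]) (metis permutes_inv_eq[OF \<sigma>])
  also have "\<dots> = 1"
    using permutes_in_image[OF permutes_inv[OF \<sigma>], of n] n by (simp add: of_bool_def)
  finally show ?thesis .
qed

end

lemma irr_char_decomposition:
  assumes n: "1 \<le> n" and \<sigma>: "\<sigma> permutes {1..n}"
  shows "3 * irr_char [n] \<sigma> + (if n = 1 then 0 else irr_char [n - 1, 1] \<sigma>) =
    (of_nat (card {k \<in> {1..n}. \<sigma> k = k}) + 2 :: 'f::field)"
proof (cases "n = 1")
  case True
  then have "{k \<in> {1..n}. \<sigma> k = k} = {1}" using permutes_in_image[OF \<sigma>, of 1] by auto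
  then show ?thesis using True irr_char_row[OF \<sigma>, where 'f = 'f] by simp
next
  case False
  then show ?thesis
    using n irr_char_row[OF \<sigma>, where 'f = 'f] irr_char_hook[OF _ \<sigma>, where 'f = 'f] by simp
qed

section \<open>The differential identities, codimensions and cocharacters of \<open>M\<^sub>1\<close> and \<open>M\<^sub>2\<close>\<close>

theorem theorem9:
  fixes B :: "'f::field_char_0 uea set" and i j :: nat
  assumes "U.independent B" and "U.span B = UNIV" and "1 \<in> B"
    and "1 \<le> i" and "1 \<le> j" and "i \<noteq> j"
  shows
    "(\<forall>d. d \<in> derivations (M1D :: ('f, 'f ^ 2 ^ 2) L_struct) \<longleftrightarrow>
        (\<exists>!u. \<forall>m\<in>carr M1D. d m = act M1D u m)) \<and>
     (\<forall>d. d \<in> derivations (M2D :: ('f, 'f ^ 2 ^ 2) L_struct) \<longleftrightarrow>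
        (\<exists>!u. \<forall>m\<in>carr M2D. d m = act M2D u m)) \<and>
     (let x = xgen B i; y = xgen B j; \<epsilon> = lie_emb lie_eps; \<delta> = lie_emb lie_del in
        diff_ids B M1D = T_L_generated B
          {x 1 * y \<epsilon>, x \<epsilon> * y 1 - y \<epsilon> * x 1 - (x 1 * y 1 - y 1 * x 1),
           x (\<epsilon>\<^sup>2) - x \<epsilon>, x (\<delta> * \<epsilon>), x (\<epsilon> * \<delta>) - x \<delta>} \<and>
        diff_ids B M2D = T_L_generated B
          {x \<epsilon> * y 1, x 1 * y \<epsilon> - y 1 * x \<epsilon> - (x 1 * y 1 - y 1 * x 1),
           x (\<epsilon>\<^sup>2) - x \<epsilon>, x (\<delta> * \<epsilon>), x (\<epsilon> * \<delta>) - x \<delta>}) \<and>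
     (\<forall>n\<ge>1. diff_codim B M1D n = n + 2 \<and> diff_codim B M2D n = n + 2) \<and>
     (\<forall>n\<ge>1. \<forall>\<sigma>. \<sigma> permutes {1..n} \<longrightarrow>
        diff_cochar B M1D n \<sigma> = 3 * irr_char [n] \<sigma> + (if n = 1 then 0 else irr_char [n - 1, 1] \<sigma>) \<and>
        diff_cochar B M2D n \<sigma> = 3 * irr_char [n] \<sigma> + (if n = 1 then 0 else irr_char [n - 1, 1] \<sigma>))"
proof (intro conjI)
  note B = assms(1-3) and ij = assms(4-6)
  show "\<forall>d. d \<in> derivations (M1D :: ('f, 'f ^ 2 ^ 2) L_struct) \<longleftrightarrow>
        (\<exists>!u. \<forall>m\<in>carr M1D. d m = act M1D u m)"
    by (intro allI derivations_M1D_iff)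
  show "\<forall>d. d \<in> derivations (M2D :: ('f, 'f ^ 2 ^ 2) L_struct) \<longleftrightarrow>
        (\<exists>!u. \<forall>m\<in>carr M2D. d m = act M2D u m)"
    by (intro allI derivations_M2D_iff)
  show "let x = xgen B i; y = xgen B j; \<epsilon> = lie_emb lie_eps; \<delta> = lie_emb lie_del in
        diff_ids B M1D = T_L_generated B
          {x 1 * y \<epsilon>, x \<epsilon> * y 1 - y \<epsilon> * x 1 - (x 1 * y 1 - y 1 * x 1),
           x (\<epsilon>\<^sup>2) - x \<epsilon>, x (\<delta> * \<epsilon>), x (\<epsilon> * \<delta>) - x \<delta>} \<and>
        diff_ids B M2D = T_L_generated B
          {x \<epsilon> * y 1, x 1 * y \<epsilon> - y 1 * x \<epsilon> - (x 1 * y 1 - y 1 * x 1),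
           x (\<epsilon>\<^sup>2) - x \<epsilon>, x (\<delta> * \<epsilon>), x (\<epsilon> * \<delta>) - x \<delta>}"
    unfolding Let_def
    by (intro conjI diff_ids_M1D_eq[OF B ij ij(1)] diff_ids_M2D_eq[OF B ij])
  show "\<forall>n\<ge>1. diff_codim B M1D n = n + 2 \<and> diff_codim B M2D n = n + 2"
    using diff_codim_cochar_dual_frame(1)[OF B _ L_algebra_M1D dual_frame_M1D[OF B]]
      diff_codim_cochar_dual_frame(1)[OF B _ L_algebra_M2D dual_frame_M2D[OF B]] by blast
  show "\<forall>n\<ge>1. \<forall>\<sigma>. \<sigma> permutes {1..n} \<longrightarrow>
        diff_cochar B M1D n \<sigma> = 3 * irr_char [n] \<sigma> + (if n = 1 then 0 else irr_char [n - 1, 1] \<sigma>) \<and>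
        diff_cochar B M2D n \<sigma> = 3 * irr_char [n] \<sigma> + (if n = 1 then 0 else irr_char [n - 1, 1] \<sigma>)"
  proof (intro allI impI)
    fix n \<sigma> assume n: "1 \<le> (n :: nat)" and \<sigma>: "\<sigma> permutes {1..n}"
    have "diff_cochar B M1D n \<sigma> = of_nat (card {k \<in> {1..n}. \<sigma> k = k}) + 2"
      unfolding diff_codim_cochar_dual_frame(2)[OF B n L_algebra_M1D dual_frame_M1D[OF B n] \<sigma>]
      by (rule frame_trace[OF B n \<sigma>])
    moreover have "diff_cochar B M2D n \<sigma> = of_nat (card {k \<in> {1..n}. \<sigma> k = k}) + 2"
      unfolding diff_codim_cochar_dual_frame(2)[OF B n L_algebra_M2D dual_frame_M2D[OF B n] \<sigma>]
        perm_act_rev_poly rev_poly_rev_poly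
      by (rule frame_trace[OF B n \<sigma>])
    ultimately show "diff_cochar B M1D n \<sigma> = 3 * irr_char [n] \<sigma> + (if n = 1 then 0 else irr_char [n - 1, 1] \<sigma>) \<and>
        diff_cochar B M2D n \<sigma> = 3 * irr_char [n] \<sigma> + (if n = 1 then 0 else irr_char [n - 1, 1] \<sigma>)"
      unfolding irr_char_decomposition[OF n \<sigma>] by blast
  qed
qed

end
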